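(* Let $k\ge3$, $a=\lfloor k/2\rfloor$, $b=k-a$, and let $\bm{T}\in(\mathbb{R}^d)^{\otimes k}$ be a deterministic symmetric tensor with unfolding parameters $(\textsc{r},\alpha,\mu)$ such that $\textsc{r}\le r_{\max}(d;k)$, where $r_{\max}(d;k)=d^{3/4}$ for $k=3$, $d^{k/2}$ for $k\ge4$ even, $d^{k/2-1}$ for $k\ge5$ odd. Fix $t\ge1$, set $\varpi=\alpha\textsc{r}/\mu$, and suppose \[\frac{32(k\log d)^4t^{1/2}\varpi}{d^{k/2}}\le\delta\le\frac{t\varpi}{d^a}.\] Let $\widehat{\bm{T}}^\star$ be the estimator of the Bernoulli-model procedure described in the context, with threshold $\lambda_\star=\eta(t)^{2/3}\|B\|_{\mathrm{op}}$, where $\eta(t)=8(k\log d)^4t^{1/2}\varpi/(d^{k/2}\delta)$. Then, with $\vartheta=\alpha\textsc{r}/(\delta d^{k/2})$, \[\|\bm{T}-\widehat{\bm{T}}^\star\|_{\mathrm F}\le20(k\log d)^{4/3}(t\mu)^{1/6}\vartheta^{1/3}\|\bm{T}\|_{\mathrm F}\] with probability at least $1-3d^k\exp\{-\tfrac18(k\log d)^2\}$.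
   Context: A tensor $\bm T\in(\mathbb{R}^d)^{\otimes k}$ is symmetric if its entries are invariant under permutation of indices. $\mathrm{unfold}^{a\times b}(\bm T)$ is the $d^a\times d^b$ matrix $X_{\vec i,\vec\ell}=\bm T_{(\vec i,\vec\ell)}$. $\bm T$ has unfolding parameters $(\textsc{r},\alpha,\mu)$ if $X=\mathrm{unfold}^{\lfloor k/2\rfloor\times\lceil k/2\rceil}(\bm T)$ satisfies $\mathrm{rank}X\le\textsc{r}$, $d^k\|X\|_\infty^2\le\alpha\|X\|_{\mathrm F}^2$, and $\mu\|X\|_{\mathrm F}^2=\textsc{r}\|X\|_{\mathrm{op}}^2$. For a square matrix $M$, $\Pi(M)$ keeps the diagonal and $\Pi_\perp(M)=M-\Pi(M)$; $\Pi_{\mathsf E}$ zeroes out tensor entries not in $\mathsf E$. Bernoulli-model procedure: for $\delta\in(0,1)$ let $\delta_1=\delta/2$, $\delta_2=\delta_1/(1-\delta_1)$. Let $\{I_{\vec u},J_{\vec u}\}_{\vec u\in[d]^k}$ be independent with $I_{\vec u}\sim\mathrm{Ber}(\delta_1)$, $J_{\vec u}\sim\mathrm{Ber}(\delta_2)$; $\mathsf E_1=\{\vec u:I_{\vec u}=1\}$, $\mathsf E_2=\{\vec u:(1-I_{\vec u})J_{\vec u}=1\}$, $\bm Y_i=\Pi_{\mathsf E_i}\bm T$. Let $Z=\mathrm{unfold}^{a\times b}(\bm Y_1)$, $B=\delta_1^{-1}\Pi(ZZ^{\mathsf t})+\delta_1^{-2}\Pi_\perp(ZZ^{\mathsf t})$,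 and $Q$ the orthogonal projection onto the eigenspace of $B$ for eigenvalues $\ge\lambda_\star$. Let $\mathcal Q=Q\otimes Q\otimes Q$ if $k=3$, $Q\otimes Q$ if $k\ge4$ even, $Q\otimes Q\otimes I_d$ if $k\ge5$ odd. Let $\widehat{\bm T}=\bm Y_1+\delta_2^{-1}\bm Y_2$ and $\widehat{\bm T}^\star=\mathcal Q(\widehat{\bm T})$. *)

theory Defs
  imports
    "HOL-Probability.Probability"
    "HOL-Combinatorics.Permutations"
    "Jordan_Normal_Form.Char_Poly"
    "Jordan_Normal_Form.DL_Rank"
begin

section \<open>Tensors and unfoldings\<close>

text \<open>
  A tensor of order \<open>k\<close> over \<open>\<real>\<^sup>d\<close> is a function \<open>nat list \<Rightarrow> real\<close> of which only the
  values on \<open>multi_index d k\<close> matter; indices are counted from \<open>0\<close>.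
\<close>

definition multi_index :: "nat \<Rightarrow> nat \<Rightarrow> nat list set" where
  "multi_index d n = {u. length u = n \<and> set u \<subseteq> {..<d}}"

definition symmetric_tensor :: "nat \<Rightarrow> nat \<Rightarrow> (nat list \<Rightarrow> real) \<Rightarrow> bool" where
  "symmetric_tensor d k T \<longleftrightarrow>
     (\<forall>u\<in>multi_index d k. \<forall>p. p permutes {..<k} \<longrightarrow> T (permute_list p u) = T u)"

definition tensor_norm :: "nat \<Rightarrow> nat \<Rightarrow> (nat list \<Rightarrow> real) \<Rightarrow> real" where
  "tensor_norm d k T = L2_set T (multi_index d k)"

definition restrict_tensor :: "nat list set \<Rightarrow> (nat list \<Rightarrow> real) \<Rightarrow> nat list \<Rightarrow> real" where
  "restrict_tensor E T u = (if u \<in> E then T u else 0)"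

text \<open>
  Library matrices have rows and columns numbered by naturals, so multi-indices are flattened
  in base \<open>d\<close>, most significant digit first. By \<open>flat_append\<close> this agrees with the usual
  row-major convention for Kronecker products used in \<open>kron\<close> below.
\<close>

definition flat :: "nat \<Rightarrow> nat list \<Rightarrow> nat" where
  "flat d u = foldl (\<lambda>m i. m * d + i) 0 u"

definition unflat :: "nat \<Rightarrow> nat \<Rightarrow> nat \<Rightarrow> nat list" where
  "unflat d n = inv_into (multi_index d n) (flat d)"

lemma flat_append: "flat d (u @ v) = flat d u * d ^ length v + flat d v"
  by (induction v rule: rev_induct) (simp_all add: flat_def algebra_simps)

lemma bij_betw_flat: "bij_betw (flat d) (multi_index d n) {..<d ^ n}"
proof (induction n)
  case 0
  have "multi_index d 0 = {[]}" by (auto simp: multi_index_def)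
  then show ?case by (auto simp: flat_def bij_betw_def)
next
  case (Suc n)
  have split: "multi_index d (Suc n) = (\<lambda>(u, i). u @ [i]) ` (multi_index d n \<times> {..<d})"
  proof (intro equalityI subsetI)
    fix w assume "w \<in> multi_index d (Suc n)"
    then have w: "length w = Suc n" "set w \<subseteq> {..<d}" by (auto simp: multi_index_def)
    then have "w \<noteq> []" by auto
    then obtain u i where wu: "w = u @ [i]" by (metis rev_exhaust)
    with w show "w \<in> (\<lambda>(u, i). u @ [i]) ` (multi_index d n \<times> {..<d})"
      by (intro image_eqI[of _ _ "(u, i)"]) (auto simp: multi_index_def)
  qed (auto simp: multi_index_def)
  have flat_snoc: "flat d (u @ [i]) = flat d u * d + i" for u i
    by (simp add: flat_def)
  have "inj_on (flat d) (multi_index d (Suc n))"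
  proof (rule inj_onI)
    fix x y assume "x \<in> multi_index d (Suc n)" "y \<in> multi_index d (Suc n)"
      and eq: "flat d x = flat d y"
    then obtain u i v j where x: "x = u @ [i]" and y: "y = v @ [j]"
      and u: "u \<in> multi_index d n" "v \<in> multi_index d n" and i: "i < d" "j < d"
      unfolding split by auto
    have e: "flat d u * d + i = flat d v * d + j" using eq x y flat_snoc by simp
    have "flat d u = flat d v" using arg_cong[OF e, of "\<lambda>m. m div d"] i by simp
    moreover have "i = j" using arg_cong[OF e, of "\<lambda>m. m mod d"] i by simp
    ultimately show "x = y" using Suc u x y by (auto simp: bij_betw_def inj_on_def)
  qed
  moreover have "flat d ` multi_index d (Suc n) = {..<d ^ Suc n}"
  proof (intro equalityI subsetI)
    fix m assume "m \<in> flat d ` multi_index d (Suc n)"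
    then obtain u i where m: "m = flat d u * d + i" and u: "u \<in> multi_index d n" and i: "i < d"
      unfolding split by (auto simp: flat_snoc)
    from u Suc have "flat d u < d ^ n" by (auto simp: bij_betw_def)
    then have "Suc (flat d u) * d \<le> d ^ n * d" by (intro mult_right_mono) auto
    with m i show "m \<in> {..<d ^ Suc n}" by (simp add: mult.commute)
  next
    fix m assume "m \<in> {..<d ^ Suc n}"
    then have m: "m < d ^ n * d" by (simp add: mult.commute)
    then have d: "d > 0" by (cases d) auto
    from m have "m div d \<in> {..<d ^ n}" by (simp add: less_mult_imp_div_less)
    with Suc obtain u where u: "u \<in> multi_index d n" "flat d u = m div d"
      unfolding bij_betw_def by (metis imageE)
    then have "flat d (u @ [m mod d]) = m" by (simp add: flat_snoc)
    moreover have "u @ [m mod d] \<in> multi_index d (Suc n)" using u d by (auto simp: split)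
    ultimately show "m \<in> flat d ` multi_index d (Suc n)" by (metis imageI)
  qed
  ultimately show ?case by (simp add: bij_betw_def)
qed

definition unfold :: "nat \<Rightarrow> nat \<Rightarrow> nat \<Rightarrow> (nat list \<Rightarrow> real) \<Rightarrow> real mat" where
  "unfold d a b T = Matrix.mat (d ^ a) (d ^ b) (\<lambda>(i, j). T (unflat d a i @ unflat d b j))"

definition apply_mat :: "nat \<Rightarrow> nat \<Rightarrow> real mat \<Rightarrow> (nat list \<Rightarrow> real) \<Rightarrow> nat list \<Rightarrow> real" where
  "apply_mat d k A T u =
     vec_index (A *\<^sub>v Matrix.vec (d ^ k) (\<lambda>i. T (unflat d k i))) (flat d u)"

section \<open>Matrix norms and spectral projections\<close>

definition vec_l2 :: "real Matrix.vec \<Rightarrow> real" where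
  "vec_l2 x = L2_set (vec_index x) {..<dim_vec x}"

definition frob_norm :: "real mat \<Rightarrow> real" where
  "frob_norm A = L2_set (\<lambda>ij. A $$ ij) ({..<dim_row A} \<times> {..<dim_col A})"

definition max_norm :: "real mat \<Rightarrow> real" where
  "max_norm A = Max (abs ` elements_mat A)"

definition op_norm :: "real mat \<Rightarrow> real" where
  "op_norm A = Sup {vec_l2 (A *\<^sub>v x) | x. x \<in> carrier_vec (dim_col A) \<and> vec_l2 x \<le> 1}"

definition diag_part :: "real mat \<Rightarrow> real mat" where
  "diag_part A = mat_diag (dim_row A) (\<lambda>i. A $$ (i, i))"

definition offdiag_part :: "real mat \<Rightarrow> real mat" where
  "offdiag_part A = A - diag_part A"

text \<open>The sum of the eigenspaces of \<open>A\<close> for the eigenvalues \<open>\<ge> c\<close>.\<close>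

definition eigenspace_ge :: "real mat \<Rightarrow> real \<Rightarrow> real Matrix.vec set" where
  "eigenspace_ge A c =
     LinearCombinations.module.span class_ring (module_vec TYPE(real) (dim_row A))
       {v. \<exists>e\<ge>c. eigenvector A v e}"

definition is_orth_proj :: "nat \<Rightarrow> real Matrix.vec set \<Rightarrow> real mat \<Rightarrow> bool" where
  "is_orth_proj n W P \<longleftrightarrow> P \<in> carrier_mat n n \<and>
     (\<forall>x\<in>carrier_vec n. P *\<^sub>v x \<in> W \<and> (\<forall>w\<in>W. scalar_prod (x - P *\<^sub>v x) w = 0))"

definition spectral_proj :: "real mat \<Rightarrow> real \<Rightarrow> real mat" where
  "spectral_proj A c = (THE P. is_orth_proj (dim_row A) (eigenspace_ge A c) P)"

definition kron :: "real mat \<Rightarrow> real mat \<Rightarrow> real mat" where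
  "kron A B = Matrix.mat (dim_row A * dim_row B) (dim_col A * dim_col B)
     (\<lambda>(i, j). A $$ (i div dim_row B, j div dim_col B) * B $$ (i mod dim_row B, j mod dim_col B))"

section \<open>Unfolding parameters and the estimator\<close>

definition unfolding_params ::
  "nat \<Rightarrow> nat \<Rightarrow> (nat list \<Rightarrow> real) \<Rightarrow> real \<Rightarrow> real \<Rightarrow> real \<Rightarrow> bool" where
  "unfolding_params d k T r \<alpha> \<mu> \<longleftrightarrow>
     (let X = unfold d (k div 2) (k - k div 2) T in
        real (vec_space.rank (d ^ (k div 2)) X) \<le> r \<and>
        real d ^ k * (max_norm X)\<^sup>2 \<le> \<alpha> * (frob_norm X)\<^sup>2 \<and>
        \<mu> * (frob_norm X)\<^sup>2 = r * (op_norm X)\<^sup>2)"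

definition r_max :: "nat \<Rightarrow> nat \<Rightarrow> real" where
  "r_max d k =
     (if k = 3 then real d powr (3 / 4)
      else if even k then real d powr (real k / 2)
      else real d powr (real k / 2 - 1))"

definition gram_estimate :: "real \<Rightarrow> real mat \<Rightarrow> real mat" where
  "gram_estimate \<delta>1 Z =
     (1 / \<delta>1) \<cdot>\<^sub>m diag_part (Z * transpose_mat Z)
     + (1 / \<delta>1\<^sup>2) \<cdot>\<^sub>m offdiag_part (Z * transpose_mat Z)"

definition tensor_proj :: "nat \<Rightarrow> nat \<Rightarrow> real mat \<Rightarrow> real mat" where
  "tensor_proj d k Q =
     (if k = 3 then kron Q (kron Q Q)
      else if even k then kron Q Q
      else kron Q (kron Q (1\<^sub>m d)))"

text \<open>
  \<open>E1\<close>, \<open>E2\<close> are the two revealed index sets and the spectral threshold is \<open>c\<close> times the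
  operator norm of the matrix \<open>B\<close>.
\<close>

definition estimator ::
  "nat \<Rightarrow> nat \<Rightarrow> real \<Rightarrow> real \<Rightarrow> real \<Rightarrow> nat list set \<Rightarrow> nat list set \<Rightarrow>
   (nat list \<Rightarrow> real) \<Rightarrow> nat list \<Rightarrow> real" where
  "estimator d k \<delta>1 \<delta>2 c E1 E2 T =
     (let Y1 = restrict_tensor E1 T;
          Y2 = restrict_tensor E2 T;
          B = gram_estimate \<delta>1 (unfold d (k div 2) (k - k div 2) Y1);
          Q = spectral_proj B (c * op_norm B)
      in apply_mat d k (tensor_proj d k Q) (\<lambda>u. Y1 u + Y2 u / \<delta>2))"

end

theory Submission
  imports Defs
begin

text \<open>
  The Gram estimate \<open>B\<close> is unbiased for \<open>X X\<^sup>t\<close>, and everything rests on the bound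
  \<open>\<parallel>B - X X\<^sup>t\<parallel> \<le> \<eta> \<parallel>X\<parallel>\<^sup>2\<close>. The diagonal error consists of sums of independent scalars. The
  off-diagonal error \<open>G\<close> is a sum of independent centered contributions of the columns. The method
  of exchangeable pairs bounds \<open>E tr G\<^bsup>2p\<^esup>\<close> by \<open>(2p - 1) E tr (V G\<^bsup>2p-2\<^esup>)\<close>, where the variance proxy
  \<open>V\<close> is at most \<open>c \<bar>G\<bar> + v\<close> unless the mask is crowded in some row or column, which has
  superpolynomially small probability. Young's inequality then bounds the moment, and the
  choice \<open>p \<approx> L\<^sup>2 / 16\<close> with \<open>L = k log d\<close> gives the tail.

  If \<open>B\<close> is that close to \<open>X X\<^sup>t\<close>, then the range of \<open>Q\<close> has dimension at most \<open>rank X\<close> and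
  \<open>Q\<close> loses little of \<open>X\<close>; as \<open>T\<close> is symmetric, this holds in every mode of \<open>T\<close>. Since \<open>Q\<close>
  depends on the first mask only, the remaining error is, given that mask, the projection of a sum
  of independent centered vectors, and Pinelis' inequality applies.
\<close>

section \<open>Bernoulli masks\<close>

text \<open>A column of the unfolding may show less than one entry on average, so a uniform bound on
  its contribution would waste the sparsity. The contribution of a column is the off-diagonal part
  of a rank-one matrix. The square of such a matrix is controlled by a multiple of the matrix itself
  plus a remainder that vanishes unless two entries of the column are revealed together. Summed over
  the columns, the first part yields \<open>c |G|\<close>, and the second counts crowded entries row
  by row.

  The exponent 2/3 of the threshold puts the cut between error and signal. The error is
  \<eta>\<Lambda> with \<Lambda> the squared operator norm of \<open>X\<close>, so a cut near
  \<eta>^(2/3) \<Lambda> exceeds it as soon as \<eta> \<le> 1/4. Each lost direction then costs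
  about \<eta>^(2/3) \<Lambda>, and the square root gives the exponent 1/3 of the rate.

  Probabilities are finite weighted sums over subsets. Conditioning on the first mask is then a
  nesting of sums, and eigenvectors may be picked by choice; the given probability space enters only
  at the end.\<close>

text \<open>\<open>bern p S f\<close> is the mean of \<open>f\<close> at a random subset of \<open>S\<close> that contains each element
  independently with probability \<open>p\<close>.\<close>

definition bern :: "real \<Rightarrow> 'a set \<Rightarrow> ('a set \<Rightarrow> real) \<Rightarrow> real" where
  "bern p S f = (\<Sum>A\<in>Pow S. p ^ card A * (1 - p) ^ card (S - A) * f A)"

lemma bern_empty [simp]: "bern p {} f = f {}"
  by (simp add: bern_def)

text \<open>Conditioning on whether \<open>x\<close> is revealed. The inductions over the ground set
  below run on this recursion, which keeps the explicit weights out of sight.\<close>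

lemma bern_insert:
  assumes "finite S" "x \<notin> S"
  shows "bern p (insert x S) f = p * bern p S (\<lambda>A. f (insert x A)) + (1 - p) * bern p S f"
proof -
  have inj: "inj_on (insert x) (Pow S)"
    using assms by (auto simp: inj_on_def)
  have "bern p (insert x S) f =
      (\<Sum>A\<in>Pow S. p ^ card A * (1 - p) ^ card (insert x S - A) * f A)
    + (\<Sum>A\<in>insert x ` Pow S. p ^ card A * (1 - p) ^ card (insert x S - A) * f A)"
    unfolding bern_def Pow_insert using assms by (intro sum.union_disjoint) auto
  also have "(\<Sum>A\<in>insert x ` Pow S. p ^ card A * (1 - p) ^ card (insert x S - A) * f A)
      = (\<Sum>A\<in>Pow S. p ^ card (insert x A) * (1 - p) ^ card (insert x S - insert x A) * f (insert x A))"
    by (rule sum.reindex[OF inj, unfolded o_def])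
  also have "\<dots> = p * bern p S (\<lambda>A. f (insert x A))"
    unfolding bern_def sum_distrib_left
  proof (intro sum.cong refl)
    fix A assume "A \<in> Pow S"
    then have "finite A" "x \<notin> A" using assms by (auto intro: finite_subset)
    moreover have "insert x S - insert x A = S - A" using assms \<open>x \<notin> A\<close> by auto
    ultimately show "p ^ card (insert x A) * (1 - p) ^ card (insert x S - insert x A) * f (insert x A)
        = p * (p ^ card A * (1 - p) ^ card (S - A) * f (insert x A))" by simp
  qed
  also have "(\<Sum>A\<in>Pow S. p ^ card A * (1 - p) ^ card (insert x S - A) * f A) = (1 - p) * bern p S f"
    unfolding bern_def sum_distrib_left
  proof (intro sum.cong refl)
    fix A assume "A \<in> Pow S"
    then have "insert x S - A = insert x (S - A)" "x \<notin> S - A" "finite (S - A)" using assms by auto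
    then show "p ^ card A * (1 - p) ^ card (insert x S - A) * f A
        = (1 - p) * (p ^ card A * (1 - p) ^ card (S - A) * f A)" by simp
  qed
  finally show ?thesis by simp
qed

lemma bern_cong: "(\<And>A. A \<subseteq> S \<Longrightarrow> f A = g A) \<Longrightarrow> bern p S f = bern p S g"
  by (simp add: bern_def)

lemma bern_add: "bern p S (\<lambda>A. f A + g A) = bern p S f + bern p S g"
  by (simp add: bern_def distrib_left sum.distrib)

lemma bern_diff: "bern p S (\<lambda>A. f A - g A) = bern p S f - bern p S g"
  by (simp add: bern_def right_diff_distrib sum_subtractf)

lemma bern_cmult: "bern p S (\<lambda>A. c * f A) = c * bern p S f"
  by (simp add: bern_def sum_distrib_left mult_ac)

lemma bern_cmult_right: "bern p S (\<lambda>A. f A * c) = bern p S f * c"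
  unfolding bern_def sum_distrib_right by (simp add: mult.assoc)

lemma bern_sum: "bern p S (\<lambda>A. \<Sum>i\<in>F. f i A) = (\<Sum>i\<in>F. bern p S (f i))"
  unfolding bern_def sum_distrib_left by (rule sum.swap)

lemma bern_mono:
  "0 \<le> p \<Longrightarrow> p \<le> 1 \<Longrightarrow> (\<And>A. A \<subseteq> S \<Longrightarrow> f A \<le> g A) \<Longrightarrow> bern p S f \<le> bern p S g"
  unfolding bern_def by (intro sum_mono mult_left_mono) auto

lemma bern_const: "finite S \<Longrightarrow> bern p S (\<lambda>_. c) = c"
  by (induction S rule: finite_induct) (simp_all add: bern_insert algebra_simps)

lemma bern_nonneg: "0 \<le> p \<Longrightarrow> p \<le> 1 \<Longrightarrow> (\<And>A. A \<subseteq> S \<Longrightarrow> 0 \<le> f A) \<Longrightarrow> 0 \<le> bern p S f"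
  unfolding bern_def by (intro sum_nonneg mult_nonneg_nonneg) auto

lemma bern_swap: "bern p S (\<lambda>A. bern q T (f A)) = bern q T (\<lambda>B. bern p S (\<lambda>A. f A B))"
  unfolding bern_def sum_distrib_left by (subst sum.swap) (simp add: mult_ac)

lemma bern_Un:
  assumes "finite S" "finite T" "S \<inter> T = {}"
  shows "bern p (S \<union> T) f = bern p S (\<lambda>A. bern p T (\<lambda>B. f (A \<union> B)))"
  using assms
proof (induction S arbitrary: f rule: finite_induct)
  case (insert x S)
  then show ?case by (simp add: bern_insert)
qed simp

lemma bern_image: "finite S \<Longrightarrow> inj_on g S \<Longrightarrow> bern p (g ` S) f = bern p S (\<lambda>A. f (g ` A))"
  by (induction S arbitrary: f rule: finite_induct) (auto simp: bern_insert)

lemma bern_prod_if: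
  "finite S \<Longrightarrow> bern p S (\<lambda>A. \<Prod>x\<in>S. if x \<in> A then g x else h x) = (\<Prod>x\<in>S. p * g x + (1 - p) * h x)"
proof (induction S rule: finite_induct)
  case (insert x S)
  have "bern p S (\<lambda>A. \<Prod>y\<in>S. if y = x \<or> y \<in> A then g y else h y)
      = bern p S (\<lambda>A. \<Prod>y\<in>S. if y \<in> A then g y else h y)"
    using insert.hyps by (intro bern_cong prod.cong) auto
  moreover have "bern p S (\<lambda>A. (if x \<in> A then g x else h x) * (\<Prod>y\<in>S. if y \<in> A then g y else h y))
    = bern p S (\<lambda>A. h x * (\<Prod>y\<in>S. if y \<in> A then g y else h y))"
    using insert.hyps by (intro bern_cong) auto
  ultimately show ?case
    using insert by (simp add: bern_insert bern_cmult) (simp add: algebra_simps)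
qed simp

lemma bern_marginal:
  assumes "finite S" "C \<subseteq> S"
  shows "bern p S (\<lambda>A. f (A \<inter> C)) = bern p C f"
proof -
  have fin: "finite C" "finite (S - C)" using assms by (auto intro: finite_subset)
  have "bern p S (\<lambda>A. f (A \<inter> C)) = bern p (C \<union> (S - C)) (\<lambda>A. f (A \<inter> C))"
    using assms by (simp add: Un_absorb1)
  also have "\<dots> = bern p C (\<lambda>A. bern p (S - C) (\<lambda>B. f ((A \<union> B) \<inter> C)))"
    using fin by (intro bern_Un) auto
  also have "\<dots> = bern p C (\<lambda>A. bern p (S - C) (\<lambda>B. f A))"
    by (intro bern_cong arg_cong[of _ _ f]) auto
  finally show ?thesis using fin by (simp add: bern_const)
qed

text \<open>Exchangeability: if \<open>B\<close> is a fresh copy of the mask on the block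
  \<open>C\<close>, exchanging the contents of the block between \<open>A\<close> and
  \<open>B\<close> preserves the joint law. Once \<open>S\<close> is split into \<open>S - C\<close>
  and \<open>C\<close>, this is a swap of the two inner means.\<close>

lemma bern_resample:
  assumes "finite S" "C \<subseteq> S"
  shows "bern p S (\<lambda>A. bern p C (\<lambda>B. F A B)) = bern p S (\<lambda>A. bern p C (\<lambda>B. F (A - C \<union> B) (A \<inter> C)))"
proof -
  have fin: "finite C" "finite (S - C)" and S: "S = (S - C) \<union> C" using assms by (auto intro: finite_subset)
  have split: "bern p S G = bern p (S - C) (\<lambda>A0. bern p C (\<lambda>A1. G (A0 \<union> A1)))" for G
    by (subst S, rule bern_Un) (use fin in auto)
  have "bern p S (\<lambda>A. bern p C (\<lambda>B. F A B))
    = bern p (S - C) (\<lambda>A0. bern p C (\<lambda>A1. bern p C (\<lambda>B. F (A0 \<union> A1) B)))"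
    by (rule split)
  also have "\<dots> = bern p (S - C) (\<lambda>A0. bern p C (\<lambda>A1. bern p C (\<lambda>B. F (A0 \<union> B) A1)))"
    by (subst bern_swap) simp
  also have "\<dots> = bern p (S - C) (\<lambda>A0. bern p C (\<lambda>A1. bern p C (\<lambda>B. F (A0 \<union> A1 - C \<union> B) ((A0 \<union> A1) \<inter> C))))"
    by (intro bern_cong arg_cong2[of _ _ _ _ F]) auto
  finally show ?thesis by (simp add: split)
qed

text \<open>Independence of disjoint blocks in product form, as needed for the exponential moment of
  a sum with one term per block.\<close>

lemma bern_prod_blocks:
  assumes "finite L" "\<And>l. l \<in> L \<Longrightarrow> finite (C l)" "disjoint_family_on C L"
  shows "bern p (\<Union>l\<in>L. C l) (\<lambda>A. \<Prod>l\<in>L. f l (A \<inter> C l)) = (\<Prod>l\<in>L. bern p (C l) (f l))"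
  using assms
proof (induction L rule: finite_induct)
  case (insert l L)
  have disj: "C l \<inter> (\<Union>j\<in>L. C j) = {}" and dL: "disjoint_family_on C L"
    using insert.prems(2) insert.hyps by (auto simp: disjoint_family_on_def)
  have fin: "finite (C l)" "finite (\<Union>j\<in>L. C j)" using insert by auto
  have "bern p (\<Union>j\<in>insert l L. C j) (\<lambda>A. \<Prod>j\<in>insert l L. f j (A \<inter> C j))
      = bern p (C l) (\<lambda>A. bern p (\<Union>j\<in>L. C j) (\<lambda>B. \<Prod>j\<in>insert l L. f j ((A \<union> B) \<inter> C j)))"
    using bern_Un[OF fin disj] by simp
  also have "\<dots> = bern p (C l) (\<lambda>A. bern p (\<Union>j\<in>L. C j) (\<lambda>B. f l A * (\<Prod>j\<in>L. f j (B \<inter> C j))))"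
  proof (intro bern_cong)
    fix A B assume A: "A \<subseteq> C l" and B: "B \<subseteq> (\<Union>j\<in>L. C j)"
    have "(A \<union> B) \<inter> C l = A" using A B disj by auto
    moreover have "(\<Prod>j\<in>L. f j ((A \<union> B) \<inter> C j)) = (\<Prod>j\<in>L. f j (B \<inter> C j))"
      using A disj by (intro prod.cong refl arg_cong[of _ _ "f _"]) auto
    ultimately show "(\<Prod>j\<in>insert l L. f j ((A \<union> B) \<inter> C j)) = f l A * (\<Prod>j\<in>L. f j (B \<inter> C j))"
      using insert.hyps by simp
  qed
  also have "\<dots> = bern p (C l) (f l) * bern p (\<Union>j\<in>L. C j) (\<lambda>B. \<Prod>j\<in>L. f j (B \<inter> C j))"
    by (simp add: bern_cmult bern_cmult_right)
  finally show ?case using insert dL by simp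
qed simp

lemma bern_markov:
  assumes p: "0 \<le> p" "p \<le> 1" and "c > 0" and X: "\<And>A. A \<subseteq> S \<Longrightarrow> 0 \<le> X A"
    and P: "\<And>A. A \<subseteq> S \<Longrightarrow> P A \<Longrightarrow> c \<le> X A"
  shows "bern p S (\<lambda>A. of_bool (P A)) \<le> bern p S X / c"
proof -
  have "bern p S (\<lambda>A. of_bool (P A)) \<le> bern p S (\<lambda>A. (1 / c) * X A)"
    using p X P \<open>c > 0\<close> by (intro bern_mono) (auto simp: of_bool_def field_simps)
  then show ?thesis by (simp only: bern_cmult) simp
qed

section \<open>The spectral theorem\<close>

text \<open>Vectors and matrices are plain functions of which only the entries below the dimension
  are read. This frees the analytic part from carrier conditions; library matrices are translated
  afterwards.\<close>

definition ip :: "nat \<Rightarrow> (nat \<Rightarrow> real) \<Rightarrow> (nat \<Rightarrow> real) \<Rightarrow> real" where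
  "ip n x y = (\<Sum>i<n. x i * y i)"

definition mv :: "nat \<Rightarrow> (nat \<Rightarrow> nat \<Rightarrow> real) \<Rightarrow> (nat \<Rightarrow> real) \<Rightarrow> nat \<Rightarrow> real" where
  "mv n A x i = (\<Sum>j<n. A i j * x j)"

definition sym_on :: "nat \<Rightarrow> (nat \<Rightarrow> nat \<Rightarrow> real) \<Rightarrow> bool" where
  "sym_on n A \<longleftrightarrow> (\<forall>i<n. \<forall>j<n. A i j = A j i)"

lemma ip_commute: "ip n x y = ip n y x"
  by (simp add: ip_def mult.commute)

lemma ip_add_left: "ip n (\<lambda>i. x i + y i) z = ip n x z + ip n y z"
  by (simp add: ip_def distrib_right sum.distrib)

lemma ip_diff_left: "ip n (\<lambda>i. x i - y i) z = ip n x z - ip n y z"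
  by (simp add: ip_def left_diff_distrib sum_subtractf)

lemma ip_scale_left: "ip n (\<lambda>i. c * x i) z = c * ip n x z"
  by (simp add: ip_def sum_distrib_left mult.assoc)

lemma ip_add_right: "ip n z (\<lambda>i. x i + y i) = ip n z x + ip n z y"
  by (simp add: ip_commute[of n z] ip_add_left)

lemma ip_diff_right: "ip n z (\<lambda>i. x i - y i) = ip n z x - ip n z y"
  by (simp add: ip_commute[of n z] ip_diff_left)

lemma ip_scale_right: "ip n z (\<lambda>i. c * x i) = c * ip n z x"
  by (simp add: ip_commute[of n z] ip_scale_left)

lemma ip_sum_left: "ip n (\<lambda>i. \<Sum>s\<in>S. x s i) z = (\<Sum>s\<in>S. ip n (x s) z)"
proof -
  have "ip n (\<lambda>i. \<Sum>s\<in>S. x s i) z = (\<Sum>i<n. \<Sum>s\<in>S. x s i * z i)"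
    by (simp add: ip_def sum_distrib_right)
  also have "\<dots> = (\<Sum>s\<in>S. \<Sum>i<n. x s i * z i)"
    by (rule sum.swap)
  finally show ?thesis by (simp add: ip_def)
qed

lemma ip_sum_right: "ip n z (\<lambda>i. \<Sum>s\<in>S. x s i) = (\<Sum>s\<in>S. ip n z (x s))"
  by (simp add: ip_commute[of n z] ip_sum_left)

lemma ip_nonneg: "ip n x x \<ge> 0"
  by (simp add: ip_def sum_nonneg)

lemma ip_eq_0D:
  assumes "ip n x x = 0" "i < n" shows "x i = 0"
proof -
  have "\<forall>i\<in>{..<n}. x i * x i = 0"
    using assms(1) unfolding ip_def by (subst (asm) sum_nonneg_eq_0_iff) auto
  with assms(2) show ?thesis by auto
qed

lemma ip_cong: "(\<And>i. i < n \<Longrightarrow> x i = x' i) \<Longrightarrow> (\<And>i. i < n \<Longrightarrow> y i = y' i) \<Longrightarrow> ip n x y = ip n x' y'"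
  by (simp add: ip_def)

lemma ip_Cauchy_Schwarz: "(ip n x y)\<^sup>2 \<le> ip n x x * ip n y y"
  using Cauchy_Schwarz_ineq_sum[of x y "{..<n}"] by (simp add: ip_def power2_eq_square)

lemma mv_cong: "(\<And>j. j < n \<Longrightarrow> x j = y j) \<Longrightarrow> mv n A x i = mv n A y i"
  by (simp add: mv_def)

lemma ip_mv_swap: "ip n (mv m A x) y = (\<Sum>j<m. x j * (\<Sum>i<n. A i j * y i))"
  unfolding ip_def mv_def sum_distrib_right sum_distrib_left
  by (subst sum.swap) (simp add: mult_ac)

lemma ip_mv_sym: "sym_on n A \<Longrightarrow> ip n (mv n A x) y = ip n x (mv n A y)"
  unfolding ip_mv_swap unfolding ip_def mv_def sym_on_def
  by (intro sum.cong arg_cong2[where f = "(*)"] refl) auto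

text \<open>Tychonoff. Pinning the coordinates from \<open>n\<close> on to 0 makes the cube of
  \<open>n\<close> dimensions a compact product inside \<open>nat \<Rightarrow> real\<close>, so
  maxima over unit vectors exist although the dimension is a variable.\<close>

lemma compact_cube: "compact {x :: nat \<Rightarrow> real. (\<forall>i. x i \<in> (if i < n then {-1..1} else {0}))}"
proof -
  have "compactin (product_topology (\<lambda>i::nat. euclidean :: real topology) UNIV)
          (PiE UNIV (\<lambda>i. if i < n then {-1..1} else {0}))"
    by (simp add: compactin_PiE)
  moreover have "product_topology (\<lambda>i::nat. euclidean :: real topology) UNIV = euclidean"
    by (rule euclidean_product_topology)
  ultimately show ?thesis
    by (simp only: compactin_euclidean_iff PiE_UNIV_domain Pi_def UNIV_I simp_thms)
qed

text \<open>\<open>y\<close> is the \<open>i\<close>-th unit vector minus its projection to the span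
  of the \<open>u j\<close>. The formula for its squared norm serves twice: a positive value
  supplies a vector orthogonal to the \<open>u j\<close>, and a vanishing total over all
  \<open>i\<close> proves completeness.\<close>

lemma unit_vector_residual:
  fixes m :: nat
  assumes on: "\<And>i j. i < m \<Longrightarrow> j < m \<Longrightarrow> ip n (u i) (u j) = (if i = j then 1 else 0)" and "i < n"
  defines "y \<equiv> \<lambda>l. of_bool (l = i) - (\<Sum>j<m. u j i * u j l)"
  shows "j < m \<Longrightarrow> ip n (u j) y = 0" and "ip n y y = 1 - (\<Sum>j<m. (u j i)\<^sup>2)"
proof -
  define e :: "nat \<Rightarrow> real" where "e l = of_bool (l = i)" for l
  have ipe: "ip n x e = x i" "ip n e x = x i" for x
    using \<open>i < n\<close> by (simp_all add: ip_def e_def of_bool_def if_distrib[of "\<lambda>z. _ * z"] if_distrib[of "\<lambda>z. z * _"] cong: if_cong)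
  have y: "y = (\<lambda>l. e l - (\<Sum>j<m. u j i * u j l))" by (simp add: y_def e_def)
  show y0: "ip n (u j) y = 0" if j: "j < m" for j
  proof -
    have "(\<Sum>s<m. u s i * ip n (u j) (u s)) = (\<Sum>s<m. if s = j then u j i else 0)"
      using j by (intro sum.cong) (auto simp: on)
    then show ?thesis using j by (simp add: y ip_diff_right ipe ip_sum_right ip_scale_right)
  qed
  have "ip n y y = ip n e y - (\<Sum>j<m. u j i * ip n (u j) y)"
    by (subst (1) y) (simp add: ip_diff_left ip_sum_left ip_scale_left)
  also have "\<dots> = 1 - (\<Sum>j<m. (u j i)\<^sup>2)"
    by (simp add: y0 ipe) (simp add: y e_def power2_eq_square)
  finally show "ip n y y = 1 - (\<Sum>j<m. (u j i)\<^sup>2)" .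
qed

text \<open>The quadratic form is maximised over the unit vectors orthogonal to the eigenvectors
  already found. That complement is invariant under \<open>A\<close>, so the gradient at a maximiser
  is an admissible direction and has to vanish.\<close>

lemma eigenvector_in_orthocomplement:
  fixes A :: "nat \<Rightarrow> nat \<Rightarrow> real"
  assumes sym: "sym_on n A" and "m < n"
    and on: "\<And>i j. i < m \<Longrightarrow> j < m \<Longrightarrow> ip n (u i) (u j) = (if i = j then 1 else 0)"
    and ev: "\<And>i j. i < m \<Longrightarrow> j < n \<Longrightarrow> mv n A (u i) j = a i * u i j"
  shows "\<exists>x c. ip n x x = 1 \<and> (\<forall>i<m. ip n (u i) x = 0) \<and> (\<forall>j<n. mv n A x j = c * x j)"
proof -
  define K where "K = {x :: nat \<Rightarrow> real. (\<forall>i. x i \<in> (if i < n then {-1..1} else {0}))}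
      \<inter> {x. ip n x x = 1} \<inter> {x. \<forall>i<m. ip n (u i) x = 0}"
  have cont_ip: "continuous_on UNIV (\<lambda>x::nat\<Rightarrow>real. ip n (f x) (g x))"
    if "\<And>i. continuous_on UNIV (\<lambda>x. f x i)" "\<And>i. continuous_on UNIV (\<lambda>x. g x i)" for f g
    unfolding ip_def by (intro continuous_intros that)
  have c1: "closed {x :: nat \<Rightarrow> real. ip n x x = 1}"
    by (intro closed_Collect_eq cont_ip continuous_on_product_coordinates continuous_on_const)
  have c2: "closed {x :: nat \<Rightarrow> real. \<forall>i<m. ip n (u i) x = 0}"
    by (intro closed_Collect_all closed_Collect_imp closed_Collect_eq cont_ip
         continuous_on_product_coordinates continuous_on_const open_Collect_const)
  have "compact K"
    unfolding K_def by (intro compact_Int_closed compact_cube c1 c2)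
  have bound1: "\<bar>x i\<bar> \<le> 1" if "ip n x x = 1" "i < n" for x i
  proof -
    have "x i * x i \<le> 1"
      unfolding that(1)[symmetric] ip_def using that(2) by (intro member_le_sum) auto
    then show ?thesis by (simp add: abs_square_le_1 flip: power2_eq_square)
  qed
  \<comment> \<open>Points of \<open>K\<close> vanish from index \<open>n\<close> on.
    \<open>ip n\<close> and \<open>mv n\<close> do not see these entries, so truncation moves a
    vector into \<open>K\<close> without any other effect.\<close>
  define tr where "tr x = (\<lambda>i. if i < n then x i else 0)" for x :: "nat \<Rightarrow> real"
  have tr_ip: "ip n (tr x) y = ip n x y" "ip n y (tr x) = ip n y x" for x y
    by (auto simp: tr_def ip_def)
  have inK: "tr x \<in> K" if "ip n x x = 1" "\<And>i. i < m \<Longrightarrow> ip n (u i) x = 0" for x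
    using bound1[OF that(1)] that by (auto simp: K_def tr_ip) (auto simp: tr_def abs_le_iff)
  have "K \<noteq> {}"
  proof -
    \<comment> \<open>Averaging: the squared lengths of the projections of the \<open>n\<close> unit
      vectors add up to \<open>m < n\<close>, so some unit vector lies outside the span.\<close>
    have "(\<Sum>i<n. \<Sum>j<m. (u j i)\<^sup>2) = (\<Sum>j<m. ip n (u j) (u j))"
      unfolding ip_def power2_eq_square by (rule sum.swap)
    also have "\<dots> = m" using on by simp
    also have "\<dots> < (\<Sum>i<n. 1::real)" using \<open>m < n\<close> by simp
    finally obtain i where i: "i < n" "(\<Sum>j<m. (u j i)\<^sup>2) < 1"
      by (meson lessThan_iff not_le sum_mono)
    define y where "y = (\<lambda>l. of_bool (l = i) - (\<Sum>j<m. u j i * u j l))"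
    have y0: "ip n (u j) y = 0" if "j < m" for j
      unfolding y_def by (rule unit_vector_residual(1)) (use on i that in auto)
    have "ip n y y = 1 - (\<Sum>j<m. (u j i)\<^sup>2)"
      unfolding y_def by (rule unit_vector_residual(2)) (use on i in auto)
    then have pos: "ip n y y > 0" using i by simp
    define z where "z = (\<lambda>l. (1 / sqrt (ip n y y)) * y l)"
    have "ip n z z = 1"
      unfolding z_def ip_scale_left ip_scale_right using pos by (simp add: field_simps)
    moreover have "ip n (u j) z = 0" if "j < m" for j
      unfolding z_def ip_scale_right using y0[OF that] by simp
    ultimately show ?thesis using inK by blast
  qed
  moreover have "continuous_on K (\<lambda>x. ip n x (mv n A x))"
    by (rule continuous_on_subset[OF cont_ip])
       (auto simp: mv_def intro!: continuous_intros continuous_on_product_coordinates)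
  ultimately obtain x where x: "x \<in> K" and max: "\<And>y. y \<in> K \<Longrightarrow> ip n y (mv n A y) \<le> ip n x (mv n A x)"
    using continuous_attains_sup[OF \<open>compact K\<close>] by metis
  define c where "c = ip n x (mv n A x)"
  have x1: "ip n x x = 1" and x0: "\<And>i. i < m \<Longrightarrow> ip n (u i) x = 0"
    using x by (auto simp: K_def)
  have mv_tr: "mv n A (tr y) = mv n A y" for y
    by (auto simp: mv_def tr_def)
  have le: "ip n y (mv n A y) \<le> c * ip n y y" if y0: "\<And>i. i < m \<Longrightarrow> ip n (u i) y = 0" for y
  proof (cases "ip n y y = 0")
    case True
    then have "ip n y (mv n A y) = 0" using ip_eq_0D[OF True] by (simp add: ip_def)
    with True show ?thesis by simp
  next
    case False
    then have pos: "ip n y y > 0" using ip_nonneg[of n y] by linarith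
    define s where "s = 1 / sqrt (ip n y y)"
    have s2: "s * (s * ip n y y) = 1" using pos by (simp add: s_def field_simps)
    have mvs: "mv n A (\<lambda>l. s * y l) = (\<lambda>l. s * mv n A y l)"
      by (auto simp: mv_def sum_distrib_left mult_ac)
    have "tr (\<lambda>l. s * y l) \<in> K"
      by (rule inK) (simp_all add: ip_scale_left ip_scale_right s2 y0)
    from max[OF this] have "s * (s * ip n y (mv n A y)) \<le> c"
      by (simp add: tr_ip mv_tr mvs ip_scale_left ip_scale_right c_def)
    then have "s * (s * ip n y (mv n A y)) * ip n y y \<le> c * ip n y y"
      using pos by (intro mult_right_mono) auto
    moreover have "s * (s * ip n y (mv n A y)) * ip n y y = ip n y (mv n A y)"
      using s2 by (metis mult.assoc mult.commute mult.right_neutral)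
    ultimately show ?thesis by simp
  qed
  \<comment> \<open>The defect in the eigenvector equation. It is orthogonal to \<open>x\<close> and
    to all \<open>u i\<close>, so maximality may be tested at \<open>x + e g\<close>; the term
    linear in \<open>e\<close> is \<open>2 e |g|^2\<close>.\<close>
  define g where "g = (\<lambda>l. mv n A x l - c * x l)"
  have mvadd: "mv n A (\<lambda>l. x l + e * g l) = (\<lambda>l. mv n A x l + e * mv n A g l)" for e
    by (auto simp: mv_def sum_distrib_left mult_ac distrib_left sum.distrib)
  have g0: "ip n (u i) g = 0" if "i < m" for i
  proof -
    have "ip n (u i) (mv n A x) = ip n (mv n A (u i)) x" using sym by (simp add: ip_mv_sym)
    also have "\<dots> = ip n (\<lambda>j. a i * u i j) x" using ev[OF that] by (intro ip_cong) auto
    finally show ?thesis using x0[OF that] by (simp add: g_def ip_diff_right ip_scale_right ip_scale_left)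
  qed
  have gx: "ip n x g = 0" by (simp add: g_def ip_diff_right ip_scale_right x1 c_def)
  have xg: "ip n g (mv n A x) = ip n g g"
    by (subst (3) g_def) (simp add: ip_diff_right ip_scale_right gx ip_commute[of n g x])
  have xg': "ip n x (mv n A g) = ip n g g"
    using xg sym by (metis ip_commute ip_mv_sym)
  define b where "b = \<bar>c * ip n g g - ip n g (mv n A g)\<bar>"
  have key: "2 * e * ip n g g \<le> e\<^sup>2 * b" for e
  proof -
    have "ip n (\<lambda>l. x l + e * g l) (mv n A (\<lambda>l. x l + e * g l))
        \<le> c * ip n (\<lambda>l. x l + e * g l) (\<lambda>l. x l + e * g l)"
      by (rule le) (simp add: ip_add_right ip_scale_right x0 g0)
    then have "c + 2 * e * ip n g g + e\<^sup>2 * ip n g (mv n A g) \<le> c * (1 + e\<^sup>2 * ip n g g)"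
      by (simp add: mvadd ip_add_right ip_add_left ip_scale_right ip_scale_left xg xg'
          gx ip_commute[of n g x] x1 flip: c_def)
         (simp add: algebra_simps power2_eq_square)
    then have "2 * e * ip n g g \<le> e\<^sup>2 * (c * ip n g g - ip n g (mv n A g))"
      by (simp add: algebra_simps)
    also have "\<dots> \<le> e\<^sup>2 * b" by (intro mult_left_mono) (auto simp: b_def)
    finally show ?thesis .
  qed
  have "ip n g g = 0"
  proof (rule ccontr)
    assume "ip n g g \<noteq> 0"
    then have pos: "ip n g g > 0" using ip_nonneg[of n g] by linarith
    have b0: "b \<ge> 0" by (simp add: b_def)
    \<comment> \<open>So small that the quadratic term \<open>e * b\<close> is at most
      \<open>ip n g g\<close>, which contradicts the linear term; the summand 1 covers
      \<open>b = 0\<close>.\<close>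
    define e where "e = ip n g g / (b + 1)"
    have e: "e > 0" using pos b0 by (simp add: e_def)
    have "e * (2 * ip n g g) \<le> e * (e * b)" using key[of e] by (simp add: power2_eq_square mult_ac)
    then have "2 * ip n g g \<le> e * b" using e by simp
    also have "\<dots> \<le> ip n g g" unfolding e_def using b0 pos by (simp add: divide_simps)
    finally show False using pos by simp
  qed
  then have "mv n A x j = c * x j" if "j < n" for j
    using ip_eq_0D[of n g j] that by (simp add: g_def)
  with x1 x0 show ?thesis by blast
qed

definition eigenbasis :: "nat \<Rightarrow> (nat \<Rightarrow> nat \<Rightarrow> real) \<Rightarrow> (nat \<Rightarrow> nat \<Rightarrow> real) \<Rightarrow> (nat \<Rightarrow> real) \<Rightarrow> bool" where
  "eigenbasis n A u a \<longleftrightarrow>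
     (\<forall>i<n. \<forall>j<n. ip n (u i) (u j) = (if i = j then 1 else 0)) \<and>
     (\<forall>i<n. \<forall>j<n. mv n A (u i) j = a i * u i j)"

theorem spectral_theorem:
  assumes sym: "sym_on n A"
  obtains u a where "eigenbasis n A u a"
proof -
  have "\<exists>u a. (\<forall>i<m. \<forall>j<m. ip n (u i) (u j) = (if i = j then 1 else 0)) \<and>
     (\<forall>i<m. \<forall>j<n. mv n A (u i) j = a i * u i j)" if "m \<le> n" for m
    using that
  proof (induction m)
    case 0 then show ?case by simp
  next
    case (Suc m)
    from Suc.prems have "m \<le> n" "m < n" by auto
    from Suc.IH[OF this(1)] obtain u a where ua:
      "(\<forall>i<m. \<forall>j<m. ip n (u i) (u j) = (if i = j then 1 else 0)) \<and>
       (\<forall>i<m. \<forall>j<n. mv n A (u i) j = a i * u i j)"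
      by (elim exE)
    then have u: "\<And>i j. i < m \<Longrightarrow> j < m \<Longrightarrow> ip n (u i) (u j) = (if i = j then 1 else 0)"
      and a: "\<And>i j. i < m \<Longrightarrow> j < n \<Longrightarrow> mv n A (u i) j = a i * u i j"
      by blast+
    have "\<exists>x c. ip n x x = 1 \<and> (\<forall>i<m. ip n (u i) x = 0) \<and> (\<forall>j<n. mv n A x j = c * x j)"
      by (rule eigenvector_in_orthocomplement[OF sym \<open>m < n\<close>, of u a]) (simp_all add: u a)
    then obtain x c where x: "ip n x x = 1" "\<forall>i<m. ip n (u i) x = 0" "\<forall>j<n. mv n A x j = c * x j"
      by (elim exE conjE)
    have x': "\<forall>i<m. ip n x (u i) = 0" using x(2) by (simp add: ip_commute)
    have "(\<forall>i<Suc m. \<forall>j<Suc m. ip n ((u(m := x)) i) ((u(m := x)) j) = (if i = j then 1 else 0)) \<and>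
     (\<forall>i<Suc m. \<forall>j<n. mv n A ((u(m := x)) i) j = (a(m := c)) i * (u(m := x)) i j)"
      using u a x x' by (auto simp: less_Suc_eq)
    then show ?case by blast
  qed
  from this[of n] that show ?thesis unfolding eigenbasis_def by blast
qed

text \<open>The residuals of the \<open>n\<close> unit vectors have squared norms that sum to
  \<open>n - n = 0\<close>, so each residual is zero.\<close>

lemma orthonormal_complete:
  assumes on: "\<And>i j. i < n \<Longrightarrow> j < n \<Longrightarrow> ip n (u i) (u j) = (if i = j then 1 else 0)"
    and "k < n" "l < n"
  shows "(\<Sum>j<n. u j k * u j l) = (if k = l then 1 else 0)"
proof -
  define y where "y i = (\<lambda>l. of_bool (l = i) - (\<Sum>j<n. u j i * u j l))" for i
  have yy: "ip n (y i) (y i) = 1 - (\<Sum>j<n. (u j i)\<^sup>2)" if "i < n" for i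
    unfolding y_def by (rule unit_vector_residual(2)) (use on that in auto)
  have "(\<Sum>i<n. ip n (y i) (y i)) = (\<Sum>i<n. 1 - (\<Sum>j<n. (u j i)\<^sup>2))"
    by (intro sum.cong) (auto simp: yy)
  also have "\<dots> = n - (\<Sum>j<n. ip n (u j) (u j))"
    unfolding ip_def power2_eq_square sum_subtractf by (subst sum.swap) simp
  also have "\<dots> = 0" using on by simp
  finally have "ip n (y k) (y k) = 0"
    using \<open>k < n\<close> by (subst (asm) sum_nonneg_eq_0_iff) (auto simp: ip_nonneg)
  from ip_eq_0D[OF this \<open>l < n\<close>] show ?thesis by (auto simp: y_def split: if_splits)
qed

lemma orthonormal_expand:
  assumes on: "\<And>i j. i < n \<Longrightarrow> j < n \<Longrightarrow> ip n (u i) (u j) = (if i = j then 1 else 0)" and "k < n"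
  shows "x k = (\<Sum>j<n. ip n (u j) x * u j k)"
proof -
  have "(\<Sum>j<n. ip n (u j) x * u j k) = (\<Sum>l<n. x l * (\<Sum>j<n. u j k * u j l))"
    unfolding ip_def sum_distrib_left sum_distrib_right by (subst sum.swap) (simp add: mult_ac)
  also have "\<dots> = (\<Sum>l<n. x l * (if k = l then 1 else 0))"
    using orthonormal_complete[OF on \<open>k < n\<close>] by (intro sum.cong) auto
  also have "\<dots> = x k" using \<open>k < n\<close> by (simp add: if_distrib[of "\<lambda>z. _ * z"] cong: if_cong)
  finally show ?thesis by simp
qed

lemma parseval:
  assumes on: "\<And>i j. i < n \<Longrightarrow> j < n \<Longrightarrow> ip n (u i) (u j) = (if i = j then 1 else 0)"
  shows "ip n x y = (\<Sum>j<n. ip n (u j) x * ip n (u j) y)"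
proof -
  have "ip n x y = ip n (\<lambda>k. \<Sum>j<n. ip n (u j) x * u j k) y"
    using orthonormal_expand[OF on] by (intro ip_cong) auto
  then show ?thesis by (simp add: ip_sum_left ip_scale_left)
qed

section \<open>Trace moments\<close>

lemma eigenbasisD:
  assumes "eigenbasis n A u a"
  shows "i < n \<Longrightarrow> j < n \<Longrightarrow> ip n (u i) (u j) = (if i = j then 1 else 0)"
    and "i < n \<Longrightarrow> j < n \<Longrightarrow> mv n A (u i) j = a i * u i j"
  using assms by (auto simp: eigenbasis_def)

text \<open>The difference of powers is \<open>a - b\<close> times the sum of the
  \<open>a^i b^(r-i)\<close>. The terms with exponents \<open>i\<close> and \<open>r - i\<close> are
  paired; each pair is at most \<open>a^r + b^r\<close> because \<open>x^i - y^i\<close> and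
  \<open>x^(r-i) - y^(r-i)\<close> have the same sign for nonnegative \<open>x\<close>,
  \<open>y\<close>. Evenness of \<open>r\<close> permits the passage to absolute values.\<close>

lemma power_diff_product_le:
  fixes a b :: real
  assumes "even r"
  shows "(a - b) * (a ^ Suc r - b ^ Suc r) \<le> (real (Suc r) / 2) * (a - b)\<^sup>2 * (a ^ r + b ^ r)"
proof -
  have pair: "a ^ i * b ^ (r - i) + a ^ (r - i) * b ^ i \<le> a ^ r + b ^ r" if "i \<le> r" for i
  proof -
    have *: "x ^ i * y ^ (r - i) + x ^ (r - i) * y ^ i \<le> x ^ r + y ^ r" if "0 \<le> x" "0 \<le> y" for x y :: real
    proof -
      have "(x ^ i - y ^ i) * (x ^ (r - i) - y ^ (r - i)) \<ge> 0"
      proof (cases "x \<le> y")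
        case True
        then show ?thesis using that power_mono[of x y] by (intro mult_nonpos_nonpos) auto
      next
        case False
        then show ?thesis using that power_mono[of y x] by (intro mult_nonneg_nonneg) auto
      qed
      moreover have "x ^ i * x ^ (r - i) = x ^ r" "y ^ i * y ^ (r - i) = y ^ r"
        using \<open>i \<le> r\<close> by (simp_all flip: power_add)
      ultimately show ?thesis by (simp add: algebra_simps)
    qed
    have "a ^ i * b ^ (r - i) + a ^ (r - i) * b ^ i
        \<le> \<bar>a\<bar> ^ i * \<bar>b\<bar> ^ (r - i) + \<bar>a\<bar> ^ (r - i) * \<bar>b\<bar> ^ i"
      by (intro add_mono) (metis abs_ge_self abs_mult power_abs)+
    also have "\<dots> \<le> \<bar>a\<bar> ^ r + \<bar>b\<bar> ^ r" by (rule *) auto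
    finally show ?thesis using \<open>even r\<close> by (simp add: power_even_abs)
  qed
  define s where "s = (\<Sum>i<Suc r. a ^ i * b ^ (r - i))"
  have s': "s = (\<Sum>i<Suc r. a ^ (r - i) * b ^ i)"
    unfolding s_def by (subst sum.nat_diff_reindex[symmetric]) (auto intro!: sum.cong)
  have "2 * s = (\<Sum>i<Suc r. a ^ i * b ^ (r - i) + a ^ (r - i) * b ^ i)"
    using s' by (simp add: sum.distrib s_def)
  also have "\<dots> \<le> (\<Sum>i<Suc r. a ^ r + b ^ r)"
    by (intro sum_mono pair) auto
  finally have s2: "2 * s \<le> real (Suc r) * (a ^ r + b ^ r)" by simp
  have "a ^ Suc r - b ^ Suc r = (a - b) * s"
    unfolding s_def by (subst power_diff_sumr2) (simp add: mult.commute)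
  then have "(a - b) * (a ^ Suc r - b ^ Suc r) = (a - b)\<^sup>2 * s"
    by (simp add: power2_eq_square)
  also have "\<dots> \<le> (a - b)\<^sup>2 * (real (Suc r) * (a ^ r + b ^ r) / 2)"
    using s2 by (intro mult_left_mono) auto
  finally show ?thesis by (simp add: mult_ac)
qed

lemma eigen_quadratic_form:
  assumes "eigenbasis n A u a"
  shows "ip n x (mv n A y) = (\<Sum>i<n. a i * ip n (u i) x * ip n (u i) y)"
proof -
  note on = eigenbasisD(1)[OF assms]
  have "mv n A y k = (\<Sum>j<n. (ip n (u j) y * a j) * u j k)" if "k < n" for k
  proof -
    have "mv n A y k = mv n A (\<lambda>l. \<Sum>j<n. ip n (u j) y * u j l) k"
      using orthonormal_expand[OF on] by (intro mv_cong) auto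
    also have "\<dots> = (\<Sum>j<n. ip n (u j) y * mv n A (u j) k)"
      unfolding mv_def sum_distrib_left by (subst sum.swap) (simp add: mult_ac)
    finally show ?thesis using eigenbasisD(2)[OF assms _ that] by (simp add: mult.assoc)
  qed
  then have "ip n x (mv n A y) = ip n x (\<lambda>k. \<Sum>j<n. (ip n (u j) y * a j) * u j k)"
    by (intro ip_cong) auto
  then show ?thesis
    by (simp add: ip_sum_right ip_scale_right) (simp add: ip_commute[of n x] mult_ac)
qed

lemma ip_eigenvector:
  assumes "eigenbasis n A u a" "i < n"
  shows "ip n (u i) (mv n A x) = a i * ip n (u i) x"
  unfolding eigen_quadratic_form[OF assms(1)] using eigenbasisD(1)[OF assms(1)] assms(2)
  by (subst sum.remove[of _ i]) (auto intro!: sum.neutral)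

lemma ip_eigenvalue:
  assumes "eigenbasis n A u a" "i < n"
  shows "ip n (u i) (mv n A (u i)) = a i"
  using ip_eigenvector[OF assms] eigenbasisD(1)[OF assms(1) assms(2) assms(2)] by simp

text \<open>Expanding both traces over the two eigenbases, with weights
  \<open>\<langle>u\<^sub>i, v\<^sub>j\<rangle>\<^sup>2\<close>, reduces a trace inequality to the scalar one.\<close>

lemma trace_power_diff_le:
  assumes A: "eigenbasis n A u a" and B: "eigenbasis n B v b" and "even r"
  shows "(\<Sum>i<n. a i ^ Suc r * ip n (u i) (mv n (\<lambda>k l. A k l - B k l) (u i)))
       - (\<Sum>j<n. b j ^ Suc r * ip n (v j) (mv n (\<lambda>k l. A k l - B k l) (v j)))
     \<le> (real (Suc r) / 2) *
       ((\<Sum>i<n. a i ^ r * ip n (mv n (\<lambda>k l. A k l - B k l) (u i)) (mv n (\<lambda>k l. A k l - B k l) (u i)))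
      + (\<Sum>j<n. b j ^ r * ip n (mv n (\<lambda>k l. A k l - B k l) (v j)) (mv n (\<lambda>k l. A k l - B k l) (v j))))"
proof -
  note ou = eigenbasisD(1)[OF A] and ov = eigenbasisD(1)[OF B]
  define H where "H = (\<lambda>k l. A k l - B k l)"
  define w where "w i j = (ip n (u i) (v j))\<^sup>2" for i j
  have Hmv: "mv n H x = (\<lambda>k. mv n A x k - mv n B x k)" for x
    by (auto simp: H_def mv_def left_diff_distrib sum_subtractf)
  have pu: "ip n x y = (\<Sum>j<n. ip n (u j) x * ip n (u j) y)" for x y
    by (rule parseval) (rule ou)
  have pv: "ip n x y = (\<Sum>j<n. ip n (v j) x * ip n (v j) y)" for x y
    by (rule parseval) (rule ov)
  \<comment> \<open>The squared overlaps of the two bases form a doubly stochastic matrix, so either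
    trace can be spread over both bases.\<close>
  have wu: "(\<Sum>j<n. w i j) = 1" if "i < n" for i
    using pv[of "u i" "u i"] ou[of i i] that
    by (simp add: w_def power2_eq_square ip_commute[of n "v j" "u i" for j])
  have wv: "(\<Sum>i<n. w i j) = 1" if "j < n" for j
    using pu[of "v j" "v j"] ov[of j j] that
    by (simp add: w_def power2_eq_square)
  have Au: "ip n x (mv n A (u i)) = a i * ip n x (u i)" if "i < n" for i x
    using eigenbasisD(2)[OF A that] by (simp add: ip_def sum_distrib_left mult_ac)
  have Bv: "ip n x (mv n B (v i)) = b i * ip n x (v i)" if "i < n" for i x
    using eigenbasisD(2)[OF B that] by (simp add: ip_def sum_distrib_left mult_ac)
  note Av = ip_eigenvector[OF A] and Bu = ip_eigenvector[OF B]
  have Hu: "ip n (u i) (mv n H (u i)) = (\<Sum>j<n. w i j * (a i - b j))" if "i < n" for i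
  proof -
    have "ip n (u i) (mv n B (u i)) = (\<Sum>j<n. b j * w i j)"
      unfolding eigen_quadratic_form[OF B] by (simp add: w_def power2_eq_square ip_commute[of n "v j" "u i" for j] mult.assoc)
    moreover have "ip n (u i) (mv n A (u i)) = (\<Sum>j<n. a i * w i j)"
      using Au[OF that, of "u i"] ou[of i i] wu[OF that] that by (simp flip: sum_distrib_left)
    ultimately show ?thesis
      by (simp add: Hmv ip_diff_right algebra_simps sum_subtractf)
  qed
  have Hv: "ip n (v j) (mv n H (v j)) = (\<Sum>i<n. w i j * (a i - b j))" if "j < n" for j
  proof -
    have "ip n (v j) (mv n A (v j)) = (\<Sum>i<n. a i * w i j)"
      unfolding eigen_quadratic_form[OF A] by (simp add: w_def power2_eq_square mult.assoc)
    moreover have "ip n (v j) (mv n B (v j)) = (\<Sum>i<n. b j * w i j)"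
      using Bv[OF that, of "v j"] ov[of j j] wv[OF that] that by (simp flip: sum_distrib_left)
    ultimately show ?thesis
      by (simp add: Hmv ip_diff_right algebra_simps sum_subtractf)
  qed
  \<comment> \<open>\<open>H = A - B\<close> is evaluated between an eigenvector of \<open>A\<close>
    and one of \<open>B\<close>: each matrix acts on its own eigenvector, which leaves the
    difference of the eigenvalues times the overlap.\<close>
  have cross: "ip n (v j) (mv n H (u i)) = (a i - b j) * ip n (u i) (v j)" if "i < n" "j < n" for i j
    using Au[OF that(1), of "v j"] Bu[OF that(2), of "u i"]
    by (simp add: Hmv ip_diff_right ip_commute[of n "v j" "u i"] algebra_simps)
  have cross': "ip n (u i) (mv n H (v j)) = (a i - b j) * ip n (u i) (v j)" if "i < n" "j < n" for i j
    using Av[OF that(1), of "v j"] Bv[OF that(2), of "u i"]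
    by (simp add: Hmv ip_diff_right algebra_simps)
  have HHu: "ip n (mv n H (u i)) (mv n H (u i)) = (\<Sum>j<n. w i j * (a i - b j)\<^sup>2)" if "i < n" for i
    using that by (subst pv, intro sum.cong refl) (simp add: cross w_def power2_eq_square)
  have HHv: "ip n (mv n H (v j)) (mv n H (v j)) = (\<Sum>i<n. w i j * (a i - b j)\<^sup>2)" if "j < n" for j
    using that by (subst pu, intro sum.cong refl) (simp add: cross' w_def power2_eq_square)
  have "(\<Sum>i<n. a i ^ Suc r * ip n (u i) (mv n H (u i))) - (\<Sum>j<n. b j ^ Suc r * ip n (v j) (mv n H (v j)))
      = (\<Sum>i<n. \<Sum>j<n. a i ^ Suc r * (w i j * (a i - b j)))
      - (\<Sum>j<n. \<Sum>i<n. b j ^ Suc r * (w i j * (a i - b j)))"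
    by (intro arg_cong2[of _ _ _ _ "(-)"] sum.cong refl) (simp_all add: Hu Hv sum_distrib_left)
  also have "\<dots> = (\<Sum>i<n. \<Sum>j<n. w i j * ((a i - b j) * (a i ^ Suc r - b j ^ Suc r)))"
    unfolding sum.swap[of "\<lambda>j i. b j ^ Suc r * (w i j * (a i - b j))"] sum_subtractf[symmetric]
    by (intro sum.cong refl) (simp add: algebra_simps)
  also have "\<dots> \<le> (\<Sum>i<n. \<Sum>j<n. w i j * ((real (Suc r) / 2) * (a i - b j)\<^sup>2 * (a i ^ r + b j ^ r)))"
    by (intro sum_mono mult_left_mono power_diff_product_le \<open>even r\<close>) (auto simp: w_def)
  also have "\<dots> = (real (Suc r) / 2) * ((\<Sum>i<n. \<Sum>j<n. a i ^ r * (w i j * (a i - b j)\<^sup>2))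
      + (\<Sum>j<n. \<Sum>i<n. b j ^ r * (w i j * (a i - b j)\<^sup>2)))"
    unfolding sum.swap[of "\<lambda>j i. b j ^ r * (w i j * (a i - b j)\<^sup>2)"] sum.distrib[symmetric] sum_distrib_left
    by (intro sum.cong refl) (simp add: field_simps)
  also have "\<dots> = (real (Suc r) / 2) * ((\<Sum>i<n. a i ^ r * ip n (mv n H (u i)) (mv n H (u i)))
      + (\<Sum>j<n. b j ^ r * ip n (mv n H (v j)) (mv n H (v j))))"
    by (intro arg_cong2[of _ _ _ _ "(*)"] arg_cong2[of _ _ _ _ "(+)"] sum.cong refl)
       (simp_all add: HHu HHv sum_distrib_left)
  finally show ?thesis by (simp add: H_def)
qed

text \<open>A fixed choice of eigenbasis makes the eigenvectors functions of the mask. Means are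
  finite sums, so an arbitrary choice raises no question of measurability.\<close>

definition evec :: "nat \<Rightarrow> (nat \<Rightarrow> nat \<Rightarrow> real) \<Rightarrow> nat \<Rightarrow> nat \<Rightarrow> real" where
  "evec n A = fst (SOME ua. eigenbasis n A (fst ua) (snd ua))"

definition evl :: "nat \<Rightarrow> (nat \<Rightarrow> nat \<Rightarrow> real) \<Rightarrow> nat \<Rightarrow> real" where
  "evl n A = snd (SOME ua. eigenbasis n A (fst ua) (snd ua))"

lemma eigenbasis_evec: "sym_on n A \<Longrightarrow> eigenbasis n A (evec n A) (evl n A)"
proof -
  assume "sym_on n A"
  then obtain u a where "eigenbasis n A u a" by (rule spectral_theorem)
  then have "eigenbasis n A (fst (u, a)) (snd (u, a))" by simp
  then show ?thesis unfolding evec_def evl_def by (rule someI)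
qed

lemma mv_matrix_diff: "mv n (\<lambda>k i. A k i - B k i) x = (\<lambda>k. mv n A x k - mv n B x k)"
  by (auto simp: mv_def left_diff_distrib sum_subtractf)

lemma mv_matrix_sum: "mv n (\<lambda>k i. \<Sum>l\<in>L. A l k i) x = (\<lambda>k. \<Sum>l\<in>L. mv n (A l) x k)"
  by (rule ext) (simp add: mv_def sum_distrib_right sum.swap[of _ "{..<n}"])

lemma mv_matrix_bern: "mv n (\<lambda>k i. bern p S (\<lambda>B. A B k i)) x = (\<lambda>k. bern p S (\<lambda>B. mv n (A B) x k))"
  by (rule ext) (simp add: mv_def bern_sum bern_cmult_right)

lemma ip_bern: "ip n y (\<lambda>k. bern p S (\<lambda>B. x B k)) = bern p S (\<lambda>B. ip n y (x B))"
  by (simp add: ip_def bern_sum bern_cmult)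

lemma ip_diff_sq_le: "ip n (\<lambda>k. x k - y k) (\<lambda>k. x k - y k) \<le> 2 * ip n x x + 2 * ip n y y"
  unfolding ip_def sum_distrib_left sum.distrib[symmetric]
proof (intro sum_mono)
  fix i
  have "0 \<le> (x i + y i)\<^sup>2" by simp
  then show "(x i - y i) * (x i - y i) \<le> 2 * (x i * x i) + 2 * (y i * y i)"
    by (simp add: power2_eq_square algebra_simps)
qed

text \<open>Each mean is taken over the block \<open>C l\<close> only. It is the full mean as soon
  as \<open>W l\<close> depends on the mask through that block alone, which is how the definition is
  used.\<close>

definition centered :: "real \<Rightarrow> 'l set \<Rightarrow> ('l \<Rightarrow> 'a set) \<Rightarrow> ('l \<Rightarrow> 'a set \<Rightarrow> nat \<Rightarrow> nat \<Rightarrow> real) \<Rightarrow>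
    'a set \<Rightarrow> nat \<Rightarrow> nat \<Rightarrow> real" where
  "centered p L C W A = (\<lambda>i j. \<Sum>l\<in>L. W l A i j - bern p (C l) (\<lambda>B. W l B i j))"

text \<open>The method of exchangeable pairs: resampling one block \<open>C l\<close> turns the trace of
  \<open>H\<^sub>l G\<^bsup>r+1\<^esup>\<close> into a trace difference.\<close>

theorem trace_moment_le:
  fixes W :: "'l \<Rightarrow> 'a set \<Rightarrow> nat \<Rightarrow> nat \<Rightarrow> real"
  assumes "finite S" and p: "0 \<le> p" "p \<le> 1" and "finite L"
    and CS: "\<And>l. l \<in> L \<Longrightarrow> C l \<subseteq> S" and disj: "disjoint_family_on C L"
    and loc: "\<And>l A. l \<in> L \<Longrightarrow> W l (A \<inter> C l) = W l A"
    and sym: "\<And>l A. l \<in> L \<Longrightarrow> sym_on n (W l A)"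
    and "even r"
  defines "u \<equiv> \<lambda>A. evec n (centered p L C W A)" and "a \<equiv> \<lambda>A. evl n (centered p L C W A)"
  shows "bern p S (\<lambda>A. \<Sum>j<n. a A j ^ (r + 2)) \<le>
    real (Suc r) * bern p S (\<lambda>A. \<Sum>j<n. a A j ^ r *
      ((\<Sum>l\<in>L. ip n (mv n (W l A) (u A j)) (mv n (W l A) (u A j)))
     + (\<Sum>l\<in>L. bern p (C l) (\<lambda>B. ip n (mv n (W l B) (u A j)) (mv n (W l B) (u A j))))))"
proof -
  define G where "G = centered p L C W"
  have symG: "sym_on n (G A)" for A
    using sym unfolding G_def centered_def sym_on_def by (auto intro!: sum.cong)
  have eb: "eigenbasis n (G A) (u A) (a A)" for A
    unfolding u_def a_def G_def[symmetric] by (rule eigenbasis_evec[OF symG])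
  define F where "F l A B = (\<Sum>j<n. a A j ^ Suc r *
      ip n (u A j) (mv n (\<lambda>k i. W l A k i - W l B k i) (u A j)))" for l A B
  define K where "K l A B = (\<Sum>j<n. a A j ^ r *
      ip n (mv n (\<lambda>k i. W l A k i - W l B k i) (u A j)) (mv n (\<lambda>k i. W l A k i - W l B k i) (u A j)))" for l A B
  have finC: "finite (C l)" if "l \<in> L" for l using CS[OF that] \<open>finite S\<close> finite_subset by blast
  \<comment> \<open>One factor \<open>a A j\<close> of the power is written as the quadratic form of
    \<open>G A\<close>. The centering of block \<open>l\<close> is the mean over an independent copy
    \<open>B\<close> of that block, which turns the trace into means of
    \<open>F l A B\<close>.\<close>
  have tr: "(\<Sum>j<n. a A j ^ (r + 2)) = (\<Sum>l\<in>L. bern p (C l) (\<lambda>B. F l A B))" for A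
  proof -
    have "(\<Sum>j<n. a A j ^ (r + 2)) = (\<Sum>j<n. a A j ^ Suc r * ip n (u A j) (mv n (G A) (u A j)))"
    proof (intro sum.cong refl)
      fix j assume "j \<in> {..<n}"
      then have "ip n (u A j) (mv n (G A) (u A j)) = a A j" by (intro ip_eigenvalue[OF eb]) simp
      then show "a A j ^ (r + 2) = a A j ^ Suc r * ip n (u A j) (mv n (G A) (u A j))" by simp
    qed
    also have "\<dots> = (\<Sum>j<n. a A j ^ Suc r * (\<Sum>l\<in>L. bern p (C l) (\<lambda>B.
        ip n (u A j) (mv n (\<lambda>k i. W l A k i - W l B k i) (u A j)))))"
    proof (intro sum.cong refl arg_cong2[of _ _ _ _ "(*)"])
      fix j
      have "ip n (u A j) (mv n (G A) (u A j)) = (\<Sum>l\<in>L. ip n (u A j) (mv n (W l A) (u A j))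
          - bern p (C l) (\<lambda>B. ip n (u A j) (mv n (W l B) (u A j))))"
        unfolding G_def centered_def mv_matrix_sum mv_matrix_diff mv_matrix_bern
        by (simp add: ip_sum_right ip_diff_right ip_bern)
      also have "\<dots> = (\<Sum>l\<in>L. bern p (C l) (\<lambda>B.
          ip n (u A j) (mv n (\<lambda>k i. W l A k i - W l B k i) (u A j))))"
        using finC by (intro sum.cong refl) (simp add: mv_matrix_diff ip_diff_right bern_diff bern_const)
      finally show "ip n (u A j) (mv n (G A) (u A j)) = \<dots>" .
    qed
    also have "\<dots> = (\<Sum>l\<in>L. bern p (C l) (\<lambda>B. F l A B))"
      unfolding sum_distrib_left F_def bern_sum bern_cmult by (rule sum.swap)
    finally show ?thesis .
  qed
  have step: "bern p S (\<lambda>A. bern p (C l) (\<lambda>B. F l A B))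
      \<le> (real (Suc r) / 2) * bern p S (\<lambda>A. bern p (C l) (\<lambda>B. K l A B))" if l: "l \<in> L" for l
  proof -
    \<comment> \<open>Exchanging the block turns \<open>A\<close> into
      \<open>A - C l \<union> B\<close> and reverses the sign of \<open>W l A - W l B\<close>. That
      difference is also \<open>G\<close> before minus \<open>G\<close> after the exchange, so the
      two terms \<open>F\<close> together are exactly the trace difference of
      \<open>trace_power_diff_le\<close>.\<close>
    have ptw: "F l A B + F l (A - C l \<union> B) (A \<inter> C l)
        \<le> (real (Suc r) / 2) * (K l A B + K l (A - C l \<union> B) (A \<inter> C l))"
      if "A \<subseteq> S" "B \<subseteq> C l" for A B
    proof -
      define A' where "A' = A - C l \<union> B"
      have other: "W l' A' = W l' A" if "l' \<in> L" "l' \<noteq> l" for l'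
      proof -
        have "C l' \<inter> C l = {}" using disj l that by (auto simp: disjoint_family_on_def)
        then have "A' \<inter> C l' = A \<inter> C l'" using \<open>B \<subseteq> C l\<close> by (auto simp: A'_def)
        then show ?thesis using loc[OF that(1)] by metis
      qed
      have "A' \<inter> C l = B \<inter> C l" using \<open>B \<subseteq> C l\<close> by (auto simp: A'_def)
      then have WA': "W l A' = W l B" using loc[OF l] by metis
      have WA: "W l (A \<inter> C l) = W l A" by (rule loc[OF l])
      have GG: "(\<lambda>k i. G A k i - G A' k i) = (\<lambda>k i. W l A k i - W l B k i)"
      proof (intro ext)
        fix k i
        have "G A k i - G A' k i = (\<Sum>l'\<in>L. W l' A k i - W l' A' k i)"
          unfolding G_def centered_def by (simp flip: sum_subtractf)
        also have "\<dots> = (\<Sum>l'\<in>L. if l' = l then W l A k i - W l A' k i else 0)"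
          using other by (intro sum.cong) auto
        finally show "G A k i - G A' k i = W l A k i - W l B k i"
          using l \<open>finite L\<close> by (simp add: WA')
      qed
      have F': "F l A' (A \<inter> C l) = - (\<Sum>j<n. a A' j ^ Suc r *
          ip n (u A' j) (mv n (\<lambda>k i. W l A k i - W l B k i) (u A' j)))"
        unfolding F_def WA WA'
        by (simp add: mv_matrix_diff ip_diff_right algebra_simps sum_subtractf)
      have K': "K l A' (A \<inter> C l) = (\<Sum>j<n. a A' j ^ r *
          ip n (mv n (\<lambda>k i. W l A k i - W l B k i) (u A' j)) (mv n (\<lambda>k i. W l A k i - W l B k i) (u A' j)))"
        unfolding K_def WA WA' by (simp add: mv_matrix_diff ip_diff_right ip_diff_left algebra_simps)
      from trace_power_diff_le[OF eb[of A] eb[of A'] \<open>even r\<close>]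
      show ?thesis
        unfolding GG A'_def[symmetric] F' K' by (simp add: F_def K_def)
    qed
    \<comment> \<open>Exchangeability: both halves of \<open>ptw\<close> have the same mean.\<close>
    have fs: "bern p S (\<lambda>A. bern p (C l) (\<lambda>B. \<Phi> (A - C l \<union> B) (A \<inter> C l)))
        = bern p S (\<lambda>A. bern p (C l) (\<lambda>B. \<Phi> A B))" for \<Phi> :: "'a set \<Rightarrow> 'a set \<Rightarrow> real"
      using bern_resample[OF \<open>finite S\<close> CS[OF l], of p \<Phi>] by simp
    have "2 * bern p S (\<lambda>A. bern p (C l) (\<lambda>B. F l A B))
       = bern p S (\<lambda>A. bern p (C l) (\<lambda>B. F l A B + F l (A - C l \<union> B) (A \<inter> C l)))"
      by (simp add: bern_add fs)
    also have "\<dots> \<le> bern p S (\<lambda>A. bern p (C l) (\<lambda>B.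
        (real (Suc r) / 2) * (K l A B + K l (A - C l \<union> B) (A \<inter> C l))))"
      using p by (intro bern_mono ptw) auto
    also have "\<dots> = 2 * ((real (Suc r) / 2) * bern p S (\<lambda>A. bern p (C l) (\<lambda>B. K l A B)))"
      unfolding bern_cmult bern_add fs by simp
    finally show ?thesis by linarith
  qed
  \<comment> \<open>Separating the two terms in the squared difference costs a factor 2, which
    cancels the 1/2 in \<open>step\<close>.\<close>
  have K2: "bern p (C l) (\<lambda>B. K l A B) \<le> 2 * (\<Sum>j<n. a A j ^ r *
      (ip n (mv n (W l A) (u A j)) (mv n (W l A) (u A j))
       + bern p (C l) (\<lambda>B. ip n (mv n (W l B) (u A j)) (mv n (W l B) (u A j)))))"
    if l: "l \<in> L" for l A
  proof -
    have "bern p (C l) (\<lambda>B. K l A B) \<le> bern p (C l) (\<lambda>B. \<Sum>j<n. a A j ^ r *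
      (2 * ip n (mv n (W l A) (u A j)) (mv n (W l A) (u A j))
       + 2 * ip n (mv n (W l B) (u A j)) (mv n (W l B) (u A j))))"
      unfolding K_def mv_matrix_diff using p \<open>even r\<close>
      by (intro bern_mono sum_mono mult_left_mono ip_diff_sq_le) auto
    also have "\<dots> = (\<Sum>j<n. a A j ^ r *
      (2 * ip n (mv n (W l A) (u A j)) (mv n (W l A) (u A j))
       + 2 * bern p (C l) (\<lambda>B. ip n (mv n (W l B) (u A j)) (mv n (W l B) (u A j)))))"
      using finC[OF l] by (simp add: bern_sum bern_cmult bern_add bern_const)
    finally show ?thesis by (simp add: sum_distrib_left algebra_simps)
  qed
  have "bern p S (\<lambda>A. \<Sum>j<n. a A j ^ (r + 2)) = (\<Sum>l\<in>L. bern p S (\<lambda>A. bern p (C l) (\<lambda>B. F l A B)))"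
    unfolding tr by (rule bern_sum)
  also have "\<dots> \<le> (\<Sum>l\<in>L. (real (Suc r) / 2) * bern p S (\<lambda>A. bern p (C l) (\<lambda>B. K l A B)))"
    by (intro sum_mono step)
  also have "\<dots> = (real (Suc r) / 2) * bern p S (\<lambda>A. \<Sum>l\<in>L. bern p (C l) (\<lambda>B. K l A B))"
    by (simp add: bern_sum sum_distrib_left)
  also have "\<dots> \<le> (real (Suc r) / 2) * bern p S (\<lambda>A. \<Sum>l\<in>L. 2 * (\<Sum>j<n. a A j ^ r *
      (ip n (mv n (W l A) (u A j)) (mv n (W l A) (u A j))
       + bern p (C l) (\<lambda>B. ip n (mv n (W l B) (u A j)) (mv n (W l B) (u A j))))))"
    using p by (intro mult_left_mono bern_mono sum_mono K2) auto
  also have "\<dots> = real (Suc r) * bern p S (\<lambda>A. \<Sum>l\<in>L. \<Sum>j<n. a A j ^ r *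
      (ip n (mv n (W l A) (u A j)) (mv n (W l A) (u A j))
       + bern p (C l) (\<lambda>B. ip n (mv n (W l B) (u A j)) (mv n (W l B) (u A j)))))"
    unfolding sum_distrib_left[symmetric] bern_cmult by simp
  also have "\<dots> = real (Suc r) * bern p S (\<lambda>A. \<Sum>j<n. a A j ^ r *
      ((\<Sum>l\<in>L. ip n (mv n (W l A) (u A j)) (mv n (W l A) (u A j)))
     + (\<Sum>l\<in>L. bern p (C l) (\<lambda>B. ip n (mv n (W l B) (u A j)) (mv n (W l B) (u A j))))))"
    unfolding sum.distrib[symmetric] sum_distrib_left by (subst sum.swap) (rule refl)
  finally show ?thesis .
qed

section \<open>Scalar moments of a mask, and the spectral tail bound from trace moments\<close>

lemma bern_split_elem:
  assumes "finite S" "x \<in> S"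
  shows "bern p S f = p * bern p (S - {x}) (\<lambda>A. f (insert x A)) + (1 - p) * bern p (S - {x}) f"
  using bern_insert[of "S - {x}" x p f] assms by (simp add: insert_absorb)

lemma bern_linear:
  "finite S \<Longrightarrow> bern p S (\<lambda>A. \<Sum>x\<in>S. of_bool (x \<in> A) * c x) = p * (\<Sum>x\<in>S. c x)"
proof -
  assume "finite S"
  have "bern p S (\<lambda>A. of_bool (x \<in> A) * c x) = p * c x" if "x \<in> S" for x
  proof -
    have "bern p (S - {x}) (\<lambda>A. of_bool (x \<in> A) * c x) = bern p (S - {x}) (\<lambda>A. 0)"
      by (intro bern_cong) auto
    then show ?thesis
      using \<open>finite S\<close> that by (subst bern_split_elem[of S x]) (simp_all add: bern_const)
  qed
  then show ?thesis by (simp add: bern_sum sum_distrib_left)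
qed

lemma bern_linear_sq:
  "finite S \<Longrightarrow> bern p S (\<lambda>A. (\<Sum>x\<in>S. of_bool (x \<in> A) * c x)\<^sup>2)
    = p\<^sup>2 * (\<Sum>x\<in>S. c x)\<^sup>2 + p * (1 - p) * (\<Sum>x\<in>S. (c x)\<^sup>2)"
proof (induction S rule: finite_induct)
  case (insert x S)
  define f where "f A = (\<Sum>x\<in>S. of_bool (x \<in> A) * c x)" for A
  have 1: "bern p S (\<lambda>A. (\<Sum>y\<in>insert x S. of_bool (y \<in> insert x A) * c y)\<^sup>2)
      = bern p S (\<lambda>A. (c x)\<^sup>2 + (2 * c x) * f A + (f A)\<^sup>2)"
  proof (intro bern_cong)
    fix A
    have "(\<Sum>y\<in>S. of_bool (y \<in> insert x A) * c y) = f A"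
      unfolding f_def using insert.hyps by (intro sum.cong) auto
    then show "(\<Sum>y\<in>insert x S. of_bool (y \<in> insert x A) * c y)\<^sup>2 = (c x)\<^sup>2 + (2 * c x) * f A + (f A)\<^sup>2"
      using insert.hyps by (simp add: power2_eq_square algebra_simps)
  qed
  have 2: "bern p S (\<lambda>A. (\<Sum>y\<in>insert x S. of_bool (y \<in> A) * c y)\<^sup>2) = bern p S (\<lambda>A. (f A)\<^sup>2)"
  proof (intro bern_cong)
    fix A assume "A \<subseteq> S"
    then have "x \<notin> A" using insert.hyps by auto
    then show "(\<Sum>y\<in>insert x S. of_bool (y \<in> A) * c y)\<^sup>2 = (f A)\<^sup>2"
      using insert.hyps by (simp add: f_def)
  qed
  have 3: "bern p S f = p * (\<Sum>x\<in>S. c x)" unfolding f_def by (rule bern_linear) fact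
  have "bern p (insert x S) (\<lambda>A. (\<Sum>y\<in>insert x S. of_bool (y \<in> A) * c y)\<^sup>2)
      = p * ((c x)\<^sup>2 + (2 * c x) * (p * (\<Sum>x\<in>S. c x)) + bern p S (\<lambda>A. (f A)\<^sup>2))
        + (1 - p) * bern p S (\<lambda>A. (f A)\<^sup>2)"
    unfolding bern_insert[OF insert.hyps] 1 2
    using insert.hyps by (simp add: bern_add bern_cmult bern_const 3)
  also have "\<dots> = p * (c x)\<^sup>2 + 2 * c x * p\<^sup>2 * (\<Sum>x\<in>S. c x) + bern p S (\<lambda>A. (f A)\<^sup>2)"
    by (simp add: algebra_simps power2_eq_square)
  finally show ?case
    using insert by (simp add: f_def) (simp add: algebra_simps power2_eq_square)
qed simp

text \<open>The exponential moment at parameter 1. From \<open>exp 1 \<le> 3\<close> each element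
  contributes at most \<open>1 + 2p\<close>, which is the source of the factors 2 in the exponents
  of the counting bounds.\<close>

lemma bern_exp_card_le:
  assumes "finite S" "0 \<le> p" "p \<le> 1"
  shows "bern p S (\<lambda>A. exp (real (card A))) \<le> exp (2 * p * card S)"
proof -
  have e: "exp (1::real) \<le> 3" by (rule exp_le)
  have "bern p S (\<lambda>A. exp (real (card A))) = bern p S (\<lambda>A. \<Prod>x\<in>S. if x \<in> A then exp 1 else 1)"
  proof (intro bern_cong)
    fix A assume "A \<subseteq> S"
    then have "(\<Prod>x\<in>S. if x \<in> A then exp 1 else 1 :: real) = exp 1 ^ card A"
      using \<open>finite S\<close> by (simp add: prod.If_cases Int_absorb1)
    then show "exp (real (card A)) = (\<Prod>x\<in>S. if x \<in> A then exp 1 else 1)"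
      by (simp flip: exp_of_nat_mult)
  qed
  also have "\<dots> = (p * exp 1 + (1 - p)) ^ card S"
    using \<open>finite S\<close> by (simp add: bern_prod_if)
  also have "\<dots> \<le> exp (2 * p) ^ card S"
  proof (intro power_mono)
    have "p * exp 1 \<le> p * 3" using e assms by (intro mult_left_mono) auto
    then have "p * exp 1 + (1 - p) \<le> 1 + 2 * p" by simp
    also have "\<dots> \<le> exp (2 * p)" by (rule exp_ge_add_one_self)
    finally show "p * exp 1 + (1 - p) \<le> exp (2 * p)" .
  qed (use assms in auto)
  finally show ?thesis by (simp add: mult_ac flip: exp_of_nat_mult)
qed

text \<open>With \<open>z = max |x| s\<close>, the assumptions bound \<open>c |x|\<close> and
  \<open>v\<close> by \<open>z^2 / (4 (r+1))\<close> each, so the left side is at most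
  \<open>z^(r+2) / 2\<close>. The coefficient 1/2 on the right is what allows a moment to be
  absorbed.\<close>

lemma power_Young_le:
  fixes x s c v :: real
  assumes "0 \<le> s" "0 \<le> c" "0 \<le> v" and c: "4 * real (Suc r) * c \<le> s" and v: "4 * real (Suc r) * v \<le> s\<^sup>2"
    and "even r"
  shows "real (Suc r) * (x ^ r * (c * \<bar>x\<bar> + v)) \<le> x ^ (r + 2) / 2 + s ^ (r + 2) / 2"
proof -
  define y where "y = \<bar>x\<bar>"
  have xy: "x ^ r = y ^ r" "x ^ (r + 2) = y ^ (r + 2)" using \<open>even r\<close> by (simp_all add: y_def power_even_abs)
  have y0: "0 \<le> y" by (simp add: y_def)
  define z where "z = max y s"
  have z: "y \<le> z" "s \<le> z" "0 \<le> z" using y0 by (auto simp: z_def)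
  have "y ^ r * (4 * real (Suc r) * c * y + 4 * real (Suc r) * v) \<le> z ^ r * (z * z + z\<^sup>2)"
  proof (intro mult_mono add_mono power_mono)
    show "4 * real (Suc r) * c \<le> z" using c z by linarith
    show "4 * real (Suc r) * v \<le> z\<^sup>2" using v power_mono[OF z(2) \<open>0 \<le> s\<close>, of 2] by linarith
  qed (use z y0 assms in auto)
  also have "\<dots> = 2 * z ^ (r + 2)" by (simp add: power_add power2_eq_square)
  also have "z ^ (r + 2) \<le> y ^ (r + 2) + s ^ (r + 2)"
    using y0 \<open>0 \<le> s\<close> by (auto simp: z_def max_def)
  finally show ?thesis unfolding xy y_def[symmetric] by (simp add: algebra_simps)
qed

text \<open>The moment bound is self-bounding. On good masks the variance proxy is affine in the
  quadratic form of \<open>G\<close>, and Young's inequality returns half of the moment itself. On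
  bad masks only the bound \<open>K\<close> is used, at the price \<epsilon>. Markov's inequality at
  level \<open>4 s\<close> then gains \<open>4^(r+2)\<close>. The proxy \<open>V\<close> is
  evaluated at vectors because only its values at the eigenvectors of \<open>G\<close>
  occur.\<close>

theorem spectral_tail_le:
  fixes W :: "'l \<Rightarrow> 'a set \<Rightarrow> nat \<Rightarrow> nat \<Rightarrow> real"
  assumes "finite S" and p: "0 \<le> p" "p \<le> 1" and "finite L"
    and CS: "\<And>l. l \<in> L \<Longrightarrow> C l \<subseteq> S" and disj: "disjoint_family_on C L"
    and loc: "\<And>l A. l \<in> L \<Longrightarrow> W l (A \<inter> C l) = W l A"
    and sym: "\<And>l A. l \<in> L \<Longrightarrow> sym_on n (W l A)"
    and "even r"
  defines "G \<equiv> centered p L C W"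
  defines "V \<equiv> \<lambda>A y. (\<Sum>l\<in>L. ip n (mv n (W l A) y) (mv n (W l A) y))
     + (\<Sum>l\<in>L. bern p (C l) (\<lambda>B. ip n (mv n (W l B) y) (mv n (W l B) y)))"
  assumes good: "\<And>A y. A \<subseteq> S \<Longrightarrow> \<not> bad A \<Longrightarrow> ip n y y = 1 \<Longrightarrow> V A y \<le> c * \<bar>ip n y (mv n (G A) y)\<bar> + v"
    and crude: "\<And>A y. A \<subseteq> S \<Longrightarrow> ip n y y = 1 \<Longrightarrow> \<bar>ip n y (mv n (G A) y)\<bar> \<le> K \<and> V A y \<le> K\<^sup>2"
    and cv: "0 \<le> c" "0 \<le> v" "4 * real (Suc r) * c \<le> s" "4 * real (Suc r) * v \<le> s\<^sup>2" and "0 < s" "0 \<le> K"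
    and bad: "bern p S (\<lambda>A. of_bool (bad A)) \<le> \<epsilon>"
  shows "bern p S (\<lambda>A. of_bool (\<not> (\<forall>y. \<bar>ip n y (mv n (G A) y)\<bar> \<le> 4 * s * ip n y y)))
    \<le> real n * (1 + 2 * real (Suc r) * (K / s) ^ (r + 2) * \<epsilon>) / 4 ^ (r + 2)"
proof -
  define u where "u A = evec n (G A)" for A
  define a where "a A = evl n (G A)" for A
  have symG: "sym_on n (G A)" for A
    using sym unfolding G_def centered_def sym_on_def by (auto intro!: sum.cong)
  have eb: "eigenbasis n (G A) (u A) (a A)" for A
    unfolding u_def a_def by (rule eigenbasis_evec[OF symG])
  note uG = ip_eigenvalue[OF eb]
  define E where "E = bern p S (\<lambda>A. \<Sum>j<n. a A j ^ (r + 2))"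
  have "E \<le> real (Suc r) * bern p S (\<lambda>A. \<Sum>j<n. a A j ^ r * V A (u A j))"
    unfolding E_def V_def a_def u_def G_def by (rule trace_moment_le) fact+
  also have "\<dots> = bern p S (\<lambda>A. \<Sum>j<n. real (Suc r) * (a A j ^ r * V A (u A j)))"
    by (simp only: sum_distrib_left bern_cmult[symmetric])
  also have "\<dots> \<le> bern p S (\<lambda>A. \<Sum>j<n. (a A j ^ (r + 2) / 2 + s ^ (r + 2) / 2)
       + of_bool (bad A) * (real (Suc r) * K ^ (r + 2)))"
  proof (intro bern_mono sum_mono p)
    fix A j assume A: "A \<subseteq> S" and "j \<in> {..<n}"
    then have j: "j < n" by simp
    have u1: "ip n (u A j) (u A j) = 1" using eigenbasisD(1)[OF eb j j] by simp
    show "real (Suc r) * (a A j ^ r * V A (u A j)) \<le> (a A j ^ (r + 2) / 2 + s ^ (r + 2) / 2)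
       + of_bool (bad A) * (real (Suc r) * K ^ (r + 2))"
    proof (cases "bad A")
      case False
      have "real (Suc r) * (a A j ^ r * V A (u A j)) \<le> real (Suc r) * (a A j ^ r * (c * \<bar>a A j\<bar> + v))"
        using good[OF A False u1] \<open>even r\<close> by (intro mult_left_mono) (auto simp: uG[OF j])
      also have "\<dots> \<le> a A j ^ (r + 2) / 2 + s ^ (r + 2) / 2"
        using cv \<open>0 < s\<close> \<open>even r\<close> by (intro power_Young_le) auto
      finally show ?thesis using False by simp
    next
      case True
      have "a A j ^ r = \<bar>a A j\<bar> ^ r" using \<open>even r\<close> by (simp add: power_even_abs)
      also have "\<dots> \<le> K ^ r" using crude[OF A u1] uG[OF j, of A] by (intro power_mono) auto
      finally have "a A j ^ r * V A (u A j) \<le> K ^ r * K\<^sup>2"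
        using crude[OF A u1] \<open>even r\<close>
        by (intro order.trans[OF mult_left_mono mult_right_mono]) auto
      then have "real (Suc r) * (a A j ^ r * V A (u A j)) \<le> real (Suc r) * K ^ (r + 2)"
        unfolding power_add by (intro mult_left_mono) auto
      moreover have "0 \<le> a A j ^ (r + 2)" "0 \<le> s ^ (r + 2)" using \<open>even r\<close> \<open>0 < s\<close>
        by (auto intro!: zero_le_even_power simp del: power_Suc add_2_eq_Suc')
      ultimately show ?thesis unfolding of_bool_def using True by (simp only: if_True mult_1)
    qed
  qed
  also have "\<dots> = E / 2 + n * s ^ (r + 2) / 2 + n * (real (Suc r) * K ^ (r + 2)) * bern p S (\<lambda>A. of_bool (bad A))"
  proof -
    have "bern p S (\<lambda>A. \<Sum>j<n. (a A j ^ (r + 2) / 2 + s ^ (r + 2) / 2)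
       + of_bool (bad A) * (real (Suc r) * K ^ (r + 2)))
     = bern p S (\<lambda>A. ((\<Sum>j<n. a A j ^ (r + 2)) * (1 / 2) + n * s ^ (r + 2) / 2)
       + of_bool (bad A) * (n * (real (Suc r) * K ^ (r + 2))))"
      by (intro bern_cong) (simp add: sum.distrib flip: sum_divide_distrib)
    then show ?thesis
      unfolding bern_add bern_cmult_right E_def bern_const[OF \<open>finite S\<close>] by simp
  qed
  also have "\<dots> \<le> E / 2 + n * s ^ (r + 2) / 2 + n * (real (Suc r) * K ^ (r + 2)) * \<epsilon>"
    using bad \<open>0 \<le> K\<close> by (intro add_left_mono mult_left_mono) auto
  \<comment> \<open>Half of \<open>E\<close> is absorbed on the left; \<open>E\<close> is a finite
    sum, so it may be subtracted.\<close>
  finally have "E \<le> n * s ^ (r + 2) + 2 * (n * (real (Suc r) * K ^ (r + 2)) * \<epsilon>)" by linarith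
  also have "\<dots> = n * (1 + 2 * real (Suc r) * (K / s) ^ (r + 2) * \<epsilon>) * s ^ (r + 2)"
    using \<open>0 < s\<close> by (simp only: power_divide) (simp add: field_simps)
  finally have E: "E \<le> n * (1 + 2 * real (Suc r) * (K / s) ^ (r + 2) * \<epsilon>) * s ^ (r + 2)" .
  have "bern p S (\<lambda>A. of_bool (\<not> (\<forall>y. \<bar>ip n y (mv n (G A) y)\<bar> \<le> 4 * s * ip n y y))) \<le> E / (4 * s) ^ (r + 2)"
    unfolding E_def
  proof (rule bern_markov[OF p])
    show "0 < (4 * s) ^ (r + 2)" using \<open>0 < s\<close> by simp
    fix A assume "A \<subseteq> S"
    show "0 \<le> (\<Sum>j<n. a A j ^ (r + 2))" using \<open>even r\<close> by (intro sum_nonneg zero_le_even_power) simp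
    assume not: "\<not> (\<forall>y. \<bar>ip n y (mv n (G A) y)\<bar> \<le> 4 * s * ip n y y)"
    \<comment> \<open>If all eigenvalues were at most \<open>4 s\<close> in modulus, the spectral
      expansion would bound the quadratic form. One large eigenvalue suffices, since the terms of an
      even trace power are nonnegative.\<close>
    have "\<exists>j<n. 4 * s < \<bar>a A j\<bar>"
    proof (rule ccontr)
      assume "\<not> ?thesis"
      then have le: "\<bar>a A j\<bar> \<le> 4 * s" if "j < n" for j using that by force
      have "\<bar>ip n y (mv n (G A) y)\<bar> \<le> 4 * s * ip n y y" for y
      proof -
        have "ip n y (mv n (G A) y) = (\<Sum>j<n. a A j * (ip n (u A j) y)\<^sup>2)"
          unfolding eigen_quadratic_form[OF eb] by (simp add: power2_eq_square mult.assoc)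
        then have "\<bar>ip n y (mv n (G A) y)\<bar> \<le> (\<Sum>j<n. \<bar>a A j\<bar> * (ip n (u A j) y)\<^sup>2)"
          using sum_abs[of "\<lambda>j. a A j * (ip n (u A j) y)\<^sup>2" "{..<n}"] by (simp add: abs_mult)
        also have "\<dots> \<le> (\<Sum>j<n. 4 * s * (ip n (u A j) y)\<^sup>2)"
          using le by (intro sum_mono mult_right_mono) auto
        also have "\<dots> = 4 * s * ip n y y"
          using parseval[of n "u A" y y, OF eigenbasisD(1)[OF eb]]
          by (simp add: sum_distrib_left power2_eq_square)
        finally show ?thesis .
      qed
      with not show False by blast
    qed
    then obtain j where j: "j < n" "4 * s < \<bar>a A j\<bar>" by blast
    have "(4 * s) ^ (r + 2) \<le> \<bar>a A j\<bar> ^ (r + 2)" using j \<open>0 < s\<close> by (intro power_mono) auto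
    also have "\<dots> = a A j ^ (r + 2)" using \<open>even r\<close> by (intro power_even_abs) simp
    also have "\<dots> \<le> (\<Sum>j<n. a A j ^ (r + 2))" using j \<open>even r\<close> by (intro member_le_sum zero_le_even_power) auto
    finally show "(4 * s) ^ (r + 2) \<le> (\<Sum>j<n. a A j ^ (r + 2))" .
  qed
  also have "\<dots> \<le> n * (1 + 2 * real (Suc r) * (K / s) ^ (r + 2) * \<epsilon>) * s ^ (r + 2) / (4 * s) ^ (r + 2)"
    using E \<open>0 < s\<close> by (intro divide_right_mono) auto
  also have "\<dots> = n * (1 + 2 * real (Suc r) * (K / s) ^ (r + 2) * \<epsilon>) / 4 ^ (r + 2)"
    using \<open>0 < s\<close> by (simp only: power_mult_distrib) simp
  finally show ?thesis .
qed

section \<open>The Gram matrix of a masked matrix\<close>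

text \<open>\<open>X\<close> stands for the unfolding, \<open>M\<close> bounds its entries, and
  \<rho> is the probability that an entry is revealed. The independent blocks are the columns, so
  \<open>X X^t\<close> is a sum of \<open>m\<close> independent contributions after masking.\<close>

locale masked_matrix =
  fixes n m :: nat and X :: "nat \<Rightarrow> nat \<Rightarrow> real" and M \<rho> :: real
  assumes M: "0 < M" and rho: "0 < \<rho>" "\<rho> \<le> 1"
    and X_le: "i < n \<Longrightarrow> l < m \<Longrightarrow> \<bar>X i l\<bar> \<le> M"
begin

definition "cell = {..<n} \<times> {..<m}"
definition "block l = {..<n} \<times> {l::nat}"
text \<open>The guard \<open>i < n\<close> makes \<open>w A i l\<close> depend on
  \<open>A \<inter> block l\<close> for every \<open>i\<close>, so locality of \<open>W\<close>
  holds as an equation of functions, without bounds on the indices.\<close>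

definition w :: "(nat \<times> nat) set \<Rightarrow> nat \<Rightarrow> nat \<Rightarrow> real" where
  "w A i l = of_bool (i < n \<and> (i, l) \<in> A) * (X i l / \<rho>)"
text \<open>Off the diagonal two different cells meet, so scaling both entries by 1/\<rho> is
  unbiased. On the diagonal a single cell is squared and another scaling is due; that part is
  treated apart.\<close>

definition W :: "nat \<Rightarrow> (nat \<times> nat) set \<Rightarrow> nat \<Rightarrow> nat \<Rightarrow> real" where
  "W l A i j = (if i = j then 0 else w A i l * w A j l)"
definition "\<beta> = (M / \<rho>)\<^sup>2"

lemma finite_cell: "finite cell" and finite_block: "finite (block l)"
  by (simp_all add: cell_def block_def)

lemma block_subset: "l < m \<Longrightarrow> block l \<subseteq> cell"
  by (auto simp: block_def cell_def)

lemma cell_eq: "cell = (\<Union>l\<in>{..<m}. block l)"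
  by (auto simp: block_def cell_def)

lemma disjoint_blocks: "disjoint_family_on block L"
  by (auto simp: disjoint_family_on_def block_def)

lemma sym_W: "sym_on n (W l A)"
  by (simp add: sym_on_def W_def mult.commute)

lemma beta_nonneg: "0 \<le> \<beta>" by (simp add: \<beta>_def)

lemma X_sq_le: "i < n \<Longrightarrow> l < m \<Longrightarrow> (X i l)\<^sup>2 \<le> M\<^sup>2"
  using X_le[of i l] M by (metis abs_ge_zero power2_abs power_mono)

lemma w_sq_le: "i < n \<Longrightarrow> l < m \<Longrightarrow> (w A i l)\<^sup>2 \<le> of_bool ((i, l) \<in> A) * \<beta>"
  using X_sq_le[of i l] rho by (auto simp: w_def \<beta>_def power_divide divide_right_mono)

lemma W_local: "W l (A \<inter> block l) = W l A"
  by (auto simp: W_def w_def block_def fun_eq_iff)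

lemma mv_W: "i < n \<Longrightarrow> mv n (W l A) y i = w A i l * (\<Sum>j\<in>{..<n}-{i}. w A j l * y j)"
proof -
  assume "i < n"
  then have "mv n (W l A) y i = (\<Sum>j\<in>{..<n}-{i}. W l A i j * y j)"
    by (simp add: mv_def sum.remove[of _ i] W_def)
  also have "\<dots> = (\<Sum>j\<in>{..<n}-{i}. w A i l * (w A j l * y j))"
    by (intro sum.cong) (auto simp: W_def)
  finally show ?thesis by (simp add: sum_distrib_left)
qed

lemma bern_W:
  assumes "i < n" "j < n" "l < m"
  shows "bern \<rho> (block l) (\<lambda>B. W l B i j) = (if i = j then 0 else X i l * X j l)"
proof (cases "i = j")
  case True
  then show ?thesis using finite_block by (simp add: W_def bern_const)
next
  case False
  have ij: "(i, l) \<in> block l" "(j, l) \<in> block l - {(i, l)}" using assms False by (auto simp: block_def)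
  have 0: "bern \<rho> (block l - {(i, l)}) (\<lambda>B. W l B i j) = bern \<rho> (block l - {(i, l)}) (\<lambda>B. 0)"
    by (intro bern_cong) (auto simp: W_def w_def)
  have 1: "bern \<rho> (block l - {(i, l)}) (\<lambda>B. W l (insert (i, l) B) i j)
     = bern \<rho> (block l - {(i, l)}) (\<lambda>B. \<Sum>x\<in>block l - {(i, l)}. of_bool (x \<in> B) *
         (if x = (j, l) then X i l / \<rho> * (X j l / \<rho>) else 0))"
    using False ij finite_block assms
    by (intro bern_cong) (simp add: W_def w_def if_distrib[of "\<lambda>z. _ * z"] cong: if_cong)
  show ?thesis
    unfolding bern_split_elem[OF finite_block ij(1)] 0 1 bern_linear[OF finite_Diff[OF finite_block]]
    using False ij finite_block rho by (simp add: bern_const)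
qed

text \<open>In row \<open>i\<close> the factor \<open>w B i l\<close> is independent of the sum over
  the other rows. The second moment of that sum is its variance plus the square of its mean
  \<open>g - X i l * y i\<close>. The three terms of the bound come from the variance, from
  \<open>g\<close>, and from the missing diagonal summand.\<close>

lemma mv_W_second_moment:
  assumes "l < m" "ip n y y = 1"
  shows "bern \<rho> (block l) (\<lambda>B. ip n (mv n (W l B) y) (mv n (W l B) y))
    \<le> real n * M ^ 4 / \<rho>\<^sup>2 + 2 * real n * M\<^sup>2 / \<rho> * (\<Sum>i<n. X i l * y i)\<^sup>2 + 2 * M ^ 4 / \<rho>"
proof -
  define g where "g = (\<Sum>i<n. X i l * y i)"
  have row: "bern \<rho> (block l) (\<lambda>B. (mv n (W l B) y i)\<^sup>2) \<le> M ^ 4 / \<rho>\<^sup>2 + 2 * M\<^sup>2 / \<rho> * g\<^sup>2 + 2 * M ^ 4 / \<rho> * (y i)\<^sup>2"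
    if i: "i < n" for i
  proof -
    define R where "R = block l - {(i, l)}"
    define c where "c x = X (fst x) l / \<rho> * y (fst x)" for x :: "nat \<times> nat"
    have finR: "finite R" using finite_block by (simp add: R_def)
    have R: "R = (\<lambda>j. (j, l)) ` ({..<n} - {i})" by (auto simp: R_def block_def)
    have sumR: "(\<Sum>x\<in>R. f x) = (\<Sum>j\<in>{..<n}-{i}. f (j, l))" for f :: "nat \<times> nat \<Rightarrow> real"
      unfolding R by (subst sum.reindex) (auto simp: inj_on_def)
    have il: "(i, l) \<in> block l" using i by (simp add: block_def)
    have 0: "bern \<rho> R (\<lambda>B. (mv n (W l B) y i)\<^sup>2) = bern \<rho> R (\<lambda>B. 0)"
      using i by (intro bern_cong) (auto simp: mv_W w_def R_def)
    have 1: "bern \<rho> R (\<lambda>B. (mv n (W l (insert (i, l) B)) y i)\<^sup>2)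
       = bern \<rho> R (\<lambda>B. (X i l / \<rho>)\<^sup>2 * (\<Sum>x\<in>R. of_bool (x \<in> B) * c x)\<^sup>2)"
    proof (intro bern_cong)
      fix B
      have "(\<Sum>j\<in>{..<n}-{i}. w (insert (i, l) B) j l * y j) = (\<Sum>x\<in>R. of_bool (x \<in> B) * c x)"
        unfolding sumR by (intro sum.cong) (auto simp: w_def c_def)
      then show "(mv n (W l (insert (i, l) B)) y i)\<^sup>2 = (X i l / \<rho>)\<^sup>2 * (\<Sum>x\<in>R. of_bool (x \<in> B) * c x)\<^sup>2"
        using i by (simp only: mv_W power_mult_distrib) (simp add: w_def)
    qed
    have sc: "(\<Sum>x\<in>R. c x) = (g - X i l * y i) / \<rho>"
      unfolding sumR g_def using i by (simp add: c_def sum.remove[of "{..<n}" i] flip: sum_divide_distrib)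
    have "(\<Sum>x\<in>R. (c x)\<^sup>2) \<le> (\<Sum>j\<in>{..<n}-{i}. \<beta> * (y j)\<^sup>2)"
      unfolding sumR
    proof (intro sum_mono)
      fix j assume "j \<in> {..<n} - {i}"
      then have "(X j l)\<^sup>2 \<le> M\<^sup>2" using X_sq_le assms by auto
      then have "(X j l)\<^sup>2 / \<rho>\<^sup>2 * (y j)\<^sup>2 \<le> M\<^sup>2 / \<rho>\<^sup>2 * (y j)\<^sup>2"
        by (intro mult_right_mono divide_right_mono) auto
      then show "(c (j, l))\<^sup>2 \<le> \<beta> * (y j)\<^sup>2" by (simp add: c_def \<beta>_def power_mult_distrib power_divide)
    qed
    also have "\<dots> \<le> (\<Sum>j<n. \<beta> * (y j)\<^sup>2)"
      using beta_nonneg by (intro sum_mono2) auto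
    also have "\<dots> = \<beta>"
      using assms(2) by (simp add: ip_def power2_eq_square flip: sum_distrib_left)
    finally have c2: "(\<Sum>x\<in>R. (c x)\<^sup>2) \<le> \<beta>" .
    have "bern \<rho> (block l) (\<lambda>B. (mv n (W l B) y i)\<^sup>2)
        = \<rho> * ((X i l / \<rho>)\<^sup>2 * (\<rho>\<^sup>2 * ((g - X i l * y i) / \<rho>)\<^sup>2 + \<rho> * (1 - \<rho>) * (\<Sum>x\<in>R. (c x)\<^sup>2)))"
      unfolding bern_split_elem[OF finite_block il] R_def[symmetric] 0 1 bern_cmult bern_linear_sq[OF finR] sc
      using finR by (simp add: bern_const)
    also have "\<dots> = (X i l)\<^sup>2 / \<rho> * ((g - X i l * y i)\<^sup>2 + \<rho> * (1 - \<rho>) * (\<Sum>x\<in>R. (c x)\<^sup>2))"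
      using rho by (simp add: power_divide power2_eq_square[of \<rho>])
    also have "\<dots> \<le> M\<^sup>2 / \<rho> * ((2 * g\<^sup>2 + 2 * M\<^sup>2 * (y i)\<^sup>2) + M\<^sup>2 / \<rho>)"
    proof (intro mult_mono add_mono divide_right_mono)
      show "(X i l)\<^sup>2 \<le> M\<^sup>2" using X_sq_le i assms by auto
      have "0 \<le> (g + X i l * y i)\<^sup>2" by simp
      then have "(g - X i l * y i)\<^sup>2 \<le> 2 * g\<^sup>2 + 2 * ((X i l)\<^sup>2 * (y i)\<^sup>2)"
        by (simp add: power2_eq_square algebra_simps)
      also have "(X i l)\<^sup>2 * (y i)\<^sup>2 \<le> M\<^sup>2 * (y i)\<^sup>2"
        using X_sq_le i assms by (intro mult_right_mono) auto
      finally show "(g - X i l * y i)\<^sup>2 \<le> 2 * g\<^sup>2 + 2 * M\<^sup>2 * (y i)\<^sup>2" by simp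
      have "\<rho> * (1 - \<rho>) * (\<Sum>x\<in>R. (c x)\<^sup>2) \<le> \<rho> * 1 * \<beta>"
        using rho c2 beta_nonneg by (intro mult_mono) (auto intro: sum_nonneg)
      also have "\<dots> = M\<^sup>2 / \<rho>" using rho by (simp add: \<beta>_def power2_eq_square)
      finally show "\<rho> * (1 - \<rho>) * (\<Sum>x\<in>R. (c x)\<^sup>2) \<le> M\<^sup>2 / \<rho>" .
    qed (use rho in \<open>auto intro!: add_nonneg_nonneg mult_nonneg_nonneg sum_nonneg\<close>)
    also have "\<dots> = M ^ 4 / \<rho>\<^sup>2 + 2 * M\<^sup>2 / \<rho> * g\<^sup>2 + 2 * M ^ 4 / \<rho> * (y i)\<^sup>2"
      by (simp add: algebra_simps power2_eq_square power4_eq_xxxx)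
    finally show ?thesis .
  qed
  have "bern \<rho> (block l) (\<lambda>B. ip n (mv n (W l B) y) (mv n (W l B) y))
      = (\<Sum>i<n. bern \<rho> (block l) (\<lambda>B. (mv n (W l B) y i)\<^sup>2))"
    unfolding ip_def power2_eq_square by (rule bern_sum)
  also have "\<dots> \<le> (\<Sum>i<n. M ^ 4 / \<rho>\<^sup>2 + 2 * M\<^sup>2 / \<rho> * g\<^sup>2 + 2 * M ^ 4 / \<rho> * (y i)\<^sup>2)"
    by (intro sum_mono row) auto
  also have "\<dots> = real n * M ^ 4 / \<rho>\<^sup>2 + 2 * real n * M\<^sup>2 / \<rho> * g\<^sup>2 + 2 * M ^ 4 / \<rho> * ip n y y"
    unfolding ip_def sum.distrib sum_distrib_left by (simp add: power2_eq_square algebra_simps)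
  finally show ?thesis using assms by (simp add: g_def)
qed

section \<open>Crowded columns and the self-bounding variance proxy\<close>

definition "cnt l A = card (A \<inter> block l)"
text \<open>A column with a single revealed entry has no off-diagonal contribution, so a revealed
  entry matters only in company. Counting crowded entries instead of revealed ones is what exploits
  the sparsity.\<close>

definition "crowded i l A \<longleftrightarrow> (i, l) \<in> A \<and> 2 \<le> cnt l A"

lemma W_eq_0: "cnt l A \<le> 1 \<Longrightarrow> W l A i j = 0"
proof (rule ccontr)
  assume 1: "cnt l A \<le> 1" and "W l A i j \<noteq> 0"
  then have "i \<noteq> j" "{(i, l), (j, l)} \<subseteq> A \<inter> block l"
    by (auto simp: W_def w_def block_def split: if_splits)
  then have "card {(i, l), (j, l)} \<le> cnt l A"
    unfolding cnt_def using finite_block by (intro card_mono) auto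
  with \<open>i \<noteq> j\<close> 1 show False by simp
qed

lemma ip_W_quadratic:
  "ip n y (mv n (W l A) y) = (\<Sum>i<n. w A i l * y i)\<^sup>2 - (\<Sum>i<n. (w A i l)\<^sup>2 * (y i)\<^sup>2)"
proof -
  define g where "g = (\<Sum>i<n. w A i l * y i)"
  have "ip n y (mv n (W l A) y) = (\<Sum>i<n. y i * (w A i l * (g - w A i l * y i)))"
    unfolding ip_def by (intro sum.cong) (simp_all add: mv_W g_def sum.remove[of "{..<n}"])
  also have "\<dots> = (\<Sum>i<n. w A i l * y i) * g - (\<Sum>i<n. (w A i l)\<^sup>2 * (y i)\<^sup>2)"
    unfolding sum_distrib_right sum_subtractf[symmetric]
    by (intro sum.cong) (auto simp: algebra_simps power2_eq_square)
  finally show ?thesis by (simp add: g_def power2_eq_square)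
qed

lemma sum_w_sq_le:
  assumes "l < m" shows "(\<Sum>i<n. (w A i l)\<^sup>2) \<le> real (cnt l A) * \<beta>"
proof -
  have "(\<Sum>i<n. (w A i l)\<^sup>2) \<le> (\<Sum>i<n. of_bool ((i, l) \<in> A) * \<beta>)"
    using assms by (intro sum_mono w_sq_le) auto
  also have "\<dots> = real (card {i \<in> {..<n}. (i, l) \<in> A}) * \<beta>"
    by (simp add: Int_def flip: sum_distrib_right)
  also have "card {i \<in> {..<n}. (i, l) \<in> A} = card ((\<lambda>i. (i, l)) ` {i \<in> {..<n}. (i, l) \<in> A})"
    by (rule card_image[symmetric]) (auto simp: inj_on_def)
  also have "(\<lambda>i. (i, l)) ` {i \<in> {..<n}. (i, l) \<in> A} = A \<inter> block l"
    by (auto simp: block_def)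
  finally show ?thesis by (simp add: cnt_def)
qed

text \<open>\<open>W\<close> is \<open>w w^t\<close> minus its diagonal, hence
  \<open>|W y|^2\<close> is at most \<open>2 |w|^2 (w . y)^2\<close> plus twice the sum of the
  \<open>w_i^4 y_i^2\<close>. Here \<open>|w|^2 \<le> \<kappa>\<beta>\<close>, and
  \<open>(w . y)^2\<close> is the quadratic form of \<open>W\<close> plus a diagonal term. All
  diagonal terms live on crowded entries. Keeping the quadratic form, instead of estimating it,
  makes the sum over the columns reproduce \<open>G\<close>.\<close>

lemma mv_W_sq_le:
  assumes "l < m" and cnt: "real (cnt l A) \<le> \<kappa>"
  shows "ip n (mv n (W l A) y) (mv n (W l A) y) \<le> 2 * \<kappa> * \<beta> * ip n y (mv n (W l A) y)
    + (2 * \<kappa> + 2) * \<beta>\<^sup>2 * (\<Sum>i<n. of_bool (crowded i l A) * (y i)\<^sup>2)"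
proof (cases "cnt l A \<le> 1")
  case True
  then have "mv n (W l A) y = (\<lambda>i. 0)" by (auto simp: mv_def W_eq_0)
  moreover have "\<kappa> \<ge> 0" using cnt by linarith
  ultimately show ?thesis by (simp add: ip_def sum_nonneg beta_nonneg)
next
  case False
  define g where "g = (\<Sum>i<n. w A i l * y i)"
  have k0: "\<kappa> \<ge> 0" using cnt by linarith
  define s where "s = (\<Sum>i<n. of_bool (crowded i l A) * (y i)\<^sup>2)"
  have w2: "(w A i l)\<^sup>2 \<le> of_bool (crowded i l A) * \<beta>" if "i < n" for i
    using w_sq_le[OF that assms(1), of A] False by (auto simp: crowded_def)
  have wy: "(\<Sum>i<n. (w A i l)\<^sup>2 * (y i)\<^sup>2) \<le> \<beta> * s"
  proof -
    have "(\<Sum>i<n. (w A i l)\<^sup>2 * (y i)\<^sup>2) \<le> (\<Sum>i<n. (of_bool (crowded i l A) * \<beta>) * (y i)\<^sup>2)"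
      by (intro sum_mono mult_right_mono w2) auto
    then show ?thesis unfolding s_def sum_distrib_left by (simp only: mult_ac)
  qed
  have w4y: "(\<Sum>i<n. (w A i l)^4 * (y i)\<^sup>2) \<le> \<beta>\<^sup>2 * s"
  proof -
    have "(\<Sum>i<n. (w A i l)^4 * (y i)\<^sup>2) \<le> (\<Sum>i<n. (of_bool (crowded i l A) * \<beta>\<^sup>2) * (y i)\<^sup>2)"
    proof (intro sum_mono mult_right_mono)
      fix i assume "i \<in> {..<n}"
      then have "((w A i l)\<^sup>2)\<^sup>2 \<le> (of_bool (crowded i l A) * \<beta>)\<^sup>2" using w2 by (intro power_mono) auto
      then show "(w A i l)^4 \<le> of_bool (crowded i l A) * \<beta>\<^sup>2"
        by (cases "crowded i l A") (simp_all flip: power_mult)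
    qed auto
    then show ?thesis unfolding s_def sum_distrib_left by (simp only: mult_ac)
  qed
  have q: "ip n y (mv n (W l A) y) = g\<^sup>2 - (\<Sum>i<n. (w A i l)\<^sup>2 * (y i)\<^sup>2)"
    by (simp add: ip_W_quadratic g_def)
  have "ip n (mv n (W l A) y) (mv n (W l A) y) = (\<Sum>i<n. (w A i l * (g - w A i l * y i))\<^sup>2)"
    unfolding ip_def by (intro sum.cong) (simp_all add: mv_W g_def sum.remove[of "{..<n}"] power2_eq_square)
  also have "\<dots> \<le> (\<Sum>i<n. 2 * g\<^sup>2 * (w A i l)\<^sup>2 + 2 * ((w A i l)^4 * (y i)\<^sup>2))"
  proof (intro sum_mono)
    fix i
    have "(g - w A i l * y i)\<^sup>2 \<le> 2 * g\<^sup>2 + 2 * (w A i l * y i)\<^sup>2"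
      using zero_le_power2[of "g + w A i l * y i"] by (simp add: power2_eq_square algebra_simps)
    then have "(w A i l)\<^sup>2 * (g - w A i l * y i)\<^sup>2 \<le> (w A i l)\<^sup>2 * (2 * g\<^sup>2 + 2 * (w A i l * y i)\<^sup>2)"
      by (intro mult_left_mono) auto
    then show "(w A i l * (g - w A i l * y i))\<^sup>2 \<le> 2 * g\<^sup>2 * (w A i l)\<^sup>2 + 2 * ((w A i l)^4 * (y i)\<^sup>2)"
      by (simp add: power_mult_distrib algebra_simps power2_eq_square power4_eq_xxxx)
  qed
  also have "\<dots> = 2 * g\<^sup>2 * (\<Sum>i<n. (w A i l)\<^sup>2) + 2 * (\<Sum>i<n. (w A i l)^4 * (y i)\<^sup>2)"
    by (simp add: sum.distrib sum_distrib_left)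
  also have "\<dots> \<le> 2 * g\<^sup>2 * (\<kappa> * \<beta>) + 2 * (\<beta>\<^sup>2 * s)"
    using w4y order.trans[OF sum_w_sq_le[OF assms(1), of A] mult_right_mono[OF cnt beta_nonneg]]
    by (intro add_mono mult_left_mono) auto
  also have "\<dots> = 2 * \<kappa> * \<beta> * (ip n y (mv n (W l A) y) + (\<Sum>i<n. (w A i l)\<^sup>2 * (y i)\<^sup>2)) + 2 * \<beta>\<^sup>2 * s"
    unfolding q by (simp add: algebra_simps)
  also have "\<dots> \<le> 2 * \<kappa> * \<beta> * (ip n y (mv n (W l A) y) + \<beta> * s) + 2 * \<beta>\<^sup>2 * s"
    using wy k0 beta_nonneg by (intro add_mono mult_left_mono) auto
  finally show ?thesis unfolding s_def[symmetric] by (simp add: algebra_simps power2_eq_square)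
qed

end

lemma offdiag_quadratic:
  "ip n y (mv n (\<lambda>i j. if i = j then 0 else z i * z j) y)
     = (\<Sum>i<n. z i * y i)\<^sup>2 - (\<Sum>i<n. (z i)\<^sup>2 * (y i)\<^sup>2)"
proof -
  define g where "g = (\<Sum>i<n. z i * y i)"
  have "mv n (\<lambda>i j. if i = j then 0 else z i * z j) y i = z i * (g - z i * y i)" if "i < n" for i
  proof -
    have "mv n (\<lambda>i j. if i = j then 0 else z i * z j) y i = (\<Sum>j\<in>{..<n}-{i}. z i * z j * y j)"
      unfolding mv_def using that by (subst sum.remove[of _ i]) (auto intro!: sum.cong)
    also have "\<dots> = z i * (g - z i * y i)"
      using that by (simp add: g_def sum.remove[of "{..<n}" i] sum_distrib_left mult.assoc)
    finally show ?thesis .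
  qed
  then have "ip n y (mv n (\<lambda>i j. if i = j then 0 else z i * z j) y) = (\<Sum>i<n. y i * (z i * (g - z i * y i)))"
    unfolding ip_def by (intro sum.cong) auto
  also have "\<dots> = (\<Sum>i<n. z i * y i) * g - (\<Sum>i<n. (z i)\<^sup>2 * (y i)\<^sup>2)"
    unfolding sum_distrib_right sum_subtractf[symmetric]
    by (intro sum.cong) (auto simp: algebra_simps power2_eq_square)
  finally show ?thesis by (simp add: g_def power2_eq_square)
qed

lemma offdiag_quadratic_bound:
  assumes "ip n y y = 1" and z: "\<And>i. i < n \<Longrightarrow> (z i)\<^sup>2 \<le> b" and "0 \<le> b"
  shows "\<bar>(\<Sum>i<n. z i * y i)\<^sup>2 - (\<Sum>i<n. (z i)\<^sup>2 * (y i)\<^sup>2)\<bar> \<le> real n * b"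
proof -
  have "n > 0" using assms(1) by (cases n) (auto simp: ip_def)
  have zz: "(\<Sum>i<n. (z i)\<^sup>2) \<le> real n * b"
    using sum_mono[of "{..<n}" "\<lambda>i. (z i)\<^sup>2" "\<lambda>_. b"] z by simp
  have "(\<Sum>i<n. z i * y i)\<^sup>2 \<le> (\<Sum>i<n. (z i)\<^sup>2)"
    using ip_Cauchy_Schwarz[of n z y] assms(1) by (simp add: ip_def power2_eq_square)
  moreover have "(\<Sum>i<n. (z i)\<^sup>2 * (y i)\<^sup>2) \<le> (\<Sum>i<n. b * (y i)\<^sup>2)"
    using z by (intro sum_mono mult_right_mono) auto
  moreover have "(\<Sum>i<n. b * (y i)\<^sup>2) = b"
    using assms(1) by (simp add: ip_def power2_eq_square flip: sum_distrib_left)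
  moreover have "b \<le> real n * b" using \<open>n > 0\<close> \<open>0 \<le> b\<close> by (simp add: mult_le_cancel_right1)
  moreover have "0 \<le> (\<Sum>i<n. (z i)\<^sup>2 * (y i)\<^sup>2)" by (intro sum_nonneg) simp
  moreover have "0 \<le> (\<Sum>i<n. z i * y i)\<^sup>2" by simp
  ultimately show ?thesis using zz by linarith
qed

context masked_matrix
begin

definition "G = centered \<rho> {..<m} block W"

text \<open>The variance proxy of \<open>trace_moment_le\<close> as a quadratic form: the actual
  squares of the column matrices plus their means.\<close>

definition "V A y = (\<Sum>l<m. ip n (mv n (W l A) y) (mv n (W l A) y))
     + (\<Sum>l<m. bern \<rho> (block l) (\<lambda>B. ip n (mv n (W l B) y) (mv n (W l B) y)))"

lemma ip_G: "ip n y (mv n (G A) y) = (\<Sum>l<m. ip n y (mv n (W l A) y))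
    - (\<Sum>l<m. (\<Sum>i<n. X i l * y i)\<^sup>2 - (\<Sum>i<n. (X i l)\<^sup>2 * (y i)\<^sup>2))"
proof -
  have E: "bern \<rho> (block l) (\<lambda>B. ip n y (mv n (W l B) y))
      = (\<Sum>i<n. X i l * y i)\<^sup>2 - (\<Sum>i<n. (X i l)\<^sup>2 * (y i)\<^sup>2)" if "l < m" for l
  proof -
    have "bern \<rho> (block l) (\<lambda>B. ip n y (mv n (W l B) y))
        = (\<Sum>i<n. \<Sum>j<n. y i * (bern \<rho> (block l) (\<lambda>B. W l B i j) * y j))"
      by (simp add: ip_def mv_def sum_distrib_left bern_sum bern_cmult bern_cmult_right)
    also have "\<dots> = ip n y (mv n (\<lambda>i j. if i = j then 0 else X i l * X j l) y)"
      unfolding ip_def mv_def sum_distrib_left using that by (intro sum.cong refl) (auto simp: bern_W)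
    finally show ?thesis by (simp add: offdiag_quadratic)
  qed
  have "ip n y (mv n (G A) y) = (\<Sum>l<m. ip n y (mv n (W l A) y) - bern \<rho> (block l) (\<lambda>B. ip n y (mv n (W l B) y)))"
    unfolding G_def centered_def mv_matrix_sum mv_matrix_diff mv_matrix_bern
    by (simp add: ip_sum_right ip_diff_right ip_bern)
  then show ?thesis by (simp add: E sum_subtractf)
qed

text \<open>Summed over the columns, the quadratic forms in \<open>mv_W_sq_le\<close> give that of
  \<open>G\<close> plus a mean that \<Lambda> dominates. In the remainder the order of summation is
  exchanged: crowded entries are then counted along a row, and the weights \<open>y_i^2\<close> sum
  to 1, so the worst row \<open>R\<close> appears instead of a total over all rows.\<close>

lemma V_good:
  assumes y: "ip n y y = 1" and col: "\<And>l. l < m \<Longrightarrow> real (cnt l A) \<le> \<kappa>" and "0 \<le> \<kappa>"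
    and row: "\<And>i. i < n \<Longrightarrow> (\<Sum>l<m. of_bool (crowded i l A)) \<le> R"
    and \<Lambda>: "(\<Sum>l<m. (\<Sum>i<n. X i l * y i)\<^sup>2) \<le> \<Lambda>"
  shows "V A y \<le> (2 * \<kappa> * \<beta>) * \<bar>ip n y (mv n (G A) y)\<bar>
    + (2 * \<kappa> * \<beta> * \<Lambda> + (2 * \<kappa> + 2) * \<beta>\<^sup>2 * R
       + (3 * (real n * real m) * M ^ 4 / \<rho>\<^sup>2 + 2 * real n * M\<^sup>2 * \<Lambda> / \<rho>))"
proof -
  have "n > 0" using y by (cases n) (auto simp: ip_def)
  have kb: "0 \<le> 2 * \<kappa> * \<beta>" using \<open>0 \<le> \<kappa>\<close> beta_nonneg by simp
  have 1: "(\<Sum>l<m. ip n (mv n (W l A) y) (mv n (W l A) y))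
    \<le> (\<Sum>l<m. 2 * \<kappa> * \<beta> * ip n y (mv n (W l A) y)
    + (2 * \<kappa> + 2) * \<beta>\<^sup>2 * (\<Sum>i<n. of_bool (crowded i l A) * (y i)\<^sup>2))"
    by (intro sum_mono mv_W_sq_le col) auto
  have 2: "(\<Sum>l<m. \<Sum>i<n. of_bool (crowded i l A) * (y i)\<^sup>2) \<le> R"
  proof -
    have "(\<Sum>l<m. \<Sum>i<n. of_bool (crowded i l A) * (y i)\<^sup>2) = (\<Sum>i<n. (\<Sum>l<m. of_bool (crowded i l A)) * (y i)\<^sup>2)"
      unfolding sum_distrib_right by (rule sum.swap)
    also have "\<dots> \<le> (\<Sum>i<n. R * (y i)\<^sup>2)"
      by (intro sum_mono mult_right_mono row) auto
    also have "\<dots> = R" using y by (simp add: ip_def power2_eq_square flip: sum_distrib_left)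
    finally show ?thesis .
  qed
  have 3: "(\<Sum>l<m. ip n y (mv n (W l A) y)) \<le> \<bar>ip n y (mv n (G A) y)\<bar> + \<Lambda>"
  proof -
    have "(\<Sum>l<m. (\<Sum>i<n. X i l * y i)\<^sup>2 - (\<Sum>i<n. (X i l)\<^sup>2 * (y i)\<^sup>2)) \<le> \<Lambda>"
      using \<Lambda> by (simp add: sum_subtractf) (smt (verit) sum_nonneg zero_le_mult_iff zero_le_power2)
    then show ?thesis using ip_G[of y A] by linarith
  qed
  have 4: "(\<Sum>l<m. bern \<rho> (block l) (\<lambda>B. ip n (mv n (W l B) y) (mv n (W l B) y)))
      \<le> 3 * (real n * real m) * M ^ 4 / \<rho>\<^sup>2 + 2 * real n * M\<^sup>2 * \<Lambda> / \<rho>"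
  proof -
    have "(\<Sum>l<m. bern \<rho> (block l) (\<lambda>B. ip n (mv n (W l B) y) (mv n (W l B) y)))
      \<le> (\<Sum>l<m. real n * M ^ 4 / \<rho>\<^sup>2 + 2 * real n * M\<^sup>2 / \<rho> * (\<Sum>i<n. X i l * y i)\<^sup>2 + 2 * M ^ 4 / \<rho>)"
      by (intro sum_mono mv_W_second_moment y) auto
    also have "\<dots> = real m * (real n * M ^ 4 / \<rho>\<^sup>2) + 2 * real n * M\<^sup>2 / \<rho> * (\<Sum>l<m. (\<Sum>i<n. X i l * y i)\<^sup>2)
        + real m * (2 * M ^ 4 / \<rho>)"
      unfolding sum.distrib sum_distrib_left by simp
    also have "\<dots> \<le> real m * (real n * M ^ 4 / \<rho>\<^sup>2) + 2 * real n * M\<^sup>2 / \<rho> * \<Lambda>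
        + real m * (2 * (real n * M ^ 4 / \<rho>\<^sup>2))"
    proof (intro add_mono mult_left_mono \<Lambda> order.refl)
      \<comment> \<open>Since \<open>\<rho> \<le> 1 \<le> n\<close>, the last term of the second
        moment merges with the first, which explains the coefficient 3.\<close>
      have "1 \<le> real n" using \<open>n > 0\<close> by simp
      then have "\<rho> \<le> real n" using rho by linarith
      then have "\<rho>\<^sup>2 \<le> \<rho> * real n"
        unfolding power2_eq_square using rho by (intro mult_left_mono) auto
      then have "M ^ 4 * \<rho>\<^sup>2 \<le> M ^ 4 * (\<rho> * real n)" by (intro mult_left_mono) auto
      then show "2 * M ^ 4 / \<rho> \<le> 2 * (real n * M ^ 4 / \<rho>\<^sup>2)" using rho by (simp add: field_simps)
    qed (use rho in auto)
    also have "\<dots> = 3 * (real n * real m) * M ^ 4 / \<rho>\<^sup>2 + 2 * real n * M\<^sup>2 * \<Lambda> / \<rho>"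
      by (simp add: field_simps)
    finally show ?thesis .
  qed
  have "(\<Sum>l<m. ip n (mv n (W l A) y) (mv n (W l A) y))
      \<le> (2 * \<kappa> * \<beta>) * (\<Sum>l<m. ip n y (mv n (W l A) y))
       + (2 * \<kappa> + 2) * \<beta>\<^sup>2 * (\<Sum>l<m. \<Sum>i<n. of_bool (crowded i l A) * (y i)\<^sup>2)"
    using 1 unfolding sum.distrib sum_distrib_left[symmetric] .
  also have "\<dots> \<le> (2 * \<kappa> * \<beta>) * (\<bar>ip n y (mv n (G A) y)\<bar> + \<Lambda>) + (2 * \<kappa> + 2) * \<beta>\<^sup>2 * R"
    using 2 3 kb \<open>0 \<le> \<kappa>\<close> by (intro add_mono mult_left_mono) auto
  finally show ?thesis using 4 by (simp add: V_def algebra_simps)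
qed

lemma M_sq_le_beta: "M\<^sup>2 \<le> \<beta>"
proof -
  have "M \<le> M / \<rho>" using M rho by (simp add: field_simps)
  then show ?thesis unfolding \<beta>_def using M by (intro power_mono) auto
qed

text \<open>Bounds valid for every mask, to be used on crowded masks only. Polynomial size is enough
  there, because such masks are superpolynomially rare.\<close>

lemma crude_bounds:
  assumes y: "ip n y y = 1" and "m > 0"
  shows "\<bar>ip n y (mv n (G A) y)\<bar> \<le> 2 * real n * real m * \<beta> \<and> V A y \<le> (2 * real n * real m * \<beta>)\<^sup>2"
proof
  have wb: "(w A i l)\<^sup>2 \<le> \<beta>" if "i < n" "l < m" for i l A
    using w_sq_le[OF that, of A] beta_nonneg by (auto split: if_splits intro: order.trans)
  have xb: "(X i l)\<^sup>2 \<le> \<beta>" if "i < n" "l < m" for i l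
    using X_sq_le[OF that] M_sq_le_beta by linarith
  have "\<bar>ip n y (mv n (G A) y)\<bar> \<le> \<bar>\<Sum>l<m. ip n y (mv n (W l A) y)\<bar>
    + \<bar>\<Sum>l<m. (\<Sum>i<n. X i l * y i)\<^sup>2 - (\<Sum>i<n. (X i l)\<^sup>2 * (y i)\<^sup>2)\<bar>"
    unfolding ip_G by (rule abs_triangle_ineq4)
  also have "\<dots> \<le> (\<Sum>l<m. real n * \<beta>) + (\<Sum>l<m. real n * \<beta>)"
    unfolding ip_W_quadratic
    by (intro add_mono order.trans[OF sum_abs] sum_mono offdiag_quadratic_bound y wb xb beta_nonneg) auto
  finally show "\<bar>ip n y (mv n (G A) y)\<bar> \<le> 2 * real n * real m * \<beta>" by (simp add: mult_ac)
  have sq: "ip n (mv n (W l A) y) (mv n (W l A) y) \<le> (real n * \<beta>)\<^sup>2" if l: "l < m" for l A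
  proof -
    have "ip n (mv n (W l A) y) (mv n (W l A) y) = (\<Sum>i<n. (w A i l)\<^sup>2 * (\<Sum>j\<in>{..<n}-{i}. w A j l * y j)\<^sup>2)"
      unfolding ip_def by (intro sum.cong) (auto simp: mv_W power_mult_distrib simp flip: power2_eq_square)
    also have "\<dots> \<le> (\<Sum>i<n. \<beta> * (real n * \<beta>))"
    proof (intro sum_mono mult_mono)
      fix i assume "i \<in> {..<n}"
      then show "(w A i l)\<^sup>2 \<le> \<beta>" using wb l by auto
      have "(\<Sum>j\<in>{..<n}-{i}. w A j l * y j)\<^sup>2 \<le> (\<Sum>j\<in>{..<n}-{i}. (w A j l)\<^sup>2) * (\<Sum>j\<in>{..<n}-{i}. (y j)\<^sup>2)"
        by (rule Cauchy_Schwarz_ineq_sum)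
      also have "\<dots> \<le> (\<Sum>j<n. (w A j l)\<^sup>2) * (\<Sum>j<n. (y j)\<^sup>2)"
        by (intro mult_mono sum_mono2 sum_nonneg) auto
      also have "\<dots> = (\<Sum>j<n. (w A j l)\<^sup>2)" using y by (simp add: ip_def power2_eq_square)
      also have "\<dots> \<le> (\<Sum>j<n. \<beta>)" using wb l by (intro sum_mono) auto
      finally show "(\<Sum>j\<in>{..<n}-{i}. w A j l * y j)\<^sup>2 \<le> real n * \<beta>" by simp
    qed (use beta_nonneg in auto)
    also have "\<dots> = (real n * \<beta>)\<^sup>2" by (simp add: power2_eq_square mult_ac)
    finally show ?thesis .
  qed
  have "bern \<rho> (block l) (\<lambda>B. ip n (mv n (W l B) y) (mv n (W l B) y)) \<le> (real n * \<beta>)\<^sup>2" if "l < m" for l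
    using bern_mono[of \<rho> "block l" "\<lambda>B. ip n (mv n (W l B) y) (mv n (W l B) y)" "\<lambda>_. (real n * \<beta>)\<^sup>2"]
      rho sq[OF that] by (simp add: bern_const finite_block)
  then have "V A y \<le> (\<Sum>l<m. (real n * \<beta>)\<^sup>2) + (\<Sum>l<m. (real n * \<beta>)\<^sup>2)"
    unfolding V_def using sq by (intro add_mono sum_mono) auto
  also have "\<dots> = 2 * real m * (real n * \<beta>)\<^sup>2" by simp
  also have "\<dots> \<le> 4 * (real m)\<^sup>2 * (real n * \<beta>)\<^sup>2"
  proof (intro mult_right_mono)
    have "real m * 1 \<le> real m * real m" using \<open>m > 0\<close> by (intro mult_left_mono) auto
    then show "2 * real m \<le> 4 * (real m)\<^sup>2" by (simp add: power2_eq_square)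
  qed auto
  finally show "V A y \<le> (2 * real n * real m * \<beta>)\<^sup>2" by (simp add: power_mult_distrib mult_ac)
qed

section \<open>Crowded masks are rare; tail of the off-diagonal error\<close>

lemma column_tail:
  assumes "l < m"
  shows "bern \<rho> cell (\<lambda>A. of_bool (\<not> real (cnt l A) \<le> \<kappa>)) \<le> exp (2 * \<rho> * n - \<kappa>)"
proof -
  have "bern \<rho> cell (\<lambda>A. of_bool (\<not> real (cnt l A) \<le> \<kappa>)) \<le> bern \<rho> cell (\<lambda>A. exp (real (card (A \<inter> block l)))) / exp \<kappa>"
    using rho by (intro bern_markov) (auto simp: cnt_def)
  also have "bern \<rho> cell (\<lambda>A. exp (real (card (A \<inter> block l)))) = bern \<rho> (block l) (\<lambda>A. exp (real (card A)))"
    by (rule bern_marginal[OF finite_cell block_subset[OF assms]])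
  also have "\<dots> \<le> exp (2 * \<rho> * real (card (block l)))"
    using rho by (intro bern_exp_card_le finite_block) auto
  also have "card (block l) = n" by (simp add: block_def)
  finally show ?thesis by (simp add: exp_diff divide_right_mono)
qed

text \<open>The cell itself is revealed with probability \<rho>, and another cell of the column with
  probability at most \<open>n * \<rho>\<close> by the union bound. The minimum with 1 keeps the
  estimate sharp for dense columns as well.\<close>

lemma crowded_prob:
  assumes "i < n" "l < m"
  shows "bern \<rho> (block l) (\<lambda>B. of_bool (crowded i l B)) \<le> \<rho> * min 1 (n * \<rho>)"
proof -
  define R where "R = block l - {(i, l)}"
  have fin: "finite R" using finite_block by (simp add: R_def)
  have il: "(i, l) \<in> block l" using assms by (simp add: block_def)
  have "bern \<rho> R (\<lambda>B. of_bool (crowded i l B)) = bern \<rho> R (\<lambda>B. 0)"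
    by (intro bern_cong) (auto simp: crowded_def R_def)
  then have eq: "bern \<rho> (block l) (\<lambda>B. of_bool (crowded i l B))
      = \<rho> * bern \<rho> R (\<lambda>B. of_bool (crowded i l (insert (i, l) B)))"
    unfolding bern_split_elem[OF finite_block il] R_def[symmetric] using fin by (simp add: bern_const)
  have b1: "bern \<rho> R (\<lambda>B. of_bool (crowded i l (insert (i, l) B))) \<le> 1"
    using bern_mono[of \<rho> R "\<lambda>B. of_bool (crowded i l (insert (i, l) B))" "\<lambda>_. 1"] rho fin
    by (simp add: bern_const)
  have "bern \<rho> R (\<lambda>B. of_bool (crowded i l (insert (i, l) B)))
      \<le> bern \<rho> R (\<lambda>B. \<Sum>x\<in>R. of_bool (x \<in> B) * 1)"
  proof (intro bern_mono)
    fix B assume B: "B \<subseteq> R"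
    show "of_bool (crowded i l (insert (i, l) B)) \<le> (\<Sum>x\<in>R. of_bool (x \<in> B) * 1 :: real)"
    proof (cases "B = {}")
      case True
      then have "insert (i, l) B \<inter> block l = {(i, l)}" using il by auto
      then show ?thesis by (simp add: crowded_def cnt_def sum_nonneg)
    next
      case False
      then obtain x where "x \<in> B" by blast
      then have "of_bool (x \<in> B) * 1 \<le> (\<Sum>x\<in>R. of_bool (x \<in> B) * 1 :: real)"
        using B fin by (intro member_le_sum) auto
      then show ?thesis using \<open>x \<in> B\<close> by simp
    qed
  qed (use rho in auto)
  also have "\<dots> = \<rho> * (\<Sum>x\<in>R. 1)" by (rule bern_linear[OF fin])
  also have "\<dots> \<le> \<rho> * n"
  proof (intro mult_left_mono)
    have "card R \<le> card (block l)" unfolding R_def by (intro card_mono finite_block) auto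
    then show "(\<Sum>x\<in>R. 1) \<le> real n" by (simp add: block_def)
  qed (use rho in auto)
  finally have "bern \<rho> R (\<lambda>B. of_bool (crowded i l (insert (i, l) B))) \<le> min 1 (n * \<rho>)"
    using b1 by (simp add: mult.commute)
  then show ?thesis unfolding eq using rho by (intro mult_left_mono) auto
qed

text \<open>Whether \<open>(i, l)\<close> is crowded is decided inside column \<open>l\<close>, so
  the indicators along row \<open>i\<close> are independent and an exponential moment bounds their
  number.\<close>

lemma row_tail:
  assumes "i < n"
  shows "bern \<rho> cell (\<lambda>A. of_bool (\<not> (\<Sum>l<m. of_bool (crowded i l A)) \<le> R))
    \<le> exp (2 * (m * (\<rho> * min 1 (n * \<rho>))) - R)"
proof -
  define q where "q = \<rho> * min 1 (n * \<rho>)"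
  have q0: "0 \<le> q" using rho by (simp add: q_def)
  have "bern \<rho> cell (\<lambda>A. of_bool (\<not> (\<Sum>l<m. of_bool (crowded i l A)) \<le> R))
      \<le> bern \<rho> cell (\<lambda>A. exp (\<Sum>l<m. of_bool (crowded i l A))) / exp R"
    using rho by (intro bern_markov) auto
  also have "bern \<rho> cell (\<lambda>A. exp (\<Sum>l<m. of_bool (crowded i l A)))
      = bern \<rho> (\<Union>l\<in>{..<m}. block l) (\<lambda>A. \<Prod>l<m. exp (of_bool (crowded i l (A \<inter> block l))))"
    unfolding cell_eq
  proof (intro bern_cong)
    fix A
    have cr: "crowded i l (A \<inter> block l) = crowded i l A" for l
      using assms by (auto simp: crowded_def cnt_def block_def Int_assoc)
    then show "exp (\<Sum>l<m. of_bool (crowded i l A)) = (\<Prod>l<m. exp (of_bool (crowded i l (A \<inter> block l))) :: real)"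
      by (simp only: cr exp_sum[OF finite_lessThan])
  qed
  also have "\<dots> = (\<Prod>l<m. bern \<rho> (block l) (\<lambda>B. exp (of_bool (crowded i l B))))"
    by (intro bern_prod_blocks disjoint_blocks finite_block) auto
  also have "\<dots> \<le> (\<Prod>l<m. exp (2 * q))"
  proof (intro prod_mono conjI)
    fix l assume "l \<in> {..<m}"
    then have l: "l < m" by simp
    show "0 \<le> bern \<rho> (block l) (\<lambda>B. exp (of_bool (crowded i l B)))"
      using rho by (intro bern_nonneg) auto
    have "bern \<rho> (block l) (\<lambda>B. exp (of_bool (crowded i l B)))
        \<le> bern \<rho> (block l) (\<lambda>B. 1 + 2 * of_bool (crowded i l B))"
      using rho exp_le by (intro bern_mono) auto
    also have "\<dots> = 1 + 2 * bern \<rho> (block l) (\<lambda>B. of_bool (crowded i l B))"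
      by (simp add: bern_add bern_cmult bern_const finite_block)
    also have "\<dots> \<le> 1 + 2 * q" using crowded_prob[OF assms l] by (simp add: q_def)
    also have "\<dots> \<le> exp (2 * q)" by (rule exp_ge_add_one_self)
    finally show "bern \<rho> (block l) (\<lambda>B. exp (of_bool (crowded i l B))) \<le> exp (2 * q)" .
  qed
  also have "\<dots> = exp (2 * (m * q))" by (simp add: mult_ac flip: exp_of_nat_mult)
  finally show ?thesis by (simp add: exp_diff divide_right_mono q_def)
qed

text \<open>\<open>spectral_tail_le\<close> with a moment order \<open>2 p\<close> near
  \<open>L^2 / 8\<close>. Crowded masks have probability about \<open>exp (- L^3)\<close>, whereas
  the crude bound contributes at most \<open>exp (L^3/8 + 2 L)\<close> to the moment, so their share
  is negligible. The powers of \<open>L\<close> in the radius pay for the order of the moment and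
  for the allowances \<open>L^3\<close> in \<kappa> and \<open>R\<close>.\<close>

theorem offdiag_tail:
  fixes L t \<Lambda> :: real
  assumes "1 \<le> n" "n \<le> m" and L: "8 \<le> L" and N: "real n * real m = exp L" and "1 \<le> t"
    and \<rho>N: "16 * L ^ 4 \<le> sqrt (real n * real m) * \<rho>"
    and \<Lambda>: "\<And>y. (\<Sum>l<m. (\<Sum>i<n. X i l * y i)\<^sup>2) \<le> \<Lambda> * ip n y y"
    and \<Lambda>1: "\<Lambda> \<le> real n * real m * M\<^sup>2" and \<Lambda>2: "\<rho> * \<Lambda> \<le> t * real m * M\<^sup>2" and "0 \<le> \<Lambda>"
  shows "bern \<rho> cell (\<lambda>A. of_bool (\<not> (\<forall>y. \<bar>ip n y (mv n (G A) y)\<bar>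
        \<le> 2 * L ^ 4 * sqrt t * sqrt (real n * real m) * M\<^sup>2 / \<rho> * ip n y y)))
    \<le> 2 * real n * exp (- (L\<^sup>2 / 8))"
proof -
  define Nr where "Nr = real n * real m"
  define q where "q = sqrt Nr"
  have Nr1: "1 \<le> Nr" using N L by (simp add: Nr_def)
  have q1: "1 \<le> q" using Nr1 by (simp add: q_def)
  have qq: "q * q = Nr" using Nr1 by (simp add: q_def)
  \<comment> \<open>Large enough for \<open>4 ^ (2 * p)\<close> to reach
    \<open>exp (L^2 / 8)\<close>, yet small enough for \<open>4 * Suc r = 8 * p - 4\<close> to stay
    below \<open>L^2\<close>.\<close>
  define p where "p = nat \<lceil>L\<^sup>2 / 16\<rceil>"
  have L64: "64 \<le> L\<^sup>2" using power_mono[OF L, of 2] by simp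
  have L512: "512 \<le> L ^ 3" using power_mono[OF L, of 3] by simp
  have p: "L\<^sup>2 / 16 \<le> real p" "real p \<le> L\<^sup>2 / 16 + 1" using L64 unfolding p_def by linarith+
  have p1: "1 \<le> p" using p(1) L64 by linarith
  define r where "r = 2 * (p - 1)"
  have r2: "r + 2 = 2 * p" using p1 by (simp add: r_def)
  have Sr: "real (Suc r) = 2 * real p - 1" using r2 by linarith
  have Sr4: "4 * real (Suc r) \<le> L\<^sup>2" unfolding Sr using p(2) L64 by simp
  \<comment> \<open>\<kappa> and \<open>R\<close> exceed the exponents \<open>2 n \<rho>\<close> and
    \<open>2 m \<rho> h\<close> of the counting bounds by at least \<open>L^3\<close>, so each count
    fails with probability at most \<open>exp (- L^3)\<close>.\<close>
  define \<kappa> where "\<kappa> = 4 * (n * \<rho>) + L ^ 3"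
  define h where "h = min 1 (n * \<rho>)"
  define R where "R = 4 * (m * (\<rho> * h)) + L ^ 3"
  \<comment> \<open>A quarter of the claimed radius, as the tail bound speaks of the level
    \<open>4 * s\<close>.\<close>
  define s where "s = L ^ 4 * sqrt t * q * M\<^sup>2 / (2 * \<rho>)"
  define c where "c = 2 * \<kappa> * \<beta>"
  define v where "v = 2 * \<kappa> * \<beta> * \<Lambda> + (2 * \<kappa> + 2) * \<beta>\<^sup>2 * R
       + (3 * (real n * real m) * M ^ 4 / \<rho>\<^sup>2 + 2 * real n * M\<^sup>2 * \<Lambda> / \<rho>)"
  define K where "K = 2 * real n * real m * \<beta>"
  define U where "U = Nr * M ^ 4 / \<rho>\<^sup>2"
  define bad where "bad A \<longleftrightarrow> (\<exists>l<m. \<not> real (cnt l A) \<le> \<kappa>) \<or> (\<exists>i<n. \<not> (\<Sum>l<m. of_bool (crowded i l A)) \<le> R)" for A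
  have m1: "1 \<le> real m" "1 \<le> real n" "real n \<le> real m" using \<open>1 \<le> n\<close> \<open>n \<le> m\<close> by auto
  have h: "0 \<le> h" "h \<le> 1" "h \<le> n * \<rho>" using rho by (auto simp: h_def)
  have "real n * real n \<le> real n * real m" "real n * real m \<le> real m * real m"
    using m1(3) by (simp_all add: mult_left_mono mult_right_mono)
  then have nq: "real n \<le> q" and qm: "q \<le> real m"
    unfolding q_def Nr_def by (auto intro!: real_le_rsqrt real_le_lsqrt simp: power2_eq_square)
  have q\<rho>: "16 * L ^ 4 \<le> q * \<rho>" using \<rho>N by (simp add: q_def Nr_def)
  have L4: "L ^ 4 = L * L ^ 3" by (simp add: power_numeral_reduce)
  have L43: "8 * L ^ 3 \<le> L ^ 4" unfolding L4 using L by (intro mult_right_mono) auto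
  have m\<rho>: "1 \<le> m * \<rho>"
  proof -
    have "q * \<rho> \<le> m * \<rho>" using qm rho by (intro mult_right_mono) auto
    then show ?thesis using q\<rho> L43 L512 by linarith
  qed
  have "0 \<le> real n * \<rho>" using rho by simp
  then have k0: "0 \<le> \<kappa>" "1 \<le> \<kappa>" using L512 unfolding \<kappa>_def by linarith+
  have R0: "0 \<le> R" using rho h L by (auto simp: R_def)
  have U0: "0 \<le> U" using Nr1 by (simp add: U_def)
  have c0: "0 \<le> c" using k0 beta_nonneg by (simp add: c_def)
  have v0: "0 \<le> v" unfolding v_def using k0 R0 beta_nonneg rho M \<open>0 \<le> \<Lambda>\<close>
    by (intro add_nonneg_nonneg mult_nonneg_nonneg divide_nonneg_nonneg) auto
  have s0: "0 < s" using L M rho q1 \<open>1 \<le> t\<close> by (simp add: s_def)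
  have K0: "0 \<le> K" using beta_nonneg by (simp add: K_def)
  have tU: "U \<le> t * U" using \<open>1 \<le> t\<close> U0 by (simp add: mult_le_cancel_right1)
  have \<beta>: "\<beta> = M\<^sup>2 / \<rho>\<^sup>2" by (simp add: \<beta>_def power_divide)
  \<comment> \<open>From \<open>n \<le> q\<close> and \<open>L^3 \<le> q \<rho>\<close> one gets
    \<open>\<kappa> \<le> 5 q \<rho>\<close>. Two of the four powers of \<open>L\<close> in
    \<open>s\<close> pay for the order of the moment, the other two for the constant.\<close>
  have cs: "4 * real (Suc r) * c \<le> s"
  proof -
    have "4 * (n * \<rho>) \<le> 4 * (q * \<rho>)" using nq rho by (intro mult_left_mono mult_right_mono) auto
    moreover have "L ^ 3 \<le> q * \<rho>" using q\<rho> L43 L512 by linarith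
    ultimately have k5: "\<kappa> \<le> 5 * (q * \<rho>)" by (simp add: \<kappa>_def)
    have "4 * real (Suc r) * c \<le> L\<^sup>2 * c" using Sr4 c0 by (rule mult_right_mono)
    also have "\<dots> \<le> L\<^sup>2 * (2 * (5 * (q * \<rho>)) * \<beta>)"
      unfolding c_def using k5 beta_nonneg by (intro mult_left_mono mult_right_mono) auto
    also have "\<dots> = 10 * L\<^sup>2 * q * M\<^sup>2 / \<rho>" unfolding \<beta> using rho by (simp add: power2_eq_square)
    also have "\<dots> \<le> (L\<^sup>2 * (L\<^sup>2 / 2) * sqrt t) * q * M\<^sup>2 / \<rho>"
    proof (intro divide_right_mono mult_right_mono)
      have "L\<^sup>2 * 10 \<le> L\<^sup>2 * (L\<^sup>2 / 2)" using L64 by (intro mult_left_mono) auto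
      also have "\<dots> \<le> L\<^sup>2 * (L\<^sup>2 / 2) * sqrt t" using \<open>1 \<le> t\<close> by (simp add: mult_le_cancel_left1)
      finally show "10 * L\<^sup>2 \<le> L\<^sup>2 * (L\<^sup>2 / 2) * sqrt t" by simp
    qed (use q1 rho in auto)
    also have "\<dots> = s" by (simp add: s_def power2_eq_square power4_eq_xxxx)
    finally show ?thesis .
  qed
  \<comment> \<open>The minimum in \<open>h\<close> matters here: with \<open>x = n \<rho>\<close>
    and \<open>z = m \<rho>\<close>, both \<open>h \<le> 1\<close> and \<open>h \<le> x\<close> are
    needed to bring every product below a multiple of \<open>x z = N \<rho>^2\<close>, where
    \<open>N = n m\<close>. The term \<open>L^6\<close> is at most \<open>(q \<rho>)^2\<close>,
    which is \<open>x z\<close> as well.\<close>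
  have \<kappa>R: "\<kappa> * R \<le> 9 * L ^ 3 * (Nr * \<rho>\<^sup>2)"
  proof -
    define x where "x = n * \<rho>"
    define z where "z = m * \<rho>"
    have xz: "x * z = Nr * \<rho>\<^sup>2" by (simp add: x_def z_def Nr_def power2_eq_square)
    have x0: "0 \<le> x" "1 \<le> z" using rho m\<rho> by (simp_all add: x_def z_def)
    have L3: "0 \<le> L ^ 3" using L by simp
    have a1: "x * (z * h) \<le> x * z" using x0 h by (intro mult_left_mono) (auto simp: mult_le_cancel_left2)
    have a2: "z * h \<le> x * z" using x0 h mult_left_mono[of h x z] by (simp add: x_def mult.commute)
    have a3: "x \<le> x * z" using x0 by (simp add: mult_le_cancel_left1)
    have a4: "L ^ 3 * L ^ 3 \<le> x * z"
    proof -
      have "L ^ 3 \<le> q * \<rho>" using q\<rho> L43 L512 by linarith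
      then have "L ^ 3 * L ^ 3 \<le> (q * \<rho>) * (q * \<rho>)" using L3 by (intro mult_mono) linarith+
      also have "\<dots> = x * z" unfolding xz qq[symmetric] by (simp add: power2_eq_square)
      finally show ?thesis .
    qed
    have "\<kappa> * R = 16 * (x * (z * h)) + 4 * L ^ 3 * x + 4 * L ^ 3 * (z * h) + L ^ 3 * L ^ 3"
      by (simp add: \<kappa>_def R_def x_def z_def algebra_simps)
    also have "\<dots> \<le> 16 * (x * z) + 4 * L ^ 3 * (x * z) + 4 * L ^ 3 * (x * z) + x * z"
      using a1 a4 mult_left_mono[OF a3, of "4 * L ^ 3"] mult_left_mono[OF a2, of "4 * L ^ 3"] L3 by linarith
    also have "\<dots> = (17 + 8 * L ^ 3) * (x * z)" by (simp add: algebra_simps)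
    also have "\<dots> \<le> (9 * L ^ 3) * (x * z)" using L512 x0 by (intro mult_right_mono) auto
    finally show ?thesis by (simp add: xz)
  qed
  \<comment> \<open>\<open>U\<close> is the natural unit because \<open>s^2 = L^8 t U / 4\<close>.
    Against the factor \<open>L^2\<close> from the moment order, a bound \<open>39 L^3 t U\<close>
    suffices once \<open>L^3 \<ge> 512\<close>.\<close>
  have vU: "v \<le> 39 * L ^ 3 * (t * U)"
  proof -
    \<comment> \<open>The two assumptions on \<Lambda> serve the two parts of \<kappa>: the bound on
      \<open>\<rho> * \<Lambda>\<close> goes with \<open>4 n \<rho>\<close>, the bound by
      \<open>n m M^2\<close> with \<open>L^3\<close>.\<close>
    have e1: "2 * \<kappa> * \<beta> * \<Lambda> \<le> 8 * (t * U) + 2 * L ^ 3 * (t * U)"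
    proof -
      have "2 * \<kappa> * \<beta> * \<Lambda> = 8 * n * M\<^sup>2 / \<rho>\<^sup>2 * (\<rho> * \<Lambda>) + 2 * L ^ 3 * (M\<^sup>2 / \<rho>\<^sup>2) * \<Lambda>"
        by (simp add: \<kappa>_def \<beta> algebra_simps)
      also have "\<dots> \<le> 8 * n * M\<^sup>2 / \<rho>\<^sup>2 * (t * real m * M\<^sup>2) + 2 * L ^ 3 * (M\<^sup>2 / \<rho>\<^sup>2) * (real n * real m * M\<^sup>2)"
        using \<Lambda>1 \<Lambda>2 L by (intro add_mono mult_left_mono) auto
      also have "\<dots> = 8 * (t * U) + 2 * L ^ 3 * U"
        by (simp add: U_def Nr_def power4_eq_xxxx power2_eq_square mult_ac)
      also have "\<dots> \<le> 8 * (t * U) + 2 * L ^ 3 * (t * U)"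
        using tU L by (intro add_left_mono mult_left_mono) auto
      finally show ?thesis .
    qed
    have e2: "(2 * \<kappa> + 2) * \<beta>\<^sup>2 * R \<le> 36 * L ^ 3 * (t * U)"
    proof -
      have "(2 * \<kappa> + 2) * \<beta>\<^sup>2 * R \<le> (4 * \<kappa>) * \<beta>\<^sup>2 * R"
        using k0 R0 by (intro mult_right_mono) auto
      also have "\<dots> = 4 * \<beta>\<^sup>2 * (\<kappa> * R)" by simp
      also have "\<dots> \<le> 4 * \<beta>\<^sup>2 * (9 * L ^ 3 * (Nr * \<rho>\<^sup>2))"
        using \<kappa>R by (intro mult_left_mono) auto
      also have "\<dots> = 36 * L ^ 3 * U"
        using rho by (simp add: U_def \<beta> power4_eq_xxxx power2_eq_square)
      also have "\<dots> \<le> 36 * L ^ 3 * (t * U)" using tU L by (intro mult_left_mono) auto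
      finally show ?thesis .
    qed
    have e3: "3 * (real n * real m) * M ^ 4 / \<rho>\<^sup>2 + 2 * real n * M\<^sup>2 * \<Lambda> / \<rho> \<le> 5 * (t * U)"
    proof -
      have "2 * real n * M\<^sup>2 * \<Lambda> / \<rho> = 2 * real n * M\<^sup>2 / \<rho>\<^sup>2 * (\<rho> * \<Lambda>)"
        using rho by (simp add: power2_eq_square)
      also have "\<dots> \<le> 2 * real n * M\<^sup>2 / \<rho>\<^sup>2 * (t * real m * M\<^sup>2)"
        using \<Lambda>2 by (intro mult_left_mono) auto
      also have "\<dots> = 2 * (t * U)"
        by (simp add: U_def Nr_def power4_eq_xxxx power2_eq_square mult_ac)
      finally have "2 * real n * M\<^sup>2 * \<Lambda> / \<rho> \<le> 2 * (t * U)" .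
      moreover have "3 * (real n * real m) * M ^ 4 / \<rho>\<^sup>2 = 3 * U" by (simp add: U_def Nr_def)
      ultimately show ?thesis using tU by linarith
    qed
    have "v \<le> (13 + 38 * L ^ 3) * (t * U)"
      unfolding v_def using e1 e2 e3 by (simp add: algebra_simps)
    also have "\<dots> \<le> (39 * L ^ 3) * (t * U)"
      using L512 U0 \<open>1 \<le> t\<close> by (intro mult_right_mono) auto
    finally show ?thesis .
  qed
  have vs: "4 * real (Suc r) * v \<le> s\<^sup>2"
  proof -
    have "4 * real (Suc r) * v \<le> L\<^sup>2 * v" using Sr4 v0 by (rule mult_right_mono)
    also have "\<dots> \<le> L\<^sup>2 * (39 * L ^ 3 * (t * U))" using vU by (intro mult_left_mono) auto
    also have "\<dots> = L ^ 5 * 39 * (t * U)" by (simp add: power_numeral_reduce)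
    also have "\<dots> \<le> L ^ 5 * (L ^ 3 / 4) * (t * U)"
      using L512 L U0 \<open>1 \<le> t\<close> by (intro mult_right_mono mult_left_mono) auto
    also have "\<dots> = s\<^sup>2"
      using \<open>1 \<le> t\<close> Nr1 by (simp add: s_def U_def power_divide power_mult_distrib q_def flip: power_mult)
    finally show ?thesis .
  qed
  \<comment> \<open>The crude bound exceeds \<open>s\<close> by at most the factor
    \<open>exp L\<close>, so the moment of order \<open>2 p\<close> loses no more than
    \<open>exp (2 p L)\<close> on bad masks.\<close>
  have Ks: "K / s \<le> exp L"
  proof -
    have "L ^ 4 * 4 * q \<le> L ^ 4 * (q * (q * \<rho>))"
      using q\<rho> L43 L512 q1 L by (subst mult.assoc, intro mult_left_mono) (auto simp: mult.commute[of 4] intro!: mult_left_mono)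
    also have "\<dots> \<le> exp L * (L ^ 4 * sqrt t * \<rho>)"
      unfolding N[symmetric] Nr_def[symmetric] qq[symmetric] using \<open>1 \<le> t\<close> L rho q1 by (simp add: mult_ac mult_le_cancel_left1)
    finally have a: "4 * q \<le> exp L * (sqrt t * \<rho>)" using L by (simp add: mult_ac)
    have "K = (4 * q) * (q * M\<^sup>2 / (2 * \<rho>\<^sup>2))" unfolding K_def \<beta> using qq by (simp add: Nr_def)
    also have "\<dots> \<le> (exp L * (sqrt t * \<rho>)) * (q * M\<^sup>2 / (2 * \<rho>\<^sup>2))"
      using a q1 rho by (intro mult_right_mono) auto
    also have "\<dots> = exp L * (1 * sqrt t * q * M\<^sup>2 / (2 * \<rho>))" using rho by (simp add: power2_eq_square)
    also have "\<dots> \<le> exp L * s" unfolding s_def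
      using L L43 L512 \<open>1 \<le> t\<close> q1 rho by (intro mult_left_mono divide_right_mono mult_right_mono) auto
    finally show ?thesis using s0 by (simp add: divide_le_eq)
  qed
  have Pbad: "bern \<rho> cell (\<lambda>A. of_bool (bad A)) \<le> 2 * exp L * exp (- (L ^ 3))"
  proof -
    have "bern \<rho> cell (\<lambda>A. of_bool (bad A)) \<le> bern \<rho> cell (\<lambda>A. (\<Sum>l<m. of_bool (\<not> real (cnt l A) \<le> \<kappa>))
        + (\<Sum>i<n. of_bool (\<not> (\<Sum>l<m. of_bool (crowded i l A)) \<le> R)))"
    proof (intro bern_mono)
      fix A :: "(nat \<times> nat) set"
      have mem: "of_bool (\<exists>i<k. P i) \<le> (\<Sum>i<k. of_bool (P i) :: real)" for P and k :: nat
      proof (cases "\<exists>i<k. P i")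
        case True
        then obtain i where "i < k" "P i" by blast
        then have "of_bool (P i) \<le> (\<Sum>i<k. of_bool (P i) :: real)" by (intro member_le_sum) auto
        with True \<open>P i\<close> show ?thesis by simp
      next
        case False
        then show ?thesis by (simp add: sum_nonneg)
      qed
      have "of_bool (bad A) \<le> of_bool (\<exists>l<m. \<not> real (cnt l A) \<le> \<kappa>) + (of_bool (\<exists>i<n. \<not> (\<Sum>l<m. of_bool (crowded i l A)) \<le> R) :: real)"
        unfolding bad_def by (simp only: of_bool_def split: if_splits) simp
      then show "of_bool (bad A) \<le> (\<Sum>l<m. of_bool (\<not> real (cnt l A) \<le> \<kappa>))
        + (\<Sum>i<n. of_bool (\<not> (\<Sum>l<m. of_bool (crowded i l A)) \<le> R) :: real)"
        by (rule order.trans) (intro add_mono mem)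
    qed (use rho in auto)
    also have "\<dots> \<le> (\<Sum>l<m. exp (- (L ^ 3))) + (\<Sum>i<n. exp (- (L ^ 3)))"
      unfolding bern_add bern_sum
    proof (intro add_mono sum_mono)
      fix l assume "l \<in> {..<m}"
      then have "bern \<rho> cell (\<lambda>A. of_bool (\<not> real (cnt l A) \<le> \<kappa>)) \<le> exp (2 * \<rho> * n - \<kappa>)"
        by (intro column_tail) auto
      also have "\<dots> \<le> exp (- (L ^ 3))" using rho by (simp add: \<kappa>_def mult.commute)
      finally show "bern \<rho> cell (\<lambda>A. of_bool (\<not> real (cnt l A) \<le> \<kappa>)) \<le> exp (- (L ^ 3))" .
    next
      fix i assume "i \<in> {..<n}"
      then have "bern \<rho> cell (\<lambda>A. of_bool (\<not> (\<Sum>l<m. of_bool (crowded i l A)) \<le> R)) \<le> exp (2 * (m * (\<rho> * h)) - R)"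
        unfolding h_def by (intro row_tail) auto
      also have "\<dots> \<le> exp (- (L ^ 3))" using rho h by (simp add: R_def)
      finally show "bern \<rho> cell (\<lambda>A. of_bool (\<not> (\<Sum>l<m. of_bool (crowded i l A)) \<le> R)) \<le> exp (- (L ^ 3))" .
    qed
    also have "\<dots> = (real m + real n) * exp (- (L ^ 3))" by (simp add: algebra_simps)
    also have "\<dots> \<le> (2 * exp L) * exp (- (L ^ 3))"
    proof (intro mult_right_mono)
      have "1 * real m \<le> real n * real m" using m1 by (intro mult_right_mono) auto
      then show "real m + real n \<le> 2 * exp L" unfolding N using m1 by linarith
    qed auto
    finally show ?thesis .
  qed
  have main: "bern \<rho> cell (\<lambda>A. of_bool (\<not> (\<forall>y. \<bar>ip n y (mv n (G A) y)\<bar> \<le> 4 * s * ip n y y)))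
    \<le> real n * (1 + 2 * real (Suc r) * (K / s) ^ (r + 2) * (2 * exp L * exp (- (L ^ 3)))) / 4 ^ (r + 2)"
    unfolding G_def
  proof (rule spectral_tail_le[where bad = bad and c = c and v = v])
    fix A y assume A: "\<not> bad A" and y: "ip n y y = 1"
    show "(\<Sum>l<m. ip n (mv n (W l A) y) (mv n (W l A) y))
       + (\<Sum>l<m. bern \<rho> (block l) (\<lambda>B. ip n (mv n (W l B) y) (mv n (W l B) y)))
       \<le> c * \<bar>ip n y (mv n (centered \<rho> {..<m} block W A) y)\<bar> + v"
      unfolding c_def v_def G_def[symmetric] V_def[symmetric]
      using A \<Lambda>[of y] by (intro V_good y k0(1)) (auto simp: bad_def y)
  next
    fix A y assume y: "ip n y y = 1"
    show "\<bar>ip n y (mv n (centered \<rho> {..<m} block W A) y)\<bar> \<le> K \<and>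
       (\<Sum>l<m. ip n (mv n (W l A) y) (mv n (W l A) y))
       + (\<Sum>l<m. bern \<rho> (block l) (\<lambda>B. ip n (mv n (W l B) y) (mv n (W l B) y))) \<le> K\<^sup>2"
      unfolding K_def G_def[symmetric] V_def[symmetric]
      using m1 by (intro crude_bounds y) auto
  qed (use rho finite_cell block_subset disjoint_blocks W_local sym_W c0 v0 cs vs s0 K0 Pbad in
        \<open>auto simp: r_def simp del: of_nat_Suc\<close>)
  \<comment> \<open>In the exponent \<open>5 L + L^3/8\<close> stands against \<open>- L^3\<close>,
    which is negative in total for \<open>L \<ge> 8\<close>.\<close>
  have eps: "2 * real (Suc r) * (K / s) ^ (r + 2) * (2 * exp L * exp (- (L ^ 3))) \<le> 1"
  proof -
    have "(K / s) ^ (r + 2) \<le> exp L ^ (r + 2)" using Ks K0 s0 by (intro power_mono) auto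
    also have "\<dots> = exp (2 * real p * L)" unfolding r2 by (simp flip: exp_of_nat_mult)
    also have "\<dots> \<le> exp ((L\<^sup>2 / 8 + 2) * L)" using p(2) L by (simp only: exp_le_cancel_iff) (intro mult_right_mono, auto)
    finally have a: "(K / s) ^ (r + 2) \<le> exp ((L\<^sup>2 / 8 + 2) * L)" .
    have pw0: "0 \<le> (K / s) ^ (r + 2)" using K0 s0 by (intro zero_le_power) auto
    have "L\<^sup>2 / 2 \<le> exp L" using exp_lower_Taylor_quadratic[of L] L by linarith
    then have b: "4 * real (Suc r) \<le> 2 * exp L" using Sr4 by linarith
    have "2 * real (Suc r) * (K / s) ^ (r + 2) * (2 * exp L * exp (- (L ^ 3)))
       = (4 * real (Suc r)) * (K / s) ^ (r + 2) * (exp L * exp (- (L ^ 3)))" by simp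
    also have "\<dots> \<le> (2 * exp L) * exp ((L\<^sup>2 / 8 + 2) * L) * (exp L * exp (- (L ^ 3)))"
      by (intro mult_right_mono mult_mono a b pw0) auto
    also have "\<dots> \<le> (exp L * exp L) * exp ((L\<^sup>2 / 8 + 2) * L) * (exp L * exp (- (L ^ 3)))"
    proof -
      have "2 \<le> exp L" using exp_ge_add_one_self[of L] L by linarith
      then show ?thesis by (intro mult_right_mono) auto
    qed
    also have "\<dots> = exp (L + L + (L\<^sup>2 / 8 + 2) * L + (L - L ^ 3))" unfolding exp_add[symmetric] by simp
    also have "\<dots> \<le> 1"
    proof -
      have "L ^ 3 = L\<^sup>2 * L" by (simp add: power_numeral_reduce)
      moreover have "64 * L \<le> L\<^sup>2 * L" using L64 L by (intro mult_right_mono) auto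
      ultimately have "L + L + (L\<^sup>2 / 8 + 2) * L + (L - L ^ 3) \<le> 0" using L by (simp add: algebra_simps)
      then show ?thesis by simp
    qed
    finally show ?thesis .
  qed
  have "real n * (1 + 2 * real (Suc r) * (K / s) ^ (r + 2) * (2 * exp L * exp (- (L ^ 3)))) / 4 ^ (r + 2)
     \<le> real n * 2 / 4 ^ (r + 2)"
    using eps by (intro divide_right_mono mult_left_mono) auto
  also have "\<dots> \<le> real n * 2 / exp (L\<^sup>2 / 8)"
  proof (intro divide_left_mono)
    have "exp (L\<^sup>2 / 8) \<le> exp (2 * real p)" using p(1) by simp
    also have "\<dots> = exp 1 ^ (r + 2)" unfolding r2 by (simp flip: exp_of_nat_mult)
    also have "\<dots> \<le> 4 ^ (r + 2)" using exp_le by (intro power_mono) auto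
    finally show "exp (L\<^sup>2 / 8) \<le> 4 ^ (r + 2)" .
  qed auto
  also have "\<dots> = 2 * real n * exp (- (L\<^sup>2 / 8))" by (simp add: exp_minus inverse_eq_divide)
  finally have fin: "real n * (1 + 2 * real (Suc r) * (K / s) ^ (r + 2) * (2 * exp L * exp (- (L ^ 3)))) / 4 ^ (r + 2)
     \<le> 2 * real n * exp (- (L\<^sup>2 / 8))" .
  have "4 * s = 2 * L ^ 4 * sqrt t * sqrt (real n * real m) * M\<^sup>2 / \<rho>"
    by (simp add: s_def q_def Nr_def)
  then show ?thesis using order.trans[OF main fin] by simp
qed

end

section \<open>Sums of independent vectors\<close>

definition nrm :: "nat \<Rightarrow> (nat \<Rightarrow> real) \<Rightarrow> real" where
  "nrm n x = sqrt (ip n x x)"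

lemma nrm_nonneg: "0 \<le> nrm n x" by (simp add: nrm_def ip_nonneg)

lemma nrm_sq: "(nrm n x)\<^sup>2 = ip n x x" by (simp add: nrm_def ip_nonneg)

lemma nrm_scale: "nrm n (\<lambda>i. c * x i) = \<bar>c\<bar> * nrm n x"
  by (simp add: nrm_def ip_scale_left ip_scale_right real_sqrt_mult flip: mult.assoc)

lemma abs_ip_le: "\<bar>ip n x y\<bar> \<le> nrm n x * nrm n y"
  using ip_Cauchy_Schwarz[of n x y]
  by (metis real_sqrt_abs real_sqrt_le_iff real_sqrt_mult nrm_def)

text \<open>The power series of \<open>cosh (sqrt q)\<close> has the terms
  \<open>q^j / (2j)!\<close>, each convex for \<open>q \<ge> 0\<close>.\<close>

lemma cosh_sqrt_convex:
  fixes x y \<tau> :: real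
  assumes "0 \<le> x" "0 \<le> y" "0 \<le> \<tau>" "\<tau> \<le> 1"
  shows "cosh (sqrt ((1 - \<tau>) * x + \<tau> * y)) \<le> (1 - \<tau>) * cosh (sqrt x) + \<tau> * cosh (sqrt y)"
proof -
  define f where "f q n = (if even n then sqrt q ^ n /\<^sub>R fact n else 0)" for q :: real and n :: nat
  have s: "f q sums cosh (sqrt q)" for q
    using cosh_converges[of "sqrt q"] unfolding f_def .
  have fe: "f q n = (if even n then q ^ (n div 2) / fact n else 0)" if "0 \<le> q" for q n
    using that by (auto simp: f_def power_mult divide_inverse elim!: evenE)
  have "f ((1 - \<tau>) * x + \<tau> * y) n \<le> (1 - \<tau>) * f x n + \<tau> * f y n" for n
  proof (cases "even n")
    case True
    have "convex_on {0::real..} (\<lambda>x. x ^ (n div 2))"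
      using convex_power_odd[of "n div 2"] convex_on_subset[OF convex_power_even[of "n div 2"], of "{0..}"]
      by (cases "even (n div 2)") auto
    from convex_onD[OF this, of \<tau> x y]
    have "((1 - \<tau>) * x + \<tau> * y) ^ (n div 2) \<le> (1 - \<tau>) * x ^ (n div 2) + \<tau> * y ^ (n div 2)"
      using assms by simp
    then have "((1 - \<tau>) * x + \<tau> * y) ^ (n div 2) / fact n
      \<le> ((1 - \<tau>) * x ^ (n div 2) + \<tau> * y ^ (n div 2)) / fact n" by (rule divide_right_mono) simp
    then show ?thesis using True assms by (simp add: fe add_divide_distrib)
  next
    case False
    then show ?thesis using assms by (simp add: fe)
  qed
  then show ?thesis
    by (rule sums_le[OF _ s sums_add[OF sums_mult[OF s] sums_mult[OF s]]])
qed

text \<open>For given lengths \<open>a\<close> and \<open>c\<close> the squared length of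
  \<open>x + z\<close> is a convex combination of \<open>(a - c)^2\<close> and
  \<open>(a + c)^2\<close>, and convexity in the square reduces the claim to the addition formulas
  on the line. The last term is linear in \<open>z\<close>, so it disappears in the mean over a
  centered \<open>z\<close>.\<close>

lemma cosh_step:
  assumes "nrm n z \<le> 1"
  shows "cosh (nrm n (\<lambda>i. x i + z i))
    \<le> cosh (nrm n x) * (1 + ip n z z) + sinh (nrm n x) / nrm n x * ip n x z"
proof -
  define a where "a = nrm n x"
  define c where "c = nrm n z"
  define b where "b = ip n x z"
  have a0: "0 \<le> a" and c0: "0 \<le> c" "c \<le> 1" using assms nrm_nonneg by (auto simp: a_def c_def)
  have b: "\<bar>b\<bar> \<le> a * c" unfolding a_def b_def c_def by (rule abs_ip_le)
  have nz: "nrm n (\<lambda>i. x i + z i) = sqrt (a\<^sup>2 + 2 * b + c\<^sup>2)"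
    unfolding nrm_def a_def b_def c_def nrm_sq
    by (simp add: ip_add_left ip_add_right ip_commute[of n z x] nrm_sq ip_nonneg)
  have c2: "ip n z z = c\<^sup>2" by (simp add: c_def nrm_sq)
  \<comment> \<open>The two cases amount to \<open>exp c \<le> 1 + c + c^2\<close> and
    \<open>exp (- c) \<le> 1 - c + c^2\<close>; the bound \<open>c \<le> 1\<close> enters
    here.\<close>
  have r: "cosh c - 1 + \<bar>sinh c - c\<bar> \<le> c\<^sup>2"
  proof (cases "c \<le> sinh c")
    case True
    have "cosh c + sinh c = exp c" by (rule cosh_plus_sinh)
    then show ?thesis using True exp_bound[of c] c0 by simp
  next
    case False
    have e: "cosh c - sinh c = exp (- c)" by (rule cosh_minus_sinh)
    have "exp (- c) * (1 + c) \<le> exp (- c) * exp c" by (intro mult_left_mono exp_ge_add_one_self) auto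
    also have "\<dots> = 1" by (simp flip: exp_add)
    also have "1 \<le> (1 - c + c\<^sup>2) * (1 + c)" using c0 by (simp add: algebra_simps power2_eq_square)
    finally have "exp (- c) \<le> 1 - c + c\<^sup>2" using c0 by simp
    then show ?thesis using False e by simp
  qed
  show ?thesis
  \<comment> \<open>For a zero vector the angle is undefined. Then \<open>b = 0\<close>, and the
    linear term vanishes whatever the quotient \<open>sinh a / a\<close> denotes.\<close>
  proof (cases "a * c = 0")
    case True
    then have "b = 0" using b by (metis abs_le_zero_iff)
    have "cosh (sqrt (a\<^sup>2 + c\<^sup>2)) \<le> cosh a * (1 + c\<^sup>2)"
    proof (cases "a = 0")
      case True
      then show ?thesis using r c0 by simp
    next
      case False
      then show ?thesis using \<open>a * c = 0\<close> a0 by simp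
    qed
    then show ?thesis using \<open>b = 0\<close> by (simp add: nz c2 a_def[symmetric] b_def[symmetric])
  next
    case False
    then have pos: "0 < a" "0 < c" using a0 c0 by auto
    \<comment> \<open>The cosine of the angle between \<open>x\<close> and \<open>z\<close>; \<tau>
      is the weight of the aligned extreme \<open>(a + c)^2\<close>.\<close>
    define \<sigma> where "\<sigma> = b / (a * c)"
    have \<sigma>: "\<bar>\<sigma>\<bar> \<le> 1" using b pos by (simp add: \<sigma>_def abs_mult)
    define \<tau> where "\<tau> = (1 + \<sigma>) / 2"
    have \<tau>: "0 \<le> \<tau>" "\<tau> \<le> 1" using \<sigma> by (auto simp: \<tau>_def abs_le_iff)
    have b\<sigma>: "b = \<sigma> * (a * c)" using pos by (simp add: \<sigma>_def)
    have "a\<^sup>2 + 2 * b + c\<^sup>2 = (1 - \<tau>) * (a - c)\<^sup>2 + \<tau> * (a + c)\<^sup>2"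
      by (simp add: b\<sigma> \<tau>_def field_simps power2_eq_square)
    then have "cosh (nrm n (\<lambda>i. x i + z i)) \<le> (1 - \<tau>) * cosh (a - c) + \<tau> * cosh (a + c)"
      using cosh_sqrt_convex[of "(a - c)\<^sup>2" "(a + c)\<^sup>2" \<tau>] \<tau> by (simp add: nz)
    also have "\<dots> = cosh a * cosh c + \<sigma> * (sinh a * sinh c)"
      by (simp add: cosh_add cosh_diff \<tau>_def field_simps)
    also have "\<dots> = cosh a + sinh a / a * b + (cosh a * (cosh c - 1) + \<sigma> * (sinh a * (sinh c - c)))"
      using pos by (simp add: b\<sigma> algebra_simps)
    also have "\<sigma> * (sinh a * (sinh c - c)) \<le> \<bar>\<sigma>\<bar> * (\<bar>sinh a\<bar> * \<bar>sinh c - c\<bar>)"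
      by (metis abs_ge_self abs_mult)
    also have "\<dots> \<le> 1 * (cosh a * \<bar>sinh c - c\<bar>)"
    proof (intro mult_mono mult_right_mono \<sigma>)
      have "sinh a \<ge> 0" using a0 by simp
      moreover have "cosh a - sinh a = exp (- a)" by (rule cosh_minus_sinh)
      ultimately show "\<bar>sinh a\<bar> \<le> cosh a" using exp_gt_zero[of "- a"] by linarith
    qed (auto simp: cosh_real_nonneg)
    also have "cosh a * (cosh c - 1) + 1 * (cosh a * \<bar>sinh c - c\<bar>) \<le> cosh a * c\<^sup>2"
      using mult_left_mono[OF r, of "cosh a"] by (simp add: algebra_simps cosh_real_nonneg)
    finally show ?thesis by (simp add: c2 a_def[symmetric] b_def[symmetric] algebra_simps)
  qed
qed

text \<open>Pinelis' argument: \<open>cosh (\<parallel>\<cdot>\<parallel>)\<close> grows by at most a factor \<open>1 + E \<parallel>\<xi>\<parallel>\<^sup>2\<close> when a small centered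
  independent summand \<open>\<xi>\<close> is added.\<close>

lemma bern_cosh_le:
  assumes "finite S" and p: "0 < p" "p \<le> 1" and small: "\<And>x. x \<in> S \<Longrightarrow> nrm n (z x) \<le> p"
  shows "bern p S (\<lambda>A. cosh (nrm n (\<lambda>i. v i + (\<Sum>x\<in>S. (of_bool (x \<in> A) / p - 1) * z x i))))
    \<le> cosh (nrm n v) * exp ((\<Sum>x\<in>S. ip n (z x) (z x)) / p)"
  using assms(1) small
proof (induction S arbitrary: v rule: finite_induct)
  case empty
  then show ?case by simp
next
  case (insert y S)
  define F where "F v A = cosh (nrm n (\<lambda>i. v i + (\<Sum>x\<in>S. (of_bool (x \<in> A) / p - 1) * z x i)))" for v A
  define E where "E = exp ((\<Sum>x\<in>S. ip n (z x) (z x)) / p)"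
  have IH: "bern p S (F v) \<le> cosh (nrm n v) * E" for v
    unfolding F_def E_def using insert.prems by (intro insert.IH) auto
  define v1 where "v1 = (\<lambda>i. v i + (1 / p - 1) * z y i)"
  define v0 where "v0 = (\<lambda>i. v i + (- 1) * z y i)"
  have 1: "bern p S (\<lambda>A. cosh (nrm n (\<lambda>i. v i + (\<Sum>x\<in>insert y S. (of_bool (x \<in> insert y A) / p - 1) * z x i))))
      = bern p S (F v1)"
  proof (intro bern_cong)
    fix A
    have "(\<Sum>x\<in>S. (of_bool (x \<in> insert y A) / p - 1) * z x i) = (\<Sum>x\<in>S. (of_bool (x \<in> A) / p - 1) * z x i)" for i
      using insert.hyps by (intro sum.cong) auto
    then show "cosh (nrm n (\<lambda>i. v i + (\<Sum>x\<in>insert y S. (of_bool (x \<in> insert y A) / p - 1) * z x i))) = F v1 A"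
      unfolding F_def v1_def using insert.hyps by (simp add: add.assoc)
  qed
  have 0: "bern p S (\<lambda>A. cosh (nrm n (\<lambda>i. v i + (\<Sum>x\<in>insert y S. (of_bool (x \<in> A) / p - 1) * z x i))))
      = bern p S (F v0)"
  proof (intro bern_cong)
    fix A assume "A \<subseteq> S"
    then have "y \<notin> A" using insert.hyps by auto
    then show "cosh (nrm n (\<lambda>i. v i + (\<Sum>x\<in>insert y S. (of_bool (x \<in> A) / p - 1) * z x i))) = F v0 A"
      unfolding F_def v0_def using insert.hyps by (simp add: algebra_simps)
  qed
  define C where "C = cosh (nrm n v)"
  define q where "q = ip n (z y) (z y)"
  define D where "D = sinh (nrm n v) / nrm n v * ip n v (z y)"
  have C0: "0 \<le> C" and q0: "0 \<le> q" by (simp_all add: C_def q_def cosh_real_nonneg ip_nonneg)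
  have nz: "nrm n (z y) \<le> p" using insert.prems by simp
  \<comment> \<open>The assumption \<open>nrm n (z y) \<le> p\<close> is what keeps even the
    amplified jump \<open>(1/p - 1) z\<close> within the range of \<open>cosh_step\<close>.\<close>
  have s1: "nrm n (\<lambda>i. (1 / p - 1) * z y i) \<le> 1"
  proof -
    have "(1 / p - 1) * nrm n (z y) \<le> (1 / p - 1) * p" using nz p by (intro mult_left_mono) auto
    also have "\<dots> \<le> 1" using p by (simp add: field_simps)
    finally show ?thesis using p by (simp add: nrm_scale)
  qed
  have s0: "nrm n (\<lambda>i. (- 1) * z y i) \<le> 1" using nz p unfolding nrm_scale by simp
  have t1: "cosh (nrm n v1) \<le> C * (1 + (1 / p - 1)\<^sup>2 * q) + (1 / p - 1) * D"
    using cosh_step[OF s1, of v] unfolding v1_def C_def D_def q_def ip_scale_left ip_scale_right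
    by (simp add: power2_eq_square mult_ac)
  have t0: "cosh (nrm n v0) \<le> C * (1 + q) - D"
    using cosh_step[OF s0, of v] unfolding v0_def C_def D_def q_def ip_scale_left ip_scale_right
    by simp
  \<comment> \<open>The linear terms cancel because the jumps are centered:
    \<open>p (1/p - 1) = 1 - p\<close>. The quadratic ones add up to
    \<open>(1 - p) / p\<close>.\<close>
  have "p * cosh (nrm n v1) + (1 - p) * cosh (nrm n v0)
      \<le> p * (C * (1 + (1 / p - 1)\<^sup>2 * q) + (1 / p - 1) * D) + (1 - p) * (C * (1 + q) - D)"
    using t1 t0 p by (intro add_mono mult_left_mono) auto
  also have "\<dots> = C * (1 + (1 - p) * q / p)"
    using p by (simp add: field_simps power2_eq_square)
  also have "\<dots> \<le> C * (1 + q / p)"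
    using p q0 C0 by (intro mult_left_mono add_left_mono divide_right_mono) (auto simp: mult_left_le_one_le)
  also have "\<dots> \<le> C * exp (q / p)" using C0 by (intro mult_left_mono exp_ge_add_one_self) auto
  finally have step: "p * cosh (nrm n v1) + (1 - p) * cosh (nrm n v0) \<le> C * exp (q / p)" .
  have "bern p (insert y S) (\<lambda>A. cosh (nrm n (\<lambda>i. v i + (\<Sum>x\<in>insert y S. (of_bool (x \<in> A) / p - 1) * z x i))))
      = p * bern p S (F v1) + (1 - p) * bern p S (F v0)"
    unfolding bern_insert[OF insert.hyps] 0 1 ..
  also have "\<dots> \<le> p * (cosh (nrm n v1) * E) + (1 - p) * (cosh (nrm n v0) * E)"
    using p by (intro add_mono mult_left_mono IH) auto
  also have "\<dots> = (p * cosh (nrm n v1) + (1 - p) * cosh (nrm n v0)) * E" by (simp add: algebra_simps)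
  also have "\<dots> \<le> (C * exp (q / p)) * E" using step by (intro mult_right_mono) (auto simp: E_def)
  also have "\<dots> = C * exp ((\<Sum>x\<in>insert y S. ip n (z x) (z x)) / p)"
    using insert.hyps by (simp add: E_def q_def add_divide_distrib exp_add)
  finally show ?case by (simp add: C_def)
qed

text \<open>The scale \<open>h\<close> is chosen so that each scaled summand is at most
  \<open>p\<close> and the total variance at most 1; then \<open>exp 1\<close> bounds the mean of
  \<open>cosh\<close> and Markov's inequality finishes. The dimension \<open>n\<close> does not
  occur in the bound, so it can be applied in dimension \<open>d^k\<close> with only the trace of a
  projection as variance.\<close>

theorem noise_tail:
  assumes "finite S" and p: "0 < p" "p \<le> 1" and "0 < h"
    and small: "\<And>x. x \<in> S \<Longrightarrow> h * nrm n (z x) \<le> p"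
    and var: "h\<^sup>2 * (\<Sum>x\<in>S. ip n (z x) (z x)) \<le> p"
  shows "bern p S (\<lambda>A. of_bool (\<not> nrm n (\<lambda>i. \<Sum>x\<in>S. (of_bool (x \<in> A) / p - 1) * z x i) \<le> s))
    \<le> 2 * exp (1 - h * s)"
proof -
  define Y where "Y A = nrm n (\<lambda>i. \<Sum>x\<in>S. (of_bool (x \<in> A) / p - 1) * z x i)" for A
  have "bern p S (\<lambda>A. cosh (nrm n (\<lambda>i. 0 + (\<Sum>x\<in>S. (of_bool (x \<in> A) / p - 1) * (h * z x i)))))
    \<le> cosh (nrm n (\<lambda>i. 0)) * exp ((\<Sum>x\<in>S. ip n (\<lambda>i. h * z x i) (\<lambda>i. h * z x i)) / p)"
    using small \<open>0 < h\<close> by (intro bern_cosh_le assms) (simp_all add: nrm_scale)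
  also have "(\<Sum>x\<in>S. ip n (\<lambda>i. h * z x i) (\<lambda>i. h * z x i)) = h\<^sup>2 * (\<Sum>x\<in>S. ip n (z x) (z x))"
    by (simp add: ip_scale_left ip_scale_right power2_eq_square sum_distrib_left mult.assoc)
  also have "cosh (nrm n (\<lambda>i. 0)) * exp (h\<^sup>2 * (\<Sum>x\<in>S. ip n (z x) (z x)) / p) \<le> exp 1"
    using var p by (simp add: nrm_def ip_def)
  also have "(\<lambda>A. cosh (nrm n (\<lambda>i. 0 + (\<Sum>x\<in>S. (of_bool (x \<in> A) / p - 1) * (h * z x i))))) = (\<lambda>A. cosh (h * Y A))"
  proof
    fix A
    have "(\<lambda>i. 0 + (\<Sum>x\<in>S. (of_bool (x \<in> A) / p - 1) * (h * z x i)))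
        = (\<lambda>i. h * (\<Sum>x\<in>S. (of_bool (x \<in> A) / p - 1) * z x i))"
      unfolding sum_distrib_left by (intro ext) (simp only: add_0_left mult.left_commute)
    then show "cosh (nrm n (\<lambda>i. 0 + (\<Sum>x\<in>S. (of_bool (x \<in> A) / p - 1) * (h * z x i)))) = cosh (h * Y A)"
      using \<open>0 < h\<close> by (simp only: nrm_scale Y_def abs_of_pos)
  qed
  finally have E: "bern p S (\<lambda>A. cosh (h * Y A)) \<le> exp 1" .
  have "bern p S (\<lambda>A. of_bool (\<not> Y A \<le> s)) \<le> bern p S (\<lambda>A. cosh (h * Y A)) / (exp (h * s) / 2)"
  proof (intro bern_markov)
    fix A assume "\<not> Y A \<le> s"
    then have "h * s \<le> h * Y A" using \<open>0 < h\<close> by simp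
    then have "exp (h * s) \<le> exp (h * Y A)" by simp
    also have "\<dots> \<le> 2 * cosh (h * Y A)" by (simp add: cosh_field_def)
    finally show "exp (h * s) / 2 \<le> cosh (h * Y A)" by simp
  qed (use p in \<open>auto simp: cosh_real_nonneg\<close>)
  also have "\<dots> \<le> exp 1 / (exp (h * s) / 2)" using E by (intro divide_right_mono) auto
  also have "\<dots> = 2 * exp (1 - h * s)" by (simp add: exp_diff)
  finally show ?thesis by (simp add: Y_def)
qed

section \<open>The diagonal error and the full Gram estimate\<close>

context masked_matrix
begin

definition "diag_dev A i = (\<Sum>l<m. (of_bool ((i, l) \<in> A) / \<rho> - 1) * (X i l)\<^sup>2)"

text \<open>A diagonal error is a sum of independent centered scalars, that is, the case of
  dimension 1 of \<open>noise_tail\<close>.\<close>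

lemma diag_tail:
  assumes "i < n" and L: "8 \<le> L" and N: "real n * real m = exp L" and "1 \<le> t" "1 \<le> n"
  shows "bern \<rho> cell (\<lambda>A. of_bool (\<not> \<bar>diag_dev A i\<bar>
       \<le> 2 * L ^ 4 * sqrt t * sqrt (real n * real m) * M\<^sup>2 / \<rho>))
    \<le> 2 * exp (1 - 4 * L\<^sup>2)"
proof -
  define q where "q = sqrt (real n * real m)"
  have q1: "1 \<le> q" using N L by (simp add: q_def)
  have qq: "q * q = real n * real m" by (simp add: q_def)
  define s where "s = 2 * L ^ 4 * sqrt t * q * M\<^sup>2 / \<rho>"
  \<comment> \<open>Balanced so that \<open>h * s = 4 L^2 sqrt t\<close>, while \<open>h M^2\<close>
    and \<open>h^2 n m M^4\<close> both stay below \<rho>.\<close>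
  define h where "h = 2 * \<rho> / (L\<^sup>2 * q * M\<^sup>2)"
  have L64: "64 \<le> L\<^sup>2" using power_mono[OF L, of 2] by simp
  have h0: "0 < h" using rho L q1 M by (simp add: h_def)
  define z :: "nat \<times> nat \<Rightarrow> nat \<Rightarrow> real" where "z x j = (if fst x = i then (X i (snd x))\<^sup>2 else 0)" for x j
  have nz: "nrm 1 (z x) = \<bar>z x 0\<bar>" for x by (simp add: nrm_def ip_def real_sqrt_mult_self)
  have q2: "2 \<le> L\<^sup>2 * q" using L64 q1 mult_mono[of 64 "L\<^sup>2" 1 q] by simp
  have z0: "z x 0 \<le> M\<^sup>2" "0 \<le> z x 0" if "x \<in> cell" for x
    using X_sq_le[OF assms(1)] that by (auto simp: z_def cell_def)
  have small: "h * nrm 1 (z x) \<le> \<rho>" if "x \<in> cell" for x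
  proof -
    have "h * nrm 1 (z x) \<le> h * M\<^sup>2" unfolding nz using z0[OF that] h0 by (intro mult_left_mono) auto
    also have "\<dots> = 2 * \<rho> / (L\<^sup>2 * q)" using M by (simp add: h_def)
    also have "\<dots> \<le> \<rho>" using q2 rho by (simp add: divide_le_eq)
    finally show ?thesis .
  qed
  have sumcell: "(\<Sum>x\<in>cell. f x) = (\<Sum>l<m. f (i, l))" if "\<And>x. fst x \<noteq> i \<Longrightarrow> f x = 0" for f :: "nat \<times> nat \<Rightarrow> real"
  proof -
    have "(\<Sum>x\<in>cell. f x) = (\<Sum>x\<in>Pair i ` {..<m}. f x)"
    proof (intro sum.mono_neutral_right ballI)
      fix x assume "x \<in> cell - Pair i ` {..<m}"
      then have "fst x \<noteq> i" by (cases x) (auto simp: cell_def)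
      then show "f x = 0" by (rule that)
    qed (use assms(1) finite_cell in \<open>auto simp: cell_def\<close>)
    then show ?thesis by (simp add: sum.reindex inj_on_def)
  qed
  have var: "h\<^sup>2 * (\<Sum>x\<in>cell. ip 1 (z x) (z x)) \<le> \<rho>"
  proof -
    have "(\<Sum>x\<in>cell. ip 1 (z x) (z x)) = (\<Sum>l<m. (X i l)\<^sup>2 * (X i l)\<^sup>2)"
      by (subst sumcell) (auto simp: ip_def z_def)
    also have "\<dots> \<le> (\<Sum>l<m. M\<^sup>2 * M\<^sup>2)"
      using X_sq_le[OF assms(1)] by (intro sum_mono mult_mono) auto
    also have "\<dots> \<le> (q * q) * (M\<^sup>2 * M\<^sup>2)"
      unfolding qq using \<open>1 \<le> n\<close> by (simp add: mult_right_mono mult_le_cancel_right1)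
    finally have "h\<^sup>2 * (\<Sum>x\<in>cell. ip 1 (z x) (z x)) \<le> h\<^sup>2 * ((q * q) * (M\<^sup>2 * M\<^sup>2))"
      by (intro mult_left_mono) auto
    also have "\<dots> = 4 * \<rho>\<^sup>2 / (L\<^sup>2)\<^sup>2" using q1 M by (simp add: h_def power_divide power_mult_distrib power2_eq_square)
    also have "\<dots> \<le> \<rho>"
    proof -
      have "64 * 64 \<le> L\<^sup>2 * L\<^sup>2" using L64 by (intro mult_mono) auto
      then have "4 * \<rho> \<le> (L\<^sup>2)\<^sup>2" using rho by (simp add: power2_eq_square[of "L\<^sup>2"])
      then have "\<rho> * (4 * \<rho>) \<le> \<rho> * (L\<^sup>2)\<^sup>2" using rho by (intro mult_left_mono) auto
      then show ?thesis using L by (simp add: divide_le_eq power2_eq_square[of \<rho>] mult_ac)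
    qed
    finally show ?thesis .
  qed
  have "bern \<rho> cell (\<lambda>A. of_bool (\<not> \<bar>diag_dev A i\<bar> \<le> s))
      = bern \<rho> cell (\<lambda>A. of_bool (\<not> nrm 1 (\<lambda>j. \<Sum>x\<in>cell. (of_bool (x \<in> A) / \<rho> - 1) * z x j) \<le> s))"
  proof (intro bern_cong)
    fix A
    have "(\<Sum>x\<in>cell. (of_bool (x \<in> A) / \<rho> - 1) * z x 0) = diag_dev A i"
      unfolding diag_dev_def by (subst sumcell) (auto simp: z_def)
    then show "of_bool (\<not> \<bar>diag_dev A i\<bar> \<le> s)
      = (of_bool (\<not> nrm 1 (\<lambda>j. \<Sum>x\<in>cell. (of_bool (x \<in> A) / \<rho> - 1) * z x j) \<le> s) :: real)"
      by (simp add: nrm_def ip_def real_sqrt_mult_self)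
  qed
  also have "\<dots> \<le> 2 * exp (1 - h * s)"
    using rho small var h0 by (intro noise_tail finite_cell) auto
  also have "h * s = 4 * L\<^sup>2 * sqrt t"
    using q1 M L rho by (simp add: h_def s_def power4_eq_xxxx power2_eq_square)
  also have "2 * exp (1 - 4 * L\<^sup>2 * sqrt t) \<le> 2 * exp (1 - 4 * L\<^sup>2)"
    using \<open>1 \<le> t\<close> L by (simp add: mult_le_cancel_left1)
  finally show ?thesis by (simp add: s_def q_def)
qed

text \<open>The Gram estimate \<open>B\<close> as a function of indices. On the diagonal
  \<open>w * X\<close> carries a single factor 1/\<rho>: the square of an indicator is the
  indicator, so scaling once is unbiased there.\<close>

definition "Bf A i j = (\<Sum>l<m. if i = j then w A i l * X i l else w A i l * w A j l)"

text \<open>The off-diagonal error and the worst of the \<open>n\<close> diagonal errors each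
  receive half of the radius.\<close>

theorem gram_tail:
  fixes L t \<Lambda> :: real
  assumes "1 \<le> n" "n \<le> m" and L: "8 \<le> L" and N: "real n * real m = exp L" and "1 \<le> t"
    and \<rho>N: "16 * L ^ 4 \<le> sqrt (real n * real m) * \<rho>"
    and \<Lambda>: "\<And>y. (\<Sum>l<m. (\<Sum>i<n. X i l * y i)\<^sup>2) \<le> \<Lambda> * ip n y y"
    and \<Lambda>1: "\<Lambda> \<le> real n * real m * M\<^sup>2" and \<Lambda>2: "\<rho> * \<Lambda> \<le> t * real m * M\<^sup>2" and "0 \<le> \<Lambda>"
  shows "bern \<rho> cell (\<lambda>A. of_bool (\<not> (\<forall>y. \<bar>ip n y (mv n (Bf A) y) - (\<Sum>l<m. (\<Sum>i<n. X i l * y i)\<^sup>2)\<bar>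
        \<le> 4 * L ^ 4 * sqrt t * sqrt (real n * real m) * M\<^sup>2 / \<rho> * ip n y y)))
    \<le> 2 * real n * exp (- (L\<^sup>2 / 8)) + 2 * real n * exp (1 - 4 * L\<^sup>2)"
proof -
  define s where "s = 2 * L ^ 4 * sqrt t * sqrt (real n * real m) * M\<^sup>2 / \<rho>"
  define P where "P A \<longleftrightarrow> (\<forall>y. \<bar>ip n y (mv n (G A) y)\<bar> \<le> s * ip n y y)" for A
  define D where "D i A \<longleftrightarrow> \<bar>diag_dev A i\<bar> \<le> s" for i A
  have quad: "ip n y (mv n (Bf A) y) - (\<Sum>l<m. (\<Sum>i<n. X i l * y i)\<^sup>2)
      = ip n y (mv n (G A) y) + (\<Sum>i<n. diag_dev A i * (y i)\<^sup>2)" for A y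
  proof -
    have "mv n (Bf A) y i = (\<Sum>l<m. mv n (W l A) y i) + (\<Sum>l<m. w A i l * X i l) * y i" if "i < n" for i
    proof -
      have "mv n (Bf A) y i = (\<Sum>j<n. (\<Sum>l<m. W l A i j) * y j + (if i = j then (\<Sum>l<m. w A i l * X i l) * y i else 0))"
        unfolding mv_def by (intro sum.cong) (auto simp: Bf_def W_def)
      also have "\<dots> = (\<Sum>l<m. mv n (W l A) y i) + (\<Sum>l<m. w A i l * X i l) * y i"
        using that by (simp add: sum.distrib mv_def sum_distrib_right sum.swap[of _ "{..<m}"])
      finally show ?thesis .
    qed
    then have "ip n y (mv n (Bf A) y) = (\<Sum>i<n. y i * ((\<Sum>l<m. mv n (W l A) y i) + (\<Sum>l<m. w A i l * X i l) * y i))"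
      unfolding ip_def by (intro sum.cong) auto
    also have "\<dots> = (\<Sum>l<m. ip n y (mv n (W l A) y)) + (\<Sum>i<n. (\<Sum>l<m. w A i l * X i l) * (y i)\<^sup>2)"
      by (simp add: distrib_left sum.distrib ip_def sum_distrib_left sum.swap[of _ "{..<m}"] power2_eq_square mult_ac)
    finally have 1: "ip n y (mv n (Bf A) y) = (\<Sum>l<m. ip n y (mv n (W l A) y)) + (\<Sum>i<n. (\<Sum>l<m. w A i l * X i l) * (y i)\<^sup>2)" .
    have 2: "(\<Sum>i<n. diag_dev A i * (y i)\<^sup>2) = (\<Sum>i<n. (\<Sum>l<m. w A i l * X i l) * (y i)\<^sup>2) - (\<Sum>l<m. \<Sum>i<n. (X i l)\<^sup>2 * (y i)\<^sup>2)"
    proof -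
      have "diag_dev A i = (\<Sum>l<m. w A i l * X i l) - (\<Sum>l<m. (X i l)\<^sup>2)" if "i < n" for i
        unfolding diag_dev_def sum_subtractf[symmetric] using that
        by (intro sum.cong refl) (simp add: w_def power2_eq_square algebra_simps)
      then have "(\<Sum>i<n. diag_dev A i * (y i)\<^sup>2) = (\<Sum>i<n. ((\<Sum>l<m. w A i l * X i l) - (\<Sum>l<m. (X i l)\<^sup>2)) * (y i)\<^sup>2)"
        by (intro sum.cong) auto
      also have "\<dots> = (\<Sum>i<n. (\<Sum>l<m. w A i l * X i l) * (y i)\<^sup>2) - (\<Sum>i<n. \<Sum>l<m. (X i l)\<^sup>2 * (y i)\<^sup>2)"
        by (simp only: left_diff_distrib sum_subtractf sum_distrib_right)
      also have "(\<Sum>i<n. \<Sum>l<m. (X i l)\<^sup>2 * (y i)\<^sup>2) = (\<Sum>l<m. \<Sum>i<n. (X i l)\<^sup>2 * (y i)\<^sup>2)" by (rule sum.swap)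
      finally show ?thesis .
    qed
    show ?thesis unfolding 1 2 ip_G by (simp add: sum_subtractf)
  qed
  have "bern \<rho> cell (\<lambda>A. of_bool (\<not> (\<forall>y. \<bar>ip n y (mv n (Bf A) y) - (\<Sum>l<m. (\<Sum>i<n. X i l * y i)\<^sup>2)\<bar>
        \<le> 2 * s * ip n y y)))
     \<le> bern \<rho> cell (\<lambda>A. of_bool (\<not> P A) + (\<Sum>i<n. of_bool (\<not> D i A)))"
  proof (intro bern_mono)
    fix A :: "(nat \<times> nat) set"
    show "of_bool (\<not> (\<forall>y. \<bar>ip n y (mv n (Bf A) y) - (\<Sum>l<m. (\<Sum>i<n. X i l * y i)\<^sup>2)\<bar> \<le> 2 * s * ip n y y))
       \<le> of_bool (\<not> P A) + (\<Sum>i<n. of_bool (\<not> D i A) :: real)"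
    proof (cases "P A \<and> (\<forall>i<n. D i A)")
      case True
      have "\<bar>ip n y (mv n (Bf A) y) - (\<Sum>l<m. (\<Sum>i<n. X i l * y i)\<^sup>2)\<bar> \<le> 2 * s * ip n y y" for y
      proof -
        have "\<bar>\<Sum>i<n. diag_dev A i * (y i)\<^sup>2\<bar> \<le> (\<Sum>i<n. \<bar>diag_dev A i * (y i)\<^sup>2\<bar>)" by (rule sum_abs)
        also have "\<dots> \<le> (\<Sum>i<n. s * (y i)\<^sup>2)"
          using True by (intro sum_mono) (auto simp: abs_mult D_def intro!: mult_right_mono)
        also have "\<dots> = s * ip n y y" by (simp add: ip_def sum_distrib_left power2_eq_square)
        finally have "\<bar>\<Sum>i<n. diag_dev A i * (y i)\<^sup>2\<bar> \<le> s * ip n y y" .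
        moreover have "\<bar>ip n y (mv n (G A) y)\<bar> \<le> s * ip n y y" using True by (auto simp: P_def)
        ultimately show ?thesis unfolding quad by linarith
      qed
      then show ?thesis by (simp add: sum_nonneg)
    next
      case False
      then consider "\<not> P A" | i where "i < n" "\<not> D i A" by blast
      then have "1 \<le> of_bool (\<not> P A) + (\<Sum>i<n. of_bool (\<not> D i A) :: real)"
      proof cases
        case 2
        then have "of_bool (\<not> D i A) \<le> (\<Sum>i<n. of_bool (\<not> D i A) :: real)" by (intro member_le_sum) auto
        with 2 show ?thesis by simp
      qed (simp add: sum_nonneg)
      then show ?thesis by (rule order.trans[rotated]) simp
    qed
  qed (use rho in auto)
  also have "\<dots> \<le> 2 * real n * exp (- (L\<^sup>2 / 8)) + (\<Sum>i<n. 2 * exp (1 - 4 * L\<^sup>2))"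
    unfolding bern_add bern_sum P_def D_def s_def
    using assms by (intro add_mono sum_mono offdiag_tail diag_tail) auto
  finally show ?thesis by (simp add: s_def mult_ac)
qed

end

section \<open>Perturbation of eigenspaces\<close>

definition proj :: "nat \<Rightarrow> (nat \<Rightarrow> nat \<Rightarrow> real) \<Rightarrow> bool" where
  "proj n P \<longleftrightarrow> sym_on n P \<and> (\<forall>i<n. \<forall>j<n. (\<Sum>k<n. P i k * P k j) = P i j)"

definition eigproj :: "nat \<Rightarrow> (nat \<Rightarrow> nat \<Rightarrow> real) \<Rightarrow> nat set \<Rightarrow> nat \<Rightarrow> nat \<Rightarrow> real" where
  "eigproj n u J i j = (\<Sum>s\<in>J. u s i * u s j)"

text \<open>A basis-free form of \<open>rank X \<le> r\<close> for matrices given as functions.\<close>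

definition rank_bound :: "nat \<Rightarrow> nat \<Rightarrow> (nat \<Rightarrow> nat \<Rightarrow> real) \<Rightarrow> real \<Rightarrow> bool" where
  "rank_bound n m X r \<longleftrightarrow> (\<forall>(J :: nat set) z. finite J \<longrightarrow>
     (\<forall>c. (\<forall>i<n. (\<Sum>j\<in>J. c j * (\<Sum>l<m. X i l * z j l)) = 0) \<longrightarrow> (\<forall>j\<in>J. c j = 0)) \<longrightarrow>
     real (card J) \<le> r)"

lemma proj_square: "proj n P \<Longrightarrow> i < n \<Longrightarrow> (\<Sum>k<n. (P k i)\<^sup>2) = P i i"
proof -
  assume P: "proj n P" and i: "i < n"
  have "(\<Sum>k<n. (P k i)\<^sup>2) = (\<Sum>k<n. P i k * P k i)"
    using P i by (intro sum.cong) (auto simp: proj_def sym_on_def power2_eq_square)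
  then show ?thesis using P i by (simp add: proj_def)
qed

lemma proj_diag: "proj n P \<Longrightarrow> i < n \<Longrightarrow> 0 \<le> P i i \<and> P i i \<le> 1"
proof -
  assume P: "proj n P" and i: "i < n"
  have nn: "0 \<le> P i i" unfolding proj_square[OF P i, symmetric] by (intro sum_nonneg) auto
  have "(P i i)\<^sup>2 \<le> (\<Sum>k<n. (P k i)\<^sup>2)" using i by (intro member_le_sum) auto
  then have "P i i * P i i \<le> P i i * 1" unfolding proj_square[OF P i] by (simp add: power2_eq_square)
  then have "P i i \<le> 1" using nn by (cases "P i i = 0") (auto simp: mult_le_cancel_left)
  with nn show ?thesis by simp
qed

lemma proj_idem:
  assumes "proj n P" "i < n"
  shows "mv n P (mv n P x) i = mv n P x i"
proof -
  have "mv n P (mv n P x) i = (\<Sum>j<n. (\<Sum>k<n. P i k * P k j) * x j)"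
    unfolding mv_def sum_distrib_left sum_distrib_right by (subst sum.swap) (simp add: mult.assoc)
  also have "\<dots> = mv n P x i" using assms unfolding mv_def by (intro sum.cong) (auto simp: proj_def)
  finally show ?thesis .
qed

lemma proj_contract: "proj n P \<Longrightarrow> ip n (mv n P x) (mv n P x) \<le> ip n x x"
proof -
  assume P: "proj n P"
  have sym: "sym_on n P" using P by (simp add: proj_def)
  have "ip n (mv n P x) (mv n P x) = ip n x (mv n P (mv n P x))"
    by (simp add: ip_mv_sym[OF sym])
  also have "\<dots> = ip n x (mv n P x)" using proj_idem[OF P] by (intro ip_cong) auto
  finally have e: "ip n (mv n P x) (mv n P x) = ip n x (mv n P x)" .
  have "0 \<le> ip n (\<lambda>i. x i - mv n P x i) (\<lambda>i. x i - mv n P x i)" by (rule ip_nonneg)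
  also have "\<dots> = ip n x x - ip n (mv n P x) (mv n P x)"
    by (simp add: ip_diff_left ip_diff_right e ip_commute[of n "mv n P x" x])
  finally show ?thesis by simp
qed

lemma proj_id: "proj n (\<lambda>i j. of_bool (i = j))"
  by (auto simp: proj_def sym_on_def of_bool_def if_distrib[of "\<lambda>z. _ * z"] cong: if_cong)

locale orthobasis =
  fixes n :: nat and u :: "nat \<Rightarrow> nat \<Rightarrow> real"
  assumes on: "\<And>i j. i < n \<Longrightarrow> j < n \<Longrightarrow> ip n (u i) (u j) = (if i = j then 1 else 0)"
begin

lemma proj_eigproj: "J \<subseteq> {..<n} \<Longrightarrow> proj n (eigproj n u J)"
proof -
  assume J: "J \<subseteq> {..<n}"
  then have fin: "finite J" by (rule finite_subset) simp
  have "(\<Sum>k<n. eigproj n u J i k * eigproj n u J k j) = eigproj n u J i j" for i j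
  proof -
    have "(\<Sum>k<n. eigproj n u J i k * eigproj n u J k j)
        = (\<Sum>k<n. \<Sum>s\<in>J. \<Sum>t\<in>J. (u s i * u s k) * (u t k * u t j))"
      unfolding eigproj_def sum_product ..
    also have "\<dots> = (\<Sum>s\<in>J. \<Sum>t\<in>J. \<Sum>k<n. (u s i * u s k) * (u t k * u t j))"
      by (subst sum.swap, rule sum.cong[OF refl], rule sum.swap)
    also have "\<dots> = (\<Sum>s\<in>J. \<Sum>t\<in>J. u s i * u t j * ip n (u s) (u t))"
      by (simp add: ip_def sum_distrib_left mult_ac)
    also have "\<dots> = (\<Sum>s\<in>J. \<Sum>t\<in>J. if s = t then u s i * u t j else 0)"
      using J by (intro sum.cong refl) (auto simp: on subset_iff)
    finally show ?thesis using fin by (simp add: eigproj_def)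
  qed
  then show ?thesis by (auto simp: proj_def sym_on_def eigproj_def mult.commute)
qed

lemma mv_eigproj: "mv n (eigproj n u J) x i = (\<Sum>s\<in>J. ip n (u s) x * u s i)"
  unfolding mv_def eigproj_def ip_def sum_distrib_right by (subst sum.swap) (simp add: mult_ac)

lemma trace_eigproj: "J \<subseteq> {..<n} \<Longrightarrow> (\<Sum>i<n. eigproj n u J i i) = card J"
proof -
  assume J: "J \<subseteq> {..<n}"
  have "(\<Sum>i<n. eigproj n u J i i) = (\<Sum>s\<in>J. ip n (u s) (u s))"
    unfolding eigproj_def ip_def by (rule sum.swap)
  also have "\<dots> = (\<Sum>s\<in>J. 1)" using J by (intro sum.cong) (auto simp: on subset_iff)
  finally show ?thesis by simp
qed

lemma ip_span:
  assumes "J \<subseteq> {..<n}" "s < n"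
  shows "ip n (u s) (\<lambda>i. \<Sum>t\<in>J. c t * u t i) = (if s \<in> J then c s else 0)"
proof -
  have fin: "finite J" using assms(1) by (rule finite_subset) simp
  have "ip n (u s) (\<lambda>i. \<Sum>t\<in>J. c t * u t i) = (\<Sum>t\<in>J. c t * ip n (u s) (u t))"
    by (simp add: ip_sum_right ip_scale_right)
  also have "\<dots> = (\<Sum>t\<in>J. if s = t then c t else 0)"
    using assms by (intro sum.cong refl) (auto simp: on subset_iff)
  finally show ?thesis using fin by simp
qed

lemma residual_sq:
  assumes J: "J \<subseteq> {..<n}"
  shows "(\<Sum>i<n. (x i - mv n (eigproj n u J) x i)\<^sup>2) = (\<Sum>s\<in>{..<n}-J. (ip n (u s) x)\<^sup>2)"
proof -
  define e where "e = (\<lambda>i. x i - mv n (eigproj n u J) x i)"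
  have "ip n (u s) e = (if s \<in> J then 0 else ip n (u s) x)" if "s < n" for s
    unfolding e_def ip_diff_right mv_eigproj using ip_span[OF J that, of "\<lambda>s. ip n (u s) x"] by simp
  then have "ip n e e = (\<Sum>s<n. if s \<in> J then 0 else (ip n (u s) x)\<^sup>2)"
    by (subst parseval[of n u, OF on]) (auto intro!: sum.cong simp: power2_eq_square)
  also have "\<dots> = (\<Sum>s\<in>{..<n}-J. (ip n (u s) x)\<^sup>2)"
    by (simp add: sum.If_cases Diff_eq)
  finally show ?thesis by (simp add: ip_def e_def power2_eq_square)
qed

end

text \<open>A matrix and its transpose have the same norm: \<open>|X^t y|^2\<close> is the inner
  product of \<open>y\<close> with \<open>X X^t y\<close>, and after Cauchy-Schwarz one factor
  cancels.\<close>

lemma transpose_bound: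
  assumes "\<And>x. ip n (\<lambda>i. \<Sum>l<m. X i l * x l) (\<lambda>i. \<Sum>l<m. X i l * x l) \<le> K * ip m x x"
    and "0 \<le> K"
  shows "(\<Sum>l<m. (\<Sum>i<n. X i l * y i)\<^sup>2) \<le> K * ip n y y"
proof -
  define x where "x = (\<lambda>l. \<Sum>i<n. X i l * y i)"
  define z where "z = (\<lambda>i. \<Sum>l<m. X i l * x l)"
  have xx: "ip m x x = ip n z y"
  proof -
    have "ip m x x = (\<Sum>l<m. \<Sum>i<n. x l * (X i l * y i))"
      unfolding ip_def by (simp add: x_def sum_distrib_left)
    also have "\<dots> = (\<Sum>i<n. \<Sum>l<m. x l * (X i l * y i))" by (rule sum.swap)
    finally show ?thesis unfolding ip_def z_def sum_distrib_right by (simp add: mult_ac)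
  qed
  have "(ip m x x)\<^sup>2 \<le> ip n z z * ip n y y" unfolding xx by (rule ip_Cauchy_Schwarz)
  also have "\<dots> \<le> (K * ip m x x) * ip n y y"
    using assms(1)[of x] by (intro mult_right_mono ip_nonneg) (simp add: z_def)
  finally have *: "ip m x x * ip m x x \<le> ip m x x * (K * ip n y y)" by (simp add: power2_eq_square mult_ac)
  show ?thesis
  proof (cases "ip m x x = 0")
    case False
    then have "0 < ip m x x" using ip_nonneg[of m x] by linarith
    with * have "ip m x x \<le> K * ip n y y" by simp
    then show ?thesis by (simp add: ip_def x_def power2_eq_square)
  next
    case True
    have "0 \<le> K * ip n y y" using \<open>0 \<le> K\<close> ip_nonneg by (rule mult_nonneg_nonneg)
    then show ?thesis using True by (simp add: ip_def x_def power2_eq_square)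
  qed
qed

text \<open>The perturbation step needs only the closeness of the quadratic forms of
  \<open>B\<close> and \<open>X X^t\<close> and a cut \<open>c\<close> above the error
  \<open>dev\<close>. The eigenbasis of \<open>B\<close> is fixed, so the spectral projection is a
  sum over \<open>Top\<close>.\<close>

locale gram_approx = orthobasis n u for n :: nat and u :: "nat \<Rightarrow> nat \<Rightarrow> real" +
  fixes m :: nat and X B :: "nat \<Rightarrow> nat \<Rightarrow> real" and a :: "nat \<Rightarrow> real" and dev c r :: real
  assumes ev: "\<And>i j. i < n \<Longrightarrow> j < n \<Longrightarrow> mv n B (u i) j = a i * u i j"
    and dev: "\<And>y. \<bar>ip n y (mv n B y) - (\<Sum>l<m. (\<Sum>i<n. X i l * y i)\<^sup>2)\<bar> \<le> dev * ip n y y"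
    and rank: "rank_bound n m X r"
    and dev_less: "0 \<le> dev" "dev < c"
begin

definition "Top = {s. s < n \<and> c \<le> a s}"

lemma Top_subset: "Top \<subseteq> {..<n}" and finite_Top: "finite Top"
  by (auto simp: Top_def)

lemma quadratic_B: "ip n y (mv n B y) = (\<Sum>s<n. a s * (ip n (u s) y)\<^sup>2)"
proof -
  have "eigenbasis n B u a" using on ev by (simp add: eigenbasis_def)
  from eigen_quadratic_form[OF this, of y y] show ?thesis by (simp add: power2_eq_square mult.assoc)
qed

lemma parseval_sq: "ip n y y = (\<Sum>s<n. (ip n (u s) y)\<^sup>2)"
  using parseval[of n u y y, OF on] by (simp add: power2_eq_square)

text \<open>The vectors \<open>X X^t u_s\<close> with \<open>s\<close> in \<open>Top\<close> are
  independent in the column space of \<open>X\<close>. A vanishing combination gives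
  \<open>X^t y = 0\<close> for the corresponding \<open>y\<close>, so
  \<open>c |y|^2 \<le> dev |y|^2\<close>; since \<open>dev < c\<close>, this forces
  \<open>y = 0\<close>.\<close>

lemma card_top_le: "real (card Top) \<le> r"
proof -
  define z where "z s l = (\<Sum>i<n. X i l * u s i)" for s l
  have "\<forall>j\<in>Top. e j = 0" if e: "\<forall>i<n. (\<Sum>j\<in>Top. e j * (\<Sum>l<m. X i l * z j l)) = 0" for e
  proof -
    define y where "y i = (\<Sum>t\<in>Top. e t * u t i)" for i
    have uy: "ip n (u s) y = (if s \<in> Top then e s else 0)" if "s < n" for s
      unfolding y_def using ip_span[OF Top_subset that, of e] .
    have yy: "ip n y y = (\<Sum>s\<in>Top. (e s)\<^sup>2)"
    proof -
      have "ip n y y = (\<Sum>s<n. if s \<in> Top then (e s)\<^sup>2 else 0)"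
        unfolding parseval_sq by (intro sum.cong) (auto simp: uy)
      also have "\<dots> = (\<Sum>s\<in>{..<n} \<inter> Top. (e s)\<^sup>2)" by (simp add: sum.inter_restrict)
      finally show ?thesis using Top_subset by (simp add: Int_absorb1)
    qed
    have zy: "(\<Sum>t\<in>Top. e t * z t l) = (\<Sum>i<n. X i l * y i)" for l
      unfolding z_def y_def sum_distrib_left by (subst sum.swap) (simp add: mult_ac)
    have "(\<Sum>l<m. (\<Sum>i<n. X i l * y i)\<^sup>2) = (\<Sum>l<m. (\<Sum>i<n. X i l * y i) * (\<Sum>t\<in>Top. e t * z t l))"
      by (simp add: zy power2_eq_square)
    also have "\<dots> = (\<Sum>i<n. y i * (\<Sum>j\<in>Top. e j * (\<Sum>l<m. X i l * z j l)))"
    proof -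
      have "(\<Sum>l<m. (\<Sum>i<n. X i l * y i) * (\<Sum>t\<in>Top. e t * z t l))
          = (\<Sum>l<m. \<Sum>i<n. y i * (X i l * (\<Sum>t\<in>Top. e t * z t l)))"
        unfolding sum_distrib_right by (simp add: mult_ac)
      also have "\<dots> = (\<Sum>i<n. y i * (\<Sum>l<m. X i l * (\<Sum>t\<in>Top. e t * z t l)))"
        unfolding sum_distrib_left by (rule sum.swap)
      also have "\<dots> = (\<Sum>i<n. y i * (\<Sum>j\<in>Top. e j * (\<Sum>l<m. X i l * z j l)))"
      proof (rule sum.cong[OF refl], rule arg_cong2[of _ _ _ _ "(*)"], rule refl)
        fix i
        show "(\<Sum>l<m. X i l * (\<Sum>t\<in>Top. e t * z t l)) = (\<Sum>j\<in>Top. e j * (\<Sum>l<m. X i l * z j l))"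
          unfolding sum_distrib_left by (subst sum.swap) (simp add: mult_ac)
      qed
      finally show ?thesis .
    qed
    also have "\<dots> = 0" using e by simp
    finally have 0: "(\<Sum>l<m. (\<Sum>i<n. X i l * y i)\<^sup>2) = 0" .
    have "c * ip n y y = (\<Sum>s\<in>Top. c * (e s)\<^sup>2)" by (simp add: yy sum_distrib_left)
    also have "\<dots> \<le> (\<Sum>s\<in>Top. a s * (e s)\<^sup>2)" by (intro sum_mono mult_right_mono) (auto simp: Top_def)
    also have "\<dots> = (\<Sum>s\<in>{..<n} \<inter> Top. a s * (e s)\<^sup>2)" using Top_subset by (simp add: Int_absorb1)
    also have "\<dots> = (\<Sum>s<n. if s \<in> Top then a s * (e s)\<^sup>2 else 0)" by (simp add: sum.inter_restrict)
    also have "\<dots> = ip n y (mv n B y)"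
      unfolding quadratic_B by (intro sum.cong) (auto simp: uy)
    also have "\<dots> \<le> dev * ip n y y" using dev[of y] unfolding 0 by linarith
    finally have "ip n y y = 0" using dev_less ip_nonneg[of n y]
      by (metis mult_right_le_imp_le leD le_less)
    then show ?thesis unfolding yy using finite_Top by (subst (asm) sum_nonneg_eq_0_iff) auto
  qed
  with rank finite_Top show ?thesis unfolding rank_bound_def by blast
qed

text \<open>Only \<open>r\<close> right singular directions of \<open>X\<close> contribute, and each of them contributes at most
  \<open>c + dev\<close>.\<close>

lemma residual_le:
  assumes "0 \<le> r"
  shows "(\<Sum>l<m. \<Sum>i<n. (X i l - mv n (eigproj n u Top) (\<lambda>k. X k l) i)\<^sup>2) \<le> r * (c + dev)"
proof -
  \<comment> \<open>An eigenbasis of \<open>X^t X\<close> supplies the right singular directions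
    \<open>v s\<close>. Their images \<open>g s\<close> are orthogonal, so the rank bounds the
    number of nonzero ones.\<close>
  define C where "C l k = (\<Sum>i<n. X i l * X i k)" for l k
  have symC: "sym_on m C" by (simp add: sym_on_def C_def mult.commute)
  then obtain v \<sigma> where eb: "eigenbasis m C v \<sigma>" by (rule spectral_theorem)
  note vo = eigenbasisD(1)[OF eb]
  define g where "g s i = (\<Sum>l<m. X i l * v s l)" for s i
  have gg: "ip n (g s) (g t) = \<sigma> t * ip m (v s) (v t)" if "t < m" for s t
  proof -
    have "ip n (g s) (g t) = (\<Sum>i<n. \<Sum>l<m. \<Sum>k<m. (X i l * v s l) * (X i k * v t k))"
      unfolding ip_def g_def sum_product ..
    also have "\<dots> = (\<Sum>l<m. \<Sum>k<m. \<Sum>i<n. (X i l * v s l) * (X i k * v t k))"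
      by (subst sum.swap, rule sum.cong[OF refl], rule sum.swap)
    also have "\<dots> = ip m (v s) (mv m C (v t))"
      unfolding ip_def mv_def C_def sum_distrib_left sum_distrib_right by (simp add: mult_ac)
    also have "\<dots> = ip m (v s) (\<lambda>k. \<sigma> t * v t k)"
      using eigenbasisD(2)[OF eb that] by (intro ip_cong) auto
    finally show ?thesis by (simp add: ip_scale_right)
  qed
  define J where "J = {s. s < m \<and> ip n (g s) (g s) \<noteq> 0}"
  have "finite J" by (simp add: J_def)
  have "real (card J) \<le> r"
  proof -
    have "\<forall>j\<in>J. e j = 0" if e: "\<forall>i<n. (\<Sum>j\<in>J. e j * (\<Sum>l<m. X i l * v j l)) = 0" for e
    proof
      fix t assume t: "t \<in> J"
      have "0 = ip n (\<lambda>i. \<Sum>j\<in>J. e j * g j i) (g t)"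
        unfolding ip_def g_def using e by simp
      also have "\<dots> = (\<Sum>j\<in>J. e j * ip n (g j) (g t))" by (simp add: ip_sum_left ip_scale_left)
      also have "\<dots> = (\<Sum>j\<in>J. if t = j then e j * ip n (g j) (g t) else 0)"
        using t by (intro sum.cong refl) (auto simp: J_def gg vo)
      also have "\<dots> = e t * ip n (g t) (g t)" using t \<open>finite J\<close> by simp
      finally show "e t = 0" using t by (simp add: J_def)
    qed
    with rank \<open>finite J\<close> show ?thesis unfolding rank_bound_def by blast
  qed
  define H where "H = {..<n} - Top"
  have "finite H" by (simp add: H_def)
  have le: "(\<Sum>j\<in>H. (ip n (u j) (g s))\<^sup>2) \<le> (if s \<in> J then c + dev else 0)" if s: "s < m" for s
  proof (cases "s \<in> J")
    case False
    then have "ip n (g s) (g s) = 0" using s by (simp add: J_def)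
    then have "g s i = 0" if "i < n" for i using ip_eq_0D that by blast
    then have "ip n (u j) (g s) = 0" for j by (simp add: ip_def)
    then show ?thesis using False by simp
  next
    case True
    \<comment> \<open>The part of \<open>g s\<close> that the projection loses. Its squared length
      \<open>q\<close> equals the inner product of \<open>X^t y\<close> with the unit vector
      \<open>v s\<close>, so \<open>q^2 \<le> |X^t y|^2 \<le> (c + dev) q\<close>.\<close>
    define y where "y i = (\<Sum>j\<in>H. ip n (u j) (g s) * u j i)" for i
    have Hs: "H \<subseteq> {..<n}" by (auto simp: H_def)
    have uy: "ip n (u j) y = (if j \<in> H then ip n (u j) (g s) else 0)" if "j < n" for j
      unfolding y_def using ip_span[OF Hs that, of "\<lambda>j. ip n (u j) (g s)"] .
    define q where "q = (\<Sum>j\<in>H. (ip n (u j) (g s))\<^sup>2)"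
    have sumH: "(\<Sum>j<n. if j \<in> H then f j else 0) = (\<Sum>j\<in>H. f j)" for f :: "nat \<Rightarrow> real"
      using Hs by (simp add: Int_absorb1 flip: sum.inter_restrict)
    have yy: "ip n y y = q"
      unfolding parseval_sq q_def sumH[symmetric] by (intro sum.cong) (auto simp: uy)
    have yg: "ip n y (g s) = q"
      unfolding y_def q_def by (simp add: ip_sum_left ip_scale_left power2_eq_square)
    have "ip n y (mv n B y) \<le> c * q"
    proof -
      have "ip n y (mv n B y) = (\<Sum>j\<in>H. a j * (ip n (u j) (g s))\<^sup>2)"
        unfolding quadratic_B sumH[symmetric] by (intro sum.cong) (auto simp: uy)
      also have "\<dots> \<le> (\<Sum>j\<in>H. c * (ip n (u j) (g s))\<^sup>2)"
        by (intro sum_mono mult_right_mono) (auto simp: H_def Top_def)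
      finally show ?thesis by (simp add: q_def sum_distrib_left)
    qed
    then have Xy: "(\<Sum>l<m. (\<Sum>i<n. X i l * y i)\<^sup>2) \<le> (c + dev) * q"
      using dev[of y] by (simp add: yy algebra_simps)
    have "q = ip m (\<lambda>l. \<Sum>i<n. X i l * y i) (v s)"
      unfolding yg[symmetric] unfolding ip_def g_def sum_distrib_left sum_distrib_right
      by (subst sum.swap) (simp add: mult_ac)
    then have "q\<^sup>2 \<le> ip m (\<lambda>l. \<Sum>i<n. X i l * y i) (\<lambda>l. \<Sum>i<n. X i l * y i) * ip m (v s) (v s)"
      using ip_Cauchy_Schwarz by metis
    also have "\<dots> = (\<Sum>l<m. (\<Sum>i<n. X i l * y i)\<^sup>2)" using vo[OF s s] by (simp add: ip_def power2_eq_square)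
    also have "\<dots> \<le> (c + dev) * q" by (rule Xy)
    finally have "q * q \<le> (c + dev) * q" by (simp add: power2_eq_square)
    moreover have "0 \<le> q" by (simp add: q_def sum_nonneg)
    ultimately have "q \<le> c + dev" using dev_less by (cases "q = 0") auto
    then show ?thesis using True by (simp add: q_def)
  qed
  have "(\<Sum>l<m. \<Sum>i<n. (X i l - mv n (eigproj n u Top) (\<lambda>k. X k l) i)\<^sup>2)
      = (\<Sum>l<m. \<Sum>j\<in>H. (ip n (u j) (\<lambda>k. X k l))\<^sup>2)"
    unfolding H_def by (intro sum.cong refl residual_sq[OF Top_subset])
  also have "\<dots> = (\<Sum>j\<in>H. ip m (\<lambda>l. ip n (u j) (\<lambda>k. X k l)) (\<lambda>l. ip n (u j) (\<lambda>k. X k l)))"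
    by (subst sum.swap) (simp add: ip_def power2_eq_square)
  also have "\<dots> = (\<Sum>j\<in>H. \<Sum>s<m. (ip n (u j) (g s))\<^sup>2)"
  proof (intro sum.cong refl)
    fix j
    have "ip m (v s) (\<lambda>l. ip n (u j) (\<lambda>k. X k l)) = ip n (u j) (g s)" for s
      unfolding ip_def g_def sum_distrib_left sum_distrib_right by (subst sum.swap) (simp add: mult_ac)
    then show "ip m (\<lambda>l. ip n (u j) (\<lambda>k. X k l)) (\<lambda>l. ip n (u j) (\<lambda>k. X k l)) = (\<Sum>s<m. (ip n (u j) (g s))\<^sup>2)"
      by (subst parseval[of m v, OF vo]) (simp_all add: power2_eq_square)
  qed
  also have "\<dots> = (\<Sum>s<m. \<Sum>j\<in>H. (ip n (u j) (g s))\<^sup>2)" by (rule sum.swap)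
  also have "\<dots> \<le> (\<Sum>s<m. if s \<in> J then c + dev else 0)" by (intro sum_mono le) auto
  also have "\<dots> = real (card J) * (c + dev)"
  proof -
    have "{..<m} \<inter> J = J" by (auto simp: J_def)
    then show ?thesis by (simp flip: sum.inter_restrict)
  qed
  also have "\<dots> \<le> r * (c + dev)" using \<open>real (card J) \<le> r\<close> dev_less by (intro mult_right_mono) auto
  finally show ?thesis .
qed

end

text \<open>The quadratic form of \<open>X X^t\<close> lies between 0 and \<open>K\<close>, so all
  eigenvalues of \<open>B\<close> lie in \<open>[-dev, K + dev]\<close>. With
  \<open>gram_lower\<close> this compares the observed norm of \<open>B\<close>, on which the
  threshold is based, with the norm of \<open>X\<close>.\<close>

lemma gram_upper:
  assumes sym: "sym_on n B" and "0 \<le> dev" "0 \<le> K"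
    and dev: "\<And>y. \<bar>ip n y (mv n B y) - (\<Sum>l<m. (\<Sum>i<n. X i l * y i)\<^sup>2)\<bar> \<le> dev * ip n y y"
    and up: "\<And>y. (\<Sum>l<m. (\<Sum>i<n. X i l * y i)\<^sup>2) \<le> K * ip n y y"
  shows "ip n (mv n B y) (mv n B y) \<le> (K + dev)\<^sup>2 * ip n y y"
proof -
  obtain u a where eb: "eigenbasis n B u a" using spectral_theorem[OF sym] .
  note on = eigenbasisD(1)[OF eb]
  have a: "\<bar>a j\<bar> \<le> K + dev" if j: "j < n" for j
  proof -
    have "ip n (u j) (mv n B (u j)) = a j" by (rule ip_eigenvalue[OF eb j])
    moreover have "0 \<le> (\<Sum>l<m. (\<Sum>i<n. X i l * u j i)\<^sup>2)" by (intro sum_nonneg) auto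
    ultimately show ?thesis using dev[of "u j"] up[of "u j"] on[OF j j] by simp
  qed
  note uB = ip_eigenvector[OF eb]
  have "ip n (mv n B y) (mv n B y) = (\<Sum>j<n. (a j)\<^sup>2 * (ip n (u j) y)\<^sup>2)"
    by (subst parseval[of n u, OF on]) (auto intro!: sum.cong simp: uB power2_eq_square)
  also have "\<dots> \<le> (\<Sum>j<n. (K + dev)\<^sup>2 * (ip n (u j) y)\<^sup>2)"
    using a power_mono[OF a, of _ 2] by (intro sum_mono mult_right_mono) auto
  also have "\<dots> = (K + dev)\<^sup>2 * ip n y y"
    by (subst (2) parseval[of n u, OF on]) (auto simp: power2_eq_square sum_distrib_left)
  finally show ?thesis .
qed

text \<open>At \<open>y = X x\<close> the bound on \<open>B\<close> gives
  \<open>|X^t y|^2 \<le> (b + dev) |y|^2\<close>. As \<open>|y|^2\<close> is the inner product of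
  \<open>x\<close> with \<open>X^t y\<close>, Cauchy-Schwarz and cancellation carry this bound over
  to \<open>X\<close>.\<close>

lemma gram_lower:
  assumes "0 \<le> dev" "0 \<le> b"
    and dev: "\<And>y. \<bar>ip n y (mv n B y) - (\<Sum>l<m. (\<Sum>i<n. X i l * y i)\<^sup>2)\<bar> \<le> dev * ip n y y"
    and Bb: "\<And>y. ip n (mv n B y) (mv n B y) \<le> b\<^sup>2 * ip n y y"
  shows "ip n (\<lambda>i. \<Sum>l<m. X i l * x l) (\<lambda>i. \<Sum>l<m. X i l * x l) \<le> (b + dev) * ip m x x"
proof -
  define y where "y = (\<lambda>i. \<Sum>l<m. X i l * x l)"
  have "(ip n y (mv n B y))\<^sup>2 \<le> ip n y y * ip n (mv n B y) (mv n B y)" by (rule ip_Cauchy_Schwarz)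
  also have "\<dots> \<le> ip n y y * (b\<^sup>2 * ip n y y)" by (intro mult_left_mono Bb ip_nonneg)
  also have "\<dots> = (b * ip n y y)\<^sup>2" by (simp add: power2_eq_square mult_ac)
  finally have "ip n y (mv n B y) \<le> b * ip n y y"
    using \<open>0 \<le> b\<close> by (intro power2_le_imp_le[of "ip n y (mv n B y)"]) (auto simp: ip_nonneg)
  then have le: "(\<Sum>l<m. (\<Sum>i<n. X i l * y i)\<^sup>2) \<le> (b + dev) * ip n y y"
    using dev[of y] by (simp add: distrib_right)
  have "ip n y y = (\<Sum>l<m. x l * (\<Sum>i<n. X i l * y i))"
    by (subst (1) y_def) (rule ip_mv_swap[of n m X x y, unfolded mv_def])
  then have "ip n y y = ip m x (\<lambda>l. \<Sum>i<n. X i l * y i)" by (simp add: ip_def)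
  then have "(ip n y y)\<^sup>2 \<le> ip m x x * ip m (\<lambda>l. \<Sum>i<n. X i l * y i) (\<lambda>l. \<Sum>i<n. X i l * y i)"
    using ip_Cauchy_Schwarz by metis
  also have "\<dots> = ip m x x * (\<Sum>l<m. (\<Sum>i<n. X i l * y i)\<^sup>2)" by (simp add: ip_def power2_eq_square)
  also have "\<dots> \<le> ip m x x * ((b + dev) * ip n y y)" by (intro mult_left_mono le ip_nonneg)
  finally have *: "ip n y y * ip n y y \<le> ip n y y * ((b + dev) * ip m x x)"
    by (simp add: power2_eq_square mult_ac)
  have "ip n y y \<le> (b + dev) * ip m x x"
  proof (cases "ip n y y = 0")
    case True
    then show ?thesis using assms(1,2) ip_nonneg[of m x] by simp
  next
    case False
    then have "0 < ip n y y" using ip_nonneg[of n y] by linarith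
    with * show ?thesis by simp
  qed
  then show ?thesis by (simp add: y_def)
qed

section \<open>Residuals of Kronecker products of projections\<close>

lemma sum_flatten:
  fixes f :: "nat \<Rightarrow> real"
  shows "(\<Sum>e<n * g. f e) = (\<Sum>i<n. \<Sum>h<g. f (i * g + h))"
proof -
  have "(\<Sum>h<g. f (i * g + h)) = sum f {i * g..<i * g + g}" for i
    by (rule sum.reindex_bij_witness[of _ "\<lambda>e. e - i * g" "\<lambda>h. i * g + h"]) auto
  then show ?thesis by (simp add: sum.nat_group)
qed

definition kr :: "nat \<Rightarrow> (nat \<Rightarrow> nat \<Rightarrow> real) \<Rightarrow> (nat \<Rightarrow> nat \<Rightarrow> real) \<Rightarrow> nat \<Rightarrow> nat \<Rightarrow> real" where
  "kr g A B e f = A (e div g) (f div g) * B (e mod g) (f mod g)"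

lemma kr_index [simp]:
  "h < g \<Longrightarrow> h' < g \<Longrightarrow> kr g A B (i * g + h) (i' * g + h') = A i i' * B h h'"
  by (simp add: kr_def)

lemma mv_kr:
  assumes "h < g"
  shows "mv (n * g) (kr g A B) x (i * g + h) = mv n A (\<lambda>i'. mv g B (\<lambda>h'. x (i' * g + h')) h) i"
proof -
  have "mv (n * g) (kr g A B) x (i * g + h) = (\<Sum>i'<n. \<Sum>h'<g. A i i' * B h h' * x (i' * g + h'))"
    unfolding mv_def sum_flatten using assms by (intro sum.cong refl) simp
  then show ?thesis by (simp add: mv_def sum_distrib_left mult.assoc)
qed

lemma proj_kr:
  assumes A: "proj n A" and B: "proj g B"
  shows "proj (n * g) (kr g A B)"
proof -
  have dm: "e div g < n" "e mod g < g" if "e < n * g" for e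
    using that by (auto simp: less_mult_imp_div_less) (metis gr_zeroI mod_less_divisor mult_0_right not_less_zero)
  have "(\<Sum>k<n * g. kr g A B e k * kr g A B k f) = kr g A B e f" if "e < n * g" "f < n * g" for e f
  proof -
    have "(\<Sum>k<n * g. kr g A B e k * kr g A B k f)
        = (\<Sum>i<n. \<Sum>h<g. (A (e div g) i * A i (f div g)) * (B (e mod g) h * B h (f mod g)))"
      unfolding sum_flatten by (intro sum.cong refl) (simp add: kr_def)
    also have "\<dots> = (\<Sum>i<n. A (e div g) i * A i (f div g)) * (\<Sum>h<g. B (e mod g) h * B h (f mod g))"
      by (simp add: sum_product)
    also have "\<dots> = kr g A B e f" using A B dm that by (simp add: kr_def proj_def)
    finally show ?thesis .
  qed
  moreover have "sym_on (n * g) (kr g A B)"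
    using A B dm by (auto simp: sym_on_def kr_def proj_def)
  ultimately show ?thesis by (simp add: proj_def)
qed

lemma trace_kr: "(\<Sum>e<n * g. kr g A B e e) = (\<Sum>i<n. A i i) * (\<Sum>h<g. B h h)"
  unfolding sum_flatten sum_product by (intro sum.cong refl) simp

definition res :: "nat \<Rightarrow> (nat \<Rightarrow> nat \<Rightarrow> real) \<Rightarrow> (nat \<Rightarrow> real) \<Rightarrow> real" where
  "res n P x = (\<Sum>i<n. (x i - mv n P x i)\<^sup>2)"

text \<open>Pythagoras: \<open>p - A q\<close> splits into \<open>p - A p\<close> and
  \<open>A (p - q)\<close>, which are orthogonal, and \<open>A\<close> is a contraction.\<close>

lemma proj_residual_le:
  assumes A: "proj n A"
  shows "(\<Sum>i<n. (p i - mv n A q i)\<^sup>2) \<le> res n A p + (\<Sum>i<n. (p i - q i)\<^sup>2)"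
proof -
  have sym: "sym_on n A" using A by (simp add: proj_def)
  have AA: "ip n x (mv n A y) = ip n (mv n A x) (mv n A y)" for x y
  proof -
    have "ip n x (mv n A y) = ip n x (mv n A (mv n A y))" using proj_idem[OF A] by (intro ip_cong) auto
    then show ?thesis by (simp add: ip_mv_sym[OF sym])
  qed
  define s where "s x = ip n x x" for x
  have "(\<Sum>i<n. (p i - mv n A q i)\<^sup>2) = s (\<lambda>i. p i - mv n A q i)" by (simp add: s_def ip_def power2_eq_square)
  also have "\<dots> = s p - 2 * ip n (mv n A p) (mv n A q) + s (mv n A q)"
    using AA[of p q] by (simp add: s_def ip_diff_left ip_diff_right ip_commute[of n "mv n A q" p])
  also have "\<dots> = (s p - s (mv n A p)) + ip n (\<lambda>i. mv n A p i - mv n A q i) (\<lambda>i. mv n A p i - mv n A q i)"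
    by (simp add: s_def ip_diff_left ip_diff_right ip_commute[of n "mv n A q" "mv n A p"])
  also have "s p - s (mv n A p) = res n A p"
  proof -
    have "res n A p = ip n (\<lambda>i. p i - mv n A p i) (\<lambda>i. p i - mv n A p i)"
      by (simp add: res_def ip_def power2_eq_square)
    then show ?thesis
      using AA[of p p] by (simp add: s_def ip_diff_left ip_diff_right ip_commute[of n "mv n A p" p])
  qed
  also have "ip n (\<lambda>i. mv n A p i - mv n A q i) (\<lambda>i. mv n A p i - mv n A q i)
      = ip n (mv n A (\<lambda>i. p i - q i)) (mv n A (\<lambda>i. p i - q i))"
  proof -
    have "mv n A (\<lambda>i. p i - q i) = (\<lambda>i. mv n A p i - mv n A q i)"
      by (simp add: mv_def right_diff_distrib sum_subtractf fun_eq_iff)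
    then show ?thesis by simp
  qed
  also have "\<dots> \<le> ip n (\<lambda>i. p i - q i) (\<lambda>i. p i - q i)" by (rule proj_contract[OF A])
  finally show ?thesis by (simp add: ip_def power2_eq_square)
qed

text \<open>The residual of a tensor product splits into the orthogonal pieces
  \<open>(1 - A) \<otimes> 1\<close> and \<open>A \<otimes> (1 - B)\<close>. In the second, the
  contraction \<open>A\<close> may be dropped, so squared residuals add up over the modes.\<close>

lemma res_kr_le:
  assumes "proj n A"
  shows "res (n * g) (kr g A B) x \<le> (\<Sum>h<g. res n A (\<lambda>i. x (i * g + h))) + (\<Sum>i<n. res g B (\<lambda>h. x (i * g + h)))"
proof -
  define y where "y i h = mv g B (\<lambda>h'. x (i * g + h')) h" for i h
  have "res (n * g) (kr g A B) x = (\<Sum>h<g. \<Sum>i<n. (x (i * g + h) - mv n A (\<lambda>i'. y i' h) i)\<^sup>2)"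
    unfolding res_def sum_flatten
    by (subst sum.swap, intro sum.cong refl) (simp add: mv_kr y_def)
  also have "\<dots> \<le> (\<Sum>h<g. res n A (\<lambda>i. x (i * g + h)) + (\<Sum>i<n. (x (i * g + h) - y i h)\<^sup>2))"
    by (intro sum_mono proj_residual_le assms)
  also have "\<dots> = (\<Sum>h<g. res n A (\<lambda>i. x (i * g + h))) + (\<Sum>i<n. \<Sum>h<g. (x (i * g + h) - y i h)\<^sup>2)"
    by (simp add: sum.distrib sum.swap[of _ "{..<n}"])
  finally show ?thesis by (simp add: res_def y_def)
qed

lemma res_id: "res n (\<lambda>i j. of_bool (i = j)) x = 0"
  by (simp add: res_def mv_def of_bool_def if_distrib[of "\<lambda>z. z * _"] cong: if_cong)

text \<open>One form covers all orders. The third factor \<open>R\<close> is either an identity,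
  which has no residual, or a further copy of \<open>Q\<close> for \<open>k = 3\<close>. Symmetry of
  the tensor moves the residual of any mode to the first one, so each of the three modes contributes
  at most \<open>D\<close>.\<close>

lemma res_kr3_le:
  assumes Q: "proj n Q"
    and s12: "\<And>i j h. i < n \<Longrightarrow> j < n \<Longrightarrow> h < g \<Longrightarrow> x (i * (n * g) + (j * g + h)) = x (j * (n * g) + (i * g + h))"
    and R: "R = (\<lambda>i j. of_bool (i = j)) \<or> R = Q \<and> g = n \<and>
      (\<forall>i<n. \<forall>j<n. \<forall>h<n. x (i * (n * g) + (j * g + h)) = x (h * (n * g) + (j * g + i)))"
  shows "res (n * (n * g)) (kr (n * g) Q (kr g Q R)) x \<le> 3 * (\<Sum>l<n * g. res n Q (\<lambda>i. x (i * (n * g) + l)))"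
proof -
  define D where "D = (\<Sum>l<n * g. res n Q (\<lambda>i. x (i * (n * g) + l)))"
  have res_cong: "res n P y = res n P z" if "\<And>i. i < n \<Longrightarrow> y i = z i" for P y z
    unfolding res_def mv_def using that by (intro sum.cong refl) simp
  have D0: "0 \<le> D" by (simp add: D_def res_def sum_nonneg)
  have 2: "(\<Sum>i<n. \<Sum>h<g. res n Q (\<lambda>j. x (i * (n * g) + (j * g + h)))) = D"
    unfolding D_def sum_flatten using s12 by (intro sum.cong refl res_cong) auto
  have 3: "(\<Sum>i<n. \<Sum>j<n. res g R (\<lambda>h. x (i * (n * g) + (j * g + h)))) \<le> D"
    using R
  proof
    assume "R = (\<lambda>i j. of_bool (i = j))"
    then show ?thesis using D0 by (simp add: res_id)
  next
    assume *: "R = Q \<and> g = n \<and>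
      (\<forall>i<n. \<forall>j<n. \<forall>h<n. x (i * (n * g) + (j * g + h)) = x (h * (n * g) + (j * g + i)))"
    then have "(\<Sum>i<n. \<Sum>j<n. res g R (\<lambda>h. x (i * (n * g) + (j * g + h))))
       = (\<Sum>i<n. \<Sum>j<n. res n Q (\<lambda>h. x (h * (n * g) + (j * g + i))))"
      by (intro sum.cong refl) (auto intro!: res_cong)
    also have "\<dots> = (\<Sum>j<n. \<Sum>i<n. res n Q (\<lambda>h. x (h * (n * g) + (j * g + i))))" by (rule sum.swap)
    also have "\<dots> = D" unfolding D_def sum_flatten using * by simp
    finally show ?thesis by simp
  qed
  have "res (n * (n * g)) (kr (n * g) Q (kr g Q R)) x \<le> D + (\<Sum>i<n. res (n * g) (kr g Q R) (\<lambda>l. x (i * (n * g) + l)))"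
    unfolding D_def by (rule res_kr_le[OF Q])
  also have "(\<Sum>i<n. res (n * g) (kr g Q R) (\<lambda>l. x (i * (n * g) + l)))
     \<le> (\<Sum>i<n. (\<Sum>h<g. res n Q (\<lambda>j. x (i * (n * g) + (j * g + h)))) + (\<Sum>j<n. res g R (\<lambda>h. x (i * (n * g) + (j * g + h)))))"
    by (intro sum_mono res_kr_le[OF Q])
  also have "\<dots> \<le> D + D" unfolding sum.distrib 2 using 3 by simp
  finally show ?thesis by (simp add: D_def)
qed

section \<open>Library matrices\<close>

text \<open>The images \<open>A z_j\<close> lie in the column space, whose dimension is the rank.
  \<open>rank_bound\<close> speaks of families and the library of sets, so the family is shown to be
  injective before the two notions of independence are matched.\<close>

lemma rank_bound_mat:
  assumes A: "A \<in> carrier_mat n m"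
  shows "rank_bound n m (\<lambda>i l. A $$ (i, l)) (real (vec_space.rank n (A :: real mat)))"
  unfolding rank_bound_def
proof (intro allI impI)
  fix J :: "nat set" and z
  assume "finite J" and ind: "\<forall>c. (\<forall>i<n. (\<Sum>j\<in>J. c j * (\<Sum>l<m. A $$ (i, l) * z j l)) = 0) \<longrightarrow> (\<forall>j\<in>J. c j = 0)"
  interpret vec_space "TYPE(real)" n .
  define y where "y j = A *\<^sub>v vec m (z j)" for j
  have yi: "y j $ i = (\<Sum>l<m. A $$ (i, l) * z j l)" if "i < n" for i j
    using A that by (simp add: y_def scalar_prod_def atLeast0LessThan)
  have yc: "y j \<in> carrier_vec n" for j using A by (simp add: y_def)
  have inj: "inj_on y J"
  proof (rule inj_onI, rule ccontr)
    fix j j' assume J: "j \<in> J" "j' \<in> J" and eq: "y j = y j'" and ne: "j \<noteq> j'"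
    \<comment> \<open>Two equal members would satisfy the relation with coefficients 1 and
      -1.\<close>
    define c :: "nat \<Rightarrow> real" where "c s = of_bool (s = j) - of_bool (s = j')" for s
    have "(\<Sum>s\<in>J. c s * (\<Sum>l<m. A $$ (i, l) * z s l)) = 0" if "i < n" for i
    proof -
      have "(\<Sum>s\<in>J. c s * (\<Sum>l<m. A $$ (i, l) * z s l)) = (\<Sum>s\<in>J. (if s = j then y s $ i else 0) - (if s = j' then y s $ i else 0))"
        using yi[OF that] by (intro sum.cong) (auto simp: c_def)
      then show ?thesis using J eq \<open>finite J\<close> by (simp add: sum_subtractf)
    qed
    then have "c j = 0" using ind J by blast
    then show False using ne by (simp add: c_def)
  qed
  have li: "lin_indpt (y ` J)"
  proof
    assume "lin_dep (y ` J)"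
    then obtain a v where a: "lincomb a (y ` J) = 0\<^sub>v n" "v \<in> y ` J" "a v \<noteq> 0"
      using finite_lin_dep[of "y ` J"] \<open>finite J\<close> yc by auto
    have "(\<Sum>j\<in>J. a (y j) * (\<Sum>l<m. A $$ (i, l) * z j l)) = 0" if "i < n" for i
    proof -
      have "lincomb a (y ` J) $ i = (\<Sum>v\<in>y ` J. a v * v $ i)"
        using that yc by (intro lincomb_index) auto
      also have "\<dots> = (\<Sum>j\<in>J. a (y j) * y j $ i)" by (simp add: sum.reindex[OF inj])
      finally show ?thesis using a(1) that by (simp add: yi)
    qed
    then have "\<forall>j\<in>J. a (y j) = 0" using ind[rule_format, of "\<lambda>j. a (y j)"] by blast
    with a show False by auto
  qed
  define W where "W = span (set (cols A))"
  have colsV: "set (cols A) \<subseteq> carrier_vec n" using A cols_dim by blast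
  have yW: "y ` J \<subseteq> W"
    using A unfolding W_def col_space_def[symmetric] col_space_eq[OF A] by (auto simp: y_def)
  have vsW: "vectorspace class_ring (vs W)"
    unfolding W_def using colsV span_is_subspace subspace_def subspace_is_vs by simp
  have subW: "submodule class_ring W V" unfolding W_def using colsV span_is_submodule by simp
  interpret w: vectorspace class_ring "vs W" by (rule vsW)
  have "card (y ` J) \<le> w.dim"
  proof (rule w.li_le_dim(2))
    show "w.fin_dim" unfolding W_def using A by (rule fin_dim_span_cols)
    show "y ` J \<subseteq> carrier (vs W)" using yW by simp
    show "w.lin_indpt (y ` J)" using li span_li_not_depend(2)[OF yW subW] by simp
  qed
  then show "real (card J) \<le> real (rank A)"
    by (simp add: card_image[OF inj] rank_def W_def)
qed

lemma mult_mat_vec_index: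
  "A \<in> carrier_mat n m \<Longrightarrow> x \<in> carrier_vec m \<Longrightarrow> i < n \<Longrightarrow> (A *\<^sub>v x) $ i = (\<Sum>l<m. A $$ (i, l) * x $ l)"
  by (simp add: scalar_prod_def atLeast0LessThan)

lemma vec_l2_nrm: "vec_l2 x = nrm (dim_vec x) (\<lambda>i. x $ i)"
  by (simp add: vec_l2_def nrm_def L2_set_def ip_def power2_eq_square)

text \<open>\<open>eigenspace_ge\<close> is spanned by all eigenvectors for eigenvalues at least
  \<open>c\<close>, of which the chosen basis vectors are only some. Orthogonality therefore has to
  be tested against an arbitrary such eigenvector.\<close>

lemma eigenspace_proj:
  assumes B: "B \<in> carrier_mat n n" and eb: "eigenbasis n (\<lambda>i j. B $$ (i, j)) u a"
    and symB: "sym_on n (\<lambda>i j. B $$ (i, j))"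
  shows "is_orth_proj n (eigenspace_ge B c) (mat n n (\<lambda>(i, j). eigproj n u {s. s < n \<and> c \<le> a s} i j))"
    (is "is_orth_proj n ?W ?P")
proof -
  interpret vec_space "TYPE(real)" n .
  define J where "J = {s. s < n \<and> c \<le> a s}"
  have J: "J \<subseteq> {..<n}" "finite J" unfolding J_def by auto
  note on = eigenbasisD(1)[OF eb]
  interpret orthobasis n u by unfold_locales (rule on)
  define S where "S = {v. \<exists>e\<ge>c. eigenvector B v e}"
  have W: "?W = span S" using B by (simp add: eigenspace_ge_def S_def)
  have SV: "S \<subseteq> carrier_vec n" using B by (auto simp: S_def eigenvector_def)
  define U where "U s = vec n (u s)" for s
  have Uc: "U s \<in> carrier_vec n" for s by (simp add: U_def)
  have Us: "U s \<in> S" if s: "s \<in> J" for s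
  proof -
    have sn: "s < n" using s J by auto
    have "B *\<^sub>v U s = a s \<cdot>\<^sub>v U s"
    proof (rule eq_vecI)
      fix i assume "i < dim_vec (a s \<cdot>\<^sub>v U s)"
      then have i: "i < n" by (simp add: U_def)
      have "(B *\<^sub>v U s) $ i = mv n (\<lambda>i j. B $$ (i, j)) (u s) i"
        using mult_mat_vec_index[OF B Uc i, of s] by (simp add: U_def mv_def)
      also have "\<dots> = a s * u s i" by (rule eigenbasisD(2)[OF eb sn i])
      finally show "(B *\<^sub>v U s) $ i = (a s \<cdot>\<^sub>v U s) $ i" using i by (simp add: U_def)
    qed (use B in \<open>simp add: U_def\<close>)
    moreover have "U s \<noteq> 0\<^sub>v n"
    proof
      assume "U s = 0\<^sub>v n"
      then have "u s i = 0" if "i < n" for i using that by (metis U_def index_vec index_zero_vec(1))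
      then have "ip n (u s) (u s) = 0" by (simp add: ip_def)
      then show False using on[OF sn sn] by simp
    qed
    ultimately have "eigenvector B (U s) (a s)" using B Uc by (simp add: eigenvector_def)
    then show ?thesis using s by (auto simp: S_def J_def)
  qed
  have Px: "(?P *\<^sub>v x) $ i = mv n (eigproj n u J) (\<lambda>i. x $ i) i" if "x \<in> carrier_vec n" "i < n" for x i
    using mult_mat_vec_index[of ?P n n x i] that by (simp add: mv_def J_def)
  have inj: "inj_on U J"
  proof (rule inj_onI)
    fix s t assume st: "s \<in> J" "t \<in> J" "U s = U t"
    have "u s i = u t i" if "i < n" for i using st(3) that by (metis U_def index_vec)
    then have eq: "ip n (u s) (u t) = ip n (u s) (u s)" by (intro ip_cong) auto
    have "s < n" "t < n" using st J by auto
    then show "s = t" using on[of s t] on[of s s] eq by (simp split: if_splits)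
  qed
  have PW: "?P *\<^sub>v x \<in> span S" if x: "x \<in> carrier_vec n" for x
  proof -
    define b where "b v = (\<Sum>i<n. v $ i * x $ i)" for v
    have UV: "U ` J \<subseteq> carrier_vec n" using Uc by auto
    have ld: "dim_vec (lincomb b (U ` J)) = n" using J UV by (intro lincomb_dim) auto
    have "?P *\<^sub>v x = lincomb b (U ` J)"
    proof (rule eq_vecI)
      show "dim_vec (?P *\<^sub>v x) = dim_vec (lincomb b (U ` J))"
        using ld by simp
      fix i assume "i < dim_vec (lincomb b (U ` J))"
      then have i: "i < n" using ld by simp
      have "lincomb b (U ` J) $ i = (\<Sum>v\<in>U ` J. b v * v $ i)" by (rule lincomb_index[OF i UV])
      also have "\<dots> = (\<Sum>s\<in>J. b (U s) * U s $ i)" by (simp add: sum.reindex[OF inj])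
      also have "\<dots> = (\<Sum>s\<in>J. ip n (u s) (\<lambda>i. x $ i) * u s i)"
        using i by (intro sum.cong) (auto simp: b_def U_def ip_def)
      finally show "(?P *\<^sub>v x) $ i = lincomb b (U ` J) $ i" using Px[OF x i] by (simp add: mv_eigproj)
    qed
    then show ?thesis unfolding span_def using J Us by (auto intro!: exI[of _ b] exI[of _ "U ` J"])
  qed
  have orth: "(x - ?P *\<^sub>v x) \<bullet> w = 0" if x: "x \<in> carrier_vec n" and w: "w \<in> span S" for x w
  proof -
    obtain b A where A: "w = lincomb b A" "finite A" "A \<subseteq> S" using in_spanE[OF w] by blast
    have AV: "A \<subseteq> carrier_vec n" using A SV by blast
    define y where "y i = x $ i - mv n (eigproj n u J) (\<lambda>i. x $ i) i" for i
    have uy: "ip n (u s) y = (if s \<in> J then 0 else ip n (u s) (\<lambda>i. x $ i))" if "s < n" for s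
      unfolding y_def ip_diff_right mv_eigproj using ip_span[OF J(1) that, of "\<lambda>s. ip n (u s) (\<lambda>i. x $ i)"] by simp
    have zero: "ip n y (\<lambda>i. v $ i) = 0" if v: "v \<in> A" for v
    proof -
      obtain e where e: "c \<le> e" "eigenvector B v e" using v A by (auto simp: S_def)
      have vc: "v \<in> carrier_vec n" and Bv: "B *\<^sub>v v = e \<cdot>\<^sub>v v" using e B by (auto simp: eigenvector_def)
      have mvv: "mv n (\<lambda>i j. B $$ (i, j)) (\<lambda>i. v $ i) i = e * v $ i" if "i < n" for i
        using mult_mat_vec_index[OF B vc that] Bv vc that by (simp add: mv_def)
      \<comment> \<open>Eigenvectors of a symmetric matrix for different eigenvalues are orthogonal;
        here \<open>a s < c \<le> e\<close>.\<close>
      have uv: "ip n (u s) (\<lambda>i. v $ i) = 0" if s: "s < n" "s \<notin> J" for s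
      proof -
        have "a s * ip n (u s) (\<lambda>i. v $ i) = ip n (mv n (\<lambda>i j. B $$ (i, j)) (u s)) (\<lambda>i. v $ i)"
          unfolding ip_scale_left[symmetric] using eigenbasisD(2)[OF eb s(1)] by (intro ip_cong) auto
        also have "\<dots> = ip n (u s) (mv n (\<lambda>i j. B $$ (i, j)) (\<lambda>i. v $ i))" by (rule ip_mv_sym[OF symB])
        also have "\<dots> = e * ip n (u s) (\<lambda>i. v $ i)"
          unfolding ip_scale_right[symmetric] using mvv by (intro ip_cong) auto
        finally have "(a s - e) * ip n (u s) (\<lambda>i. v $ i) = 0" by (simp add: left_diff_distrib)
        moreover have "a s - e \<noteq> 0" using s e by (auto simp: J_def)
        ultimately show ?thesis by simp
      qed
      have "ip n y (\<lambda>i. v $ i) = (\<Sum>s<n. ip n (u s) y * ip n (u s) (\<lambda>i. v $ i))" by (rule parseval[OF on])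
      also have "\<dots> = 0" using uy uv by (intro sum.neutral) auto
      finally show ?thesis .
    qed
    have "(x - ?P *\<^sub>v x) \<bullet> w = ip n y (\<lambda>i. w $ i)"
      unfolding scalar_prod_def ip_def
      using lincomb_dim[OF A(2) AV] A(1) x Px[OF x]
      by (intro sum.cong) (auto simp: y_def atLeast0LessThan)
    also have "\<dots> = ip n y (\<lambda>i. \<Sum>v\<in>A. b v * v $ i)"
      unfolding A(1) using lincomb_index[OF _ AV] by (intro ip_cong) auto
    also have "\<dots> = 0" using zero by (simp add: ip_sum_right ip_scale_right)
    finally show ?thesis .
  qed
  show ?thesis unfolding is_orth_proj_def W using PW orth by auto
qed

text \<open>Both images of \<open>x\<close> lie in \<open>W\<close>, so their difference is
  orthogonal to each of them and hence to itself. This makes the description in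
  \<open>spectral_proj\<close> definite.\<close>

lemma is_orth_proj_unique:
  assumes P: "is_orth_proj n W P" and Q: "is_orth_proj n W Q"
  shows "P = Q"
proof -
  have Pc: "P \<in> carrier_mat n n" and Qc: "Q \<in> carrier_mat n n" using assms by (auto simp: is_orth_proj_def)
  have eq: "P *\<^sub>v x = Q *\<^sub>v x" if x: "x \<in> carrier_vec n" for x
  proof -
    define p where "p = P *\<^sub>v x"
    define q where "q = Q *\<^sub>v x"
    have pc: "p \<in> carrier_vec n" and qc: "q \<in> carrier_vec n" using Pc Qc x by (auto simp: p_def q_def)
    have orth: "(x - p) \<bullet> w = 0" "(x - q) \<bullet> w = 0" if "w \<in> W" for w
      using P Q x that by (auto simp: is_orth_proj_def p_def q_def)
    have W: "p \<in> W" "q \<in> W" using P Q x by (auto simp: is_orth_proj_def p_def q_def)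
    have d: "ip n (\<lambda>i. p $ i - q $ i) (\<lambda>i. w $ i) = 0" if "w \<in> W" "w \<in> carrier_vec n" for w
    proof -
      have "ip n (\<lambda>i. x $ i - p $ i) (\<lambda>i. w $ i) = 0" "ip n (\<lambda>i. x $ i - q $ i) (\<lambda>i. w $ i) = 0"
        using orth[OF that(1)] that(2) pc qc x by (auto simp: scalar_prod_def ip_def atLeast0LessThan)
      then show ?thesis by (simp add: ip_diff_left)
    qed
    have "ip n (\<lambda>i. p $ i - q $ i) (\<lambda>i. p $ i - q $ i) = 0"
      using d[OF W(1) pc] d[OF W(2) qc] by (simp add: ip_diff_right)
    then have "p $ i = q $ i" if "i < n" for i using ip_eq_0D[of n _ i] that by fastforce
    then show ?thesis using pc qc unfolding p_def[symmetric] q_def[symmetric] by (intro eq_vecI) auto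
  qed
  show ?thesis
  proof (rule eq_matI)
    fix i j assume ij: "i < dim_row Q" "j < dim_col Q"
    then have "j < n" "i < n" using Qc by auto
    then have "P *\<^sub>v unit_vec n j = Q *\<^sub>v unit_vec n j" by (intro eq) auto
    then have "(P *\<^sub>v unit_vec n j) $ i = (Q *\<^sub>v unit_vec n j) $ i" by simp
    then show "P $$ (i, j) = Q $$ (i, j)"
      using mult_mat_vec_index[OF Pc, of "unit_vec n j" i] mult_mat_vec_index[OF Qc, of "unit_vec n j" i] \<open>i < n\<close> \<open>j < n\<close>
      by (simp add: if_distrib[of "\<lambda>z. _ * z"] cong: if_cong)
  qed (use Pc Qc in auto)
qed

theorem spectral_proj_eq:
  assumes B: "B \<in> carrier_mat n n" and eb: "eigenbasis n (\<lambda>i j. B $$ (i, j)) u a"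
    and symB: "sym_on n (\<lambda>i j. B $$ (i, j))"
  shows "spectral_proj B c = mat n n (\<lambda>(i, j). eigproj n u {s. s < n \<and> c \<le> a s} i j)"
proof -
  have "dim_row B = n" using B by simp
  then show ?thesis
    unfolding spectral_proj_def
    using eigenspace_proj[OF assms] is_orth_proj_unique by (intro the_equality) auto
qed

text \<open>A supremum of reals is an upper bound only of a bounded set; the Frobenius norm
  \<open>sqrt K\<close> supplies the bound. Scaling to unit length does the rest.\<close>

lemma op_norm_ge:
  assumes A: "A \<in> carrier_mat n m"
  shows "nrm n (\<lambda>i. \<Sum>l<m. A $$ (i, l) * x l) \<le> op_norm A * nrm m x"
proof -
  define K where "K = (\<Sum>i<n. \<Sum>l<m. (A $$ (i, l))\<^sup>2)"
  have l2: "vec_l2 (A *\<^sub>v v) = nrm n (\<lambda>i. \<Sum>l<m. A $$ (i, l) * v $ l)" if "v \<in> carrier_vec m" for v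
  proof -
    have dv: "dim_vec (A *\<^sub>v v) = n" using A by simp
    show ?thesis
      unfolding vec_l2_nrm nrm_def dv
      by (intro arg_cong[of _ _ sqrt] ip_cong mult_mat_vec_index[OF A that])
  qed
  have bound: "nrm n (\<lambda>i. \<Sum>l<m. A $$ (i, l) * y l) \<le> sqrt K * nrm m y" for y
  proof -
    have "ip n (\<lambda>i. \<Sum>l<m. A $$ (i, l) * y l) (\<lambda>i. \<Sum>l<m. A $$ (i, l) * y l) = (\<Sum>i<n. (\<Sum>l<m. A $$ (i, l) * y l)\<^sup>2)"
      by (simp add: ip_def power2_eq_square)
    also have "\<dots> \<le> (\<Sum>i<n. (\<Sum>l<m. (A $$ (i, l))\<^sup>2) * (\<Sum>l<m. (y l)\<^sup>2))"
      by (intro sum_mono Cauchy_Schwarz_ineq_sum)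
    also have "\<dots> = K * ip m y y" by (simp add: K_def ip_def power2_eq_square sum_distrib_right)
    finally show ?thesis unfolding nrm_def by (simp flip: real_sqrt_mult)
  qed
  have K0: "0 \<le> K" by (simp add: K_def sum_nonneg)
  have bdd: "bdd_above {vec_l2 (A *\<^sub>v v) | v. v \<in> carrier_vec (dim_col A) \<and> vec_l2 v \<le> 1}"
  proof (rule bdd_aboveI[of _ "sqrt K"])
    fix y assume "y \<in> {vec_l2 (A *\<^sub>v v) | v. v \<in> carrier_vec (dim_col A) \<and> vec_l2 v \<le> 1}"
    then obtain v where v: "y = vec_l2 (A *\<^sub>v v)" "v \<in> carrier_vec m" "vec_l2 v \<le> 1" using A by auto
    have "y \<le> sqrt K * nrm m (\<lambda>i. v $ i)" using bound v by (simp add: l2)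
    also have "\<dots> \<le> sqrt K * 1" using v K0 by (intro mult_left_mono) (auto simp: vec_l2_nrm)
    finally show "y \<le> sqrt K" by simp
  qed
  have le: "vec_l2 (A *\<^sub>v v) \<le> op_norm A" if "v \<in> carrier_vec m" "vec_l2 v \<le> 1" for v
    unfolding op_norm_def by (rule cSup_upper[OF _ bdd]) (use A that in auto)
  show ?thesis
  proof (cases "nrm m x = 0")
    case True
    have "nrm n (\<lambda>i. \<Sum>l<m. A $$ (i, l) * x l) \<le> 0" using bound[of x] True by simp
    then show ?thesis using True by simp
  next
    case False
    then have pos: "0 < nrm m x" using nrm_nonneg[of m x] by linarith
    define v where "v = vec m (\<lambda>l. (1 / nrm m x) * x l)"
    have vc: "v \<in> carrier_vec m" by (simp add: v_def)
    have "vec_l2 v = nrm m (\<lambda>l. (1 / nrm m x) * x l)"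
      unfolding vec_l2_nrm nrm_def carrier_vecD[OF vc] by (intro arg_cong[of _ _ sqrt] ip_cong) (simp_all add: v_def nrm_def)
    also have "\<dots> = 1" using pos by (simp only: nrm_scale) simp
    finally have "vec_l2 (A *\<^sub>v v) \<le> op_norm A" by (intro le vc) simp
    also have "vec_l2 (A *\<^sub>v v) = nrm n (\<lambda>i. (1 / nrm m x) * (\<Sum>l<m. A $$ (i, l) * x l))"
      unfolding l2[OF vc] by (rule arg_cong[of _ _ "nrm n"]) (simp add: v_def sum_distrib_left mult_ac sum_divide_distrib)
    also have "\<dots> = nrm n (\<lambda>i. \<Sum>l<m. A $$ (i, l) * x l) / nrm m x"
      using pos by (simp only: nrm_scale) simp
    finally show ?thesis using pos by (simp add: divide_le_eq)
  qed
qed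

lemma op_norm_le:
  assumes A: "A \<in> carrier_mat n m" and "0 \<le> C"
    and C: "\<And>x. nrm n (\<lambda>i. \<Sum>l<m. A $$ (i, l) * x l) \<le> C * nrm m x"
  shows "op_norm A \<le> C"
  unfolding op_norm_def
proof (rule cSup_least)
  have "vec_l2 (0\<^sub>v m) = 0" by (simp add: vec_l2_def L2_set_def)
  then show "{vec_l2 (A *\<^sub>v v) | v. v \<in> carrier_vec (dim_col A) \<and> vec_l2 v \<le> 1} \<noteq> {}"
    using A by (auto intro!: exI[of _ "0\<^sub>v m"])
  fix y assume "y \<in> {vec_l2 (A *\<^sub>v v) | v. v \<in> carrier_vec (dim_col A) \<and> vec_l2 v \<le> 1}"
  then obtain v where v: "y = vec_l2 (A *\<^sub>v v)" "v \<in> carrier_vec m" "vec_l2 v \<le> 1" using A by auto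
  have dv: "dim_vec (A *\<^sub>v v) = n" using A by simp
  have "y = nrm n (\<lambda>i. \<Sum>l<m. A $$ (i, l) * v $ l)"
    unfolding v(1) vec_l2_nrm nrm_def dv
    by (intro arg_cong[of _ _ sqrt] ip_cong mult_mat_vec_index[OF A v(2)])
  also have "\<dots> \<le> C * nrm m (\<lambda>l. v $ l)" by (rule C)
  also have "\<dots> \<le> C * 1" using v \<open>0 \<le> C\<close> by (intro mult_left_mono) (auto simp: vec_l2_nrm)
  finally show "y \<le> C" by simp
qed

lemma max_norm_ge:
  assumes A: "A \<in> carrier_mat n m" and "i < n" "l < m"
  shows "\<bar>A $$ (i, l)\<bar> \<le> max_norm A"
proof -
  have "elements_mat A = (\<lambda>(i, l). A $$ (i, l)) ` ({..<dim_row A} \<times> {..<dim_col A})"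
    by (auto simp: elements_mat_def)
  then have "finite (elements_mat A)" by simp
  moreover have "A $$ (i, l) \<in> elements_mat A" using A assms by (auto intro!: elements_matI)
  ultimately show ?thesis unfolding max_norm_def by (intro Max_ge) auto
qed

lemma frob_norm_sq: "A \<in> carrier_mat n m \<Longrightarrow> (frob_norm A)\<^sup>2 = (\<Sum>i<n. \<Sum>l<m. (A $$ (i, l))\<^sup>2)"
  by (auto simp: frob_norm_def L2_set_def sum_nonneg sum.cartesian_product case_prod_unfold)

section \<open>The estimator\<close>

lemma finite_multi_index: "finite (multi_index d n)"
  using bij_betw_finite[OF bij_betw_flat[of d n]] by simp

lemma unflat_multi_index: "e < d ^ n \<Longrightarrow> unflat d n e \<in> multi_index d n"
  and flat_unflat: "e < d ^ n \<Longrightarrow> flat d (unflat d n e) = e"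
proof -
  assume "e < d ^ n"
  then have e: "e \<in> flat d ` multi_index d n" using bij_betw_flat[of d n] by (simp add: bij_betw_def)
  show "unflat d n e \<in> multi_index d n" unfolding unflat_def by (rule inv_into_into[OF e])
  show "flat d (unflat d n e) = e" unfolding unflat_def by (rule f_inv_into_f[OF e])
qed

lemma unflat_flat: "u \<in> multi_index d n \<Longrightarrow> unflat d n (flat d u) = u"
  using bij_betw_flat[of d n] unfolding unflat_def bij_betw_def by (simp add: inv_into_f_f)

lemma flat_less: "u \<in> multi_index d n \<Longrightarrow> flat d u < d ^ n"
  using bij_betw_flat[of d n] unfolding bij_betw_def by auto

lemma multi_index_append:
  "u \<in> multi_index d a \<Longrightarrow> v \<in> multi_index d b \<Longrightarrow> u @ v \<in> multi_index d (a + b)"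
  by (auto simp: multi_index_def)

lemma unflat_append:
  assumes "i < d ^ a" "l < d ^ b"
  shows "unflat d (a + b) (i * d ^ b + l) = unflat d a i @ unflat d b l"
proof -
  have u: "unflat d a i \<in> multi_index d a" "unflat d b l \<in> multi_index d b"
    using assms by (simp_all add: unflat_multi_index)
  have "flat d (unflat d a i @ unflat d b l) = i * d ^ b + l"
    using u assms by (simp add: flat_append flat_unflat) (simp add: multi_index_def)
  then show ?thesis using unflat_flat[OF multi_index_append[OF u]] by simp
qed

text \<open>Comparing multisets allows whole groups of indices to be interchanged without naming the
  permutation.\<close>

lemma symmetric_tensor_mset:
  assumes "symmetric_tensor d k T" "u \<in> multi_index d k" "mset v = mset u"
  shows "T v = T u"
proof -
  obtain p where "p permutes {..<length u}" "permute_list p u = v"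
    using mset_eq_permutation[OF assms(3)] .
  then show ?thesis using assms(1,2) unfolding symmetric_tensor_def multi_index_def by auto
qed

lemma tensor_norm_sq: "(tensor_norm d k S)\<^sup>2 = (\<Sum>f<d ^ k. (S (unflat d k f))\<^sup>2)"
proof -
  have "(tensor_norm d k S)\<^sup>2 = (\<Sum>u\<in>multi_index d k. (S u)\<^sup>2)"
    by (simp add: tensor_norm_def L2_set_def sum_nonneg)
  also have "\<dots> = (\<Sum>u\<in>multi_index d k. (S (unflat d k (flat d u)))\<^sup>2)"
    by (intro sum.cong) (simp_all add: unflat_flat)
  also have "\<dots> = (\<Sum>f<d ^ k. (S (unflat d k f))\<^sup>2)"
    by (rule sum.reindex_bij_betw[OF bij_betw_flat])
  finally show ?thesis .
qed

lemma tensor_norm_nrm: "tensor_norm d k S = nrm (d ^ k) (\<lambda>f. S (unflat d k f))"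
proof -
  have "tensor_norm d k S = sqrt ((tensor_norm d k S)\<^sup>2)" by (simp add: tensor_norm_def)
  then show ?thesis unfolding tensor_norm_sq by (simp add: nrm_def ip_def power2_eq_square)
qed

lemma unfold_carrier: "unfold d a b T \<in> carrier_mat (d ^ a) (d ^ b)"
  and unfold_index: "i < d ^ a \<Longrightarrow> l < d ^ b \<Longrightarrow> unfold d a b T $$ (i, l) = T (unflat d a i @ unflat d b l)"
  by (simp_all add: unfold_def)

lemma frob_unfold: "frob_norm (unfold d a b T) = tensor_norm d (a + b) T"
proof -
  have "(frob_norm (unfold d a b T))\<^sup>2 = (\<Sum>i<d ^ a. \<Sum>l<d ^ b. (T (unflat d (a + b) (i * d ^ b + l)))\<^sup>2)"
    unfolding frob_norm_sq[OF unfold_carrier] by (intro sum.cong refl) (simp add: unfold_index unflat_append)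
  also have "\<dots> = (tensor_norm d (a + b) T)\<^sup>2"
    unfolding tensor_norm_sq power_add sum_flatten ..
  finally show ?thesis
    by (rule power2_eq_imp_eq) (simp_all add: frob_norm_def tensor_norm_def)
qed

lemma gram_estimate_carrier: "Z \<in> carrier_mat n m \<Longrightarrow> gram_estimate \<rho> Z \<in> carrier_mat n n"
  by (rule carrier_matI) (simp_all add: gram_estimate_def diag_part_def offdiag_part_def mat_diag_def)

lemma gram_estimate_index:
  assumes "Z \<in> carrier_mat n m" "i < n" "j < n"
  shows "gram_estimate \<rho> Z $$ (i, j)
    = (if i = j then 1 / \<rho> else 1 / \<rho>\<^sup>2) * (\<Sum>l<m. Z $$ (i, l) * Z $$ (j, l))"
proof -
  have "(Z * transpose_mat Z) $$ (i, j) = (\<Sum>l<m. Z $$ (i, l) * Z $$ (j, l))" if "i < n" "j < n" for i j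
    using assms(1) that by (simp add: scalar_prod_def atLeast0LessThan)
  then show ?thesis
    using assms by (simp add: gram_estimate_def diag_part_def offdiag_part_def mat_diag_def)
qed

lemma kron_carrier: "A \<in> carrier_mat n n \<Longrightarrow> B \<in> carrier_mat g g \<Longrightarrow> kron A B \<in> carrier_mat (n * g) (n * g)"
  by (simp add: kron_def)

lemma kron_index:
  assumes "A \<in> carrier_mat n n" "B \<in> carrier_mat g g" "e < n * g" "f < n * g"
  shows "kron A B $$ (e, f) = kr g (\<lambda>i j. A $$ (i, j)) (\<lambda>i j. B $$ (i, j)) e f"
  using assms by (simp add: kron_def kr_def)

text \<open>A common form for the three cases: with \<open>g = d ^ (k - 2 * (k div 2))\<close>, the
  last factor \<open>R\<close> is \<open>Q\<close> for \<open>k = 3\<close>, where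
  \<open>g = n\<close>; it is the 1 by 1 identity for even \<open>k\<close>, and the identity of
  size \<open>d\<close> for odd \<open>k \<ge> 5\<close>.\<close>

lemma tensor_proj_index:
  assumes Q: "Q \<in> carrier_mat n n" and n: "n = d ^ (k div 2)" and g: "g = d ^ (k - 2 * (k div 2))" and "3 \<le> k" "1 \<le> d"
  defines "R \<equiv> if k = 3 then (\<lambda>i j. Q $$ (i, j)) else (\<lambda>i j. of_bool (i = j))"
  shows "tensor_proj d k Q \<in> carrier_mat (n * (n * g)) (n * (n * g))"
    and "e < n * (n * g) \<Longrightarrow> f < n * (n * g) \<Longrightarrow>
      tensor_proj d k Q $$ (e, f) = kr (n * g) (\<lambda>i j. Q $$ (i, j)) (kr g (\<lambda>i j. Q $$ (i, j)) R) e f"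
proof -
  define Rm :: "real mat" where "Rm = (if k = 3 then Q else 1\<^sub>m g)"
  have g3: "g = n" if "k = 3" using that g n by simp
  have Rc: "Rm \<in> carrier_mat g g" using Q g3 by (simp add: Rm_def)
  have Ri: "Rm $$ (i, j) = R i j" if "i < g" "j < g" for i j using that by (simp add: Rm_def R_def)
  have eq: "tensor_proj d k Q = kron Q (kron Q Rm)"
  proof -
    consider "k = 3" | "k \<noteq> 3" "even k" | "k \<noteq> 3" "odd k" by blast
    then show ?thesis
    proof cases
      case 2
      then have "g = 1" using g by simp
      then have "kron Q Rm = Q" using Q 2 by (auto simp: kron_def Rm_def)
      then show ?thesis using 2 by (simp add: tensor_proj_def)
    next
      case 3
      then have "k - 2 * (k div 2) = 1" by (auto elim!: oddE)
      then show ?thesis using 3 g by (simp add: tensor_proj_def Rm_def)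
    qed (simp add: tensor_proj_def Rm_def)
  qed
  show "tensor_proj d k Q \<in> carrier_mat (n * (n * g)) (n * (n * g))"
    unfolding eq by (intro kron_carrier Q Rc)
  assume ef: "e < n * (n * g)" "f < n * (n * g)"
  have pos: "0 < n * g" using ef by (metis gr0I mult_0_right not_less0)
  then have g0: "0 < g" by simp
  have lt: "e mod (n * g) < n * g" "f mod (n * g) < n * g" using pos by auto
  have "kron Q Rm $$ (e mod (n * g), f mod (n * g)) = kr g (\<lambda>i j. Q $$ (i, j)) R (e mod (n * g)) (f mod (n * g))"
    unfolding kron_index[OF Q Rc lt] using Ri[of "e mod (n * g) mod g" "f mod (n * g) mod g"] g0
    by (simp add: kr_def)
  then show "tensor_proj d k Q $$ (e, f) = kr (n * g) (\<lambda>i j. Q $$ (i, j)) (kr g (\<lambda>i j. Q $$ (i, j)) R) e f"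
    unfolding eq kron_index[OF Q kron_carrier[OF Q Rc] ef] by (simp add: kr_def)
qed

lemma apply_mat_index:
  assumes "A \<in> carrier_mat (d ^ k) (d ^ k)" "e < d ^ k"
  shows "apply_mat d k A Y (unflat d k e) = (\<Sum>f<d ^ k. A $$ (e, f) * Y (unflat d k f))"
  unfolding apply_mat_def flat_unflat[OF assms(2)]
  by (subst mult_mat_vec_index[OF assms(1) _ assms(2)]) auto

lemma restrict_tensor_cong:
  assumes "A \<inter> multi_index d k = B \<inter> multi_index d k" "u \<in> multi_index d k"
  shows "restrict_tensor A T u = restrict_tensor B T u"
  using assms by (auto simp: restrict_tensor_def)

text \<open>The random sets of the theorem contain arbitrary lists outside
  \<open>multi_index d k\<close>; the estimator does not see them, so both masks may be cut down to
  a finite ground set.\<close>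

lemma estimator_cong:
  assumes "k div 2 + (k - k div 2) = k"
    and 1: "A1 \<inter> multi_index d k = B1 \<inter> multi_index d k" and 2: "A2 \<inter> multi_index d k = B2 \<inter> multi_index d k"
  shows "estimator d k \<delta>1 \<delta>2 c A1 A2 T u = estimator d k \<delta>1 \<delta>2 c B1 B2 T u"
proof -
  have "unfold d (k div 2) (k - k div 2) (restrict_tensor A1 T) = unfold d (k div 2) (k - k div 2) (restrict_tensor B1 T)"
    unfolding unfold_def
    using restrict_tensor_cong[OF 1] multi_index_append[OF unflat_multi_index unflat_multi_index, of _ d "k div 2" _ "k - k div 2"]
    by (intro cong_mat) (auto simp: assms(1))
  moreover have "Matrix.vec (d ^ k) (\<lambda>i. restrict_tensor A1 T (unflat d k i) + restrict_tensor A2 T (unflat d k i) / \<delta>2)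
    = Matrix.vec (d ^ k) (\<lambda>i. restrict_tensor B1 T (unflat d k i) + restrict_tensor B2 T (unflat d k i) / \<delta>2)"
    using restrict_tensor_cong[OF 1] restrict_tensor_cong[OF 2] by (intro eq_vecI) (auto simp: unflat_multi_index)
  ultimately show ?thesis by (simp add: estimator_def Let_def apply_mat_def)
qed

text \<open>The event is a finite disjoint union of atoms on which both masks are fixed, and joint
  independence gives each atom the product of its weights. The two families are indexed by a
  disjoint sum, which expresses independence within and between them at once.\<close>

lemma (in prob_space) prob_bernoulli_masks:
  fixes I J :: "'i \<Rightarrow> 'a \<Rightarrow> bool"
  assumes U: "finite U" "U \<noteq> {}" and p: "0 \<le> p" "p \<le> 1" and q: "0 \<le> q" "q \<le> 1"
    and indep: "indep_vars (\<lambda>_. count_space UNIV) (case_sum I J) (U <+> U)"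
    and I: "\<And>u. u \<in> U \<Longrightarrow> distr M (count_space UNIV) (I u) = measure_pmf (bernoulli_pmf p)"
    and J: "\<And>u. u \<in> U \<Longrightarrow> distr M (count_space UNIV) (J u) = measure_pmf (bernoulli_pmf q)"
  shows "prob {s \<in> space M. \<Phi> {u\<in>U. I u s} {u\<in>U. J u s}} = bern p U (\<lambda>A. bern q U (\<lambda>B. of_bool (\<Phi> A B)))"
proof -
  have meas: "X \<in> measurable M (count_space UNIV)" if "X \<in> I ` U \<union> J ` U" for X
  proof -
    have "\<forall>i\<in>U <+> U. case_sum I J i \<in> measurable M (count_space UNIV)"
      using indep by (simp add: indep_vars_def2)
    then show ?thesis using that by force
  qed
  have single: "prob (X -` {b} \<inter> space M) = (if b then r else 1 - r)"
    if X: "X \<in> measurable M (count_space UNIV)" and D: "distr M (count_space UNIV) X = measure_pmf (bernoulli_pmf r)"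
      and r: "0 \<le> r" "r \<le> 1" for X r b
  proof -
    have "prob (X -` {b} \<inter> space M) = measure (distr M (count_space UNIV) X) {b}"
      using X by (simp add: measure_distr)
    also have "\<dots> = pmf (bernoulli_pmf r) b" unfolding D by (simp add: measure_pmf_single)
    finally show ?thesis using r by (cases b) auto
  qed
  define E where "E A B = {s \<in> space M. {u\<in>U. I u s} = A \<and> {u\<in>U. J u s} = B}" for A B
  have E: "E A B \<in> events \<and> prob (E A B) = (p ^ card A * (1 - p) ^ card (U - A)) * (q ^ card B * (1 - q) ^ card (U - B))"
    if AB: "A \<subseteq> U" "B \<subseteq> U" for A B
  proof -
    define S where "S = case_sum (\<lambda>u. {u \<in> A}) (\<lambda>u. {u \<in> B})"
    have eq: "E A B = (\<Inter>i\<in>U <+> U. case_sum I J i -` S i \<inter> space M)"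
    proof (intro equalityI subsetI)
      fix s assume "s \<in> E A B"
      then show "s \<in> (\<Inter>i\<in>U <+> U. case_sum I J i -` S i \<inter> space M)"
        by (auto simp: E_def S_def)
    next
      fix s assume s: "s \<in> (\<Inter>i\<in>U <+> U. case_sum I J i -` S i \<inter> space M)"
      \<comment> \<open>The intersection over an empty index set would be everything; an element of
        \<open>U\<close> places \<open>s\<close> in the sample space.\<close>
      obtain u0 where "u0 \<in> U" using U by blast
      then have "s \<in> space M" using s by blast
      moreover have "I u s = (u \<in> A)" "J u s = (u \<in> B)" if "u \<in> U" for u
        using INT_D[OF s InlI[OF that]] INT_D[OF s InrI[OF that]] by (auto simp: S_def)
      ultimately show "s \<in> E A B" using AB by (auto simp: E_def)
    qed
    have "prob (E A B) = (\<Prod>i\<in>U <+> U. prob (case_sum I J i -` S i \<inter> space M))"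
      unfolding eq using U by (intro indep_varsD_finite[OF indep]) auto
    also have "\<dots> = (\<Prod>u\<in>U. prob (I u -` {u \<in> A} \<inter> space M)) * (\<Prod>u\<in>U. prob (J u -` {u \<in> B} \<inter> space M))"
      unfolding Plus_def using U
      by (subst prod.union_disjoint) (auto simp: prod.reindex S_def)
    also have "(\<Prod>u\<in>U. prob (I u -` {u \<in> A} \<inter> space M)) = (\<Prod>u\<in>U. if u \<in> A then p else 1 - p)"
      using I p meas by (intro prod.cong refl single) auto
    also have "\<dots> = p ^ card A * (1 - p) ^ card (U - A)"
      using AB U by (simp add: prod.If_cases Int_absorb1 Diff_eq)
    also have "(\<Prod>u\<in>U. prob (J u -` {u \<in> B} \<inter> space M)) = (\<Prod>u\<in>U. if u \<in> B then q else 1 - q)"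
      using J q meas by (intro prod.cong refl single) auto
    also have "\<dots> = q ^ card B * (1 - q) ^ card (U - B)"
      using AB U by (simp add: prod.If_cases Int_absorb1 Diff_eq)
    finally have pr: "prob (E A B) = (p ^ card A * (1 - p) ^ card (U - A)) * (q ^ card B * (1 - q) ^ card (U - B))" .
    have "case_sum I J i -` S i \<inter> space M \<in> events" if "i \<in> U <+> U" for i
      using that meas by (intro measurable_sets[of _ M "count_space UNIV"]) (auto simp: Plus_def)
    then have "E A B \<in> events" unfolding eq using U by (intro sets.finite_INT) auto
    with pr show ?thesis by simp
  qed
  define K where "K = {(A, B). A \<subseteq> U \<and> B \<subseteq> U \<and> \<Phi> A B}"
  have KP: "K \<subseteq> Pow U \<times> Pow U" by (auto simp: K_def)
  have finK: "finite K" using KP U by (meson finite_Pow_iff finite_SigmaI finite_subset)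
  have "{s \<in> space M. \<Phi> {u\<in>U. I u s} {u\<in>U. J u s}} = (\<Union>x\<in>K. E (fst x) (snd x))"
    by (auto simp: K_def E_def)
  also have "prob \<dots> = (\<Sum>x\<in>K. prob (E (fst x) (snd x)))"
    using finK E by (intro finite_measure_finite_Union) (auto simp: K_def disjoint_family_on_def E_def)
  also have "\<dots> = (\<Sum>x\<in>K. (p ^ card (fst x) * (1 - p) ^ card (U - fst x)) * (q ^ card (snd x) * (1 - q) ^ card (U - snd x)))"
    using E by (intro sum.cong refl) (auto simp: K_def)
  also have "\<dots> = (\<Sum>x\<in>Pow U \<times> Pow U. (p ^ card (fst x) * (1 - p) ^ card (U - fst x))
      * ((q ^ card (snd x) * (1 - q) ^ card (U - snd x)) * of_bool (\<Phi> (fst x) (snd x))))"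
    using U KP by (intro sum.mono_neutral_cong_left) (auto simp: K_def)
  also have "\<dots> = bern p U (\<lambda>A. bern q U (\<lambda>B. of_bool (\<Phi> A B)))"
    unfolding bern_def sum_distrib_left by (simp add: sum.cartesian_product case_prod_unfold)
  finally show ?thesis .
qed

section \<open>Rates, and the signal and noise parts of the error\<close>

lemma nrm_triangle_diff: "nrm n (\<lambda>i. x i - y i) \<le> nrm n x + nrm n y"
proof (rule power2_le_imp_le)
  have "(nrm n (\<lambda>i. x i - y i))\<^sup>2 = (nrm n x)\<^sup>2 - 2 * ip n x y + (nrm n y)\<^sup>2"
    unfolding nrm_sq by (simp add: ip_diff_left ip_diff_right ip_commute[of n y x])
  also have "\<dots> \<le> (nrm n x)\<^sup>2 + 2 * (nrm n x * nrm n y) + (nrm n y)\<^sup>2"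
    using abs_ip_le[of n x y] by linarith
  also have "\<dots> = (nrm n x + nrm n y)\<^sup>2" by (simp add: power2_eq_square algebra_simps)
  finally show "(nrm n (\<lambda>i. x i - y i))\<^sup>2 \<le> (nrm n x + nrm n y)\<^sup>2" .
qed (simp add: nrm_nonneg)

text \<open>The stated rate is \<open>10 * sqrt \<mu> * \<eta>^(1/3)\<close>, because \<eta> equals
  \<open>8 L^4 sqrt t \<theta> / \<mu>\<close> and the cube root of 8 is 2.\<close>

lemma rate_identity:
  fixes L t \<theta> \<mu> :: real
  assumes "0 < L" "0 < t" "0 < \<theta>" "0 < \<mu>"
  shows "20 * L powr (4/3) * (t * \<mu>) powr (1/6) * \<theta> powr (1/3)
    = 10 * sqrt \<mu> * (8 * L ^ 4 * sqrt t * \<theta> / \<mu>) powr (1/3)"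
proof -
  have 8: "(8::real) powr (1/3) = 2"
    using powr_powr[of 2 3 "1/3 :: real"] by simp
  have L: "(L ^ 4) powr (1/3) = L powr (4/3)"
    using assms powr_powr[of L 4 "1/3"] by (simp add: powr_numeral)
  have t: "sqrt t powr (1/3) = t powr (1/6)"
    using assms powr_powr[of t "1/2" "1/3"] by (simp add: powr_half_sqrt)
  have m: "sqrt \<mu> / \<mu> powr (1/3) = \<mu> powr (1/6)"
    using assms powr_diff[of \<mu> "1/2" "1/3"] by (simp add: powr_half_sqrt)
  have "10 * sqrt \<mu> * (8 * L ^ 4 * sqrt t * \<theta> / \<mu>) powr (1/3)
     = 10 * sqrt \<mu> * (2 * L powr (4/3) * t powr (1/6) * \<theta> powr (1/3) / \<mu> powr (1/3))"
    using assms by (simp add: powr_mult powr_divide 8 L t)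
  also have "\<dots> = 20 * L powr (4/3) * t powr (1/6) * \<theta> powr (1/3) * (sqrt \<mu> / \<mu> powr (1/3))" by simp
  also have "\<dots> = 20 * L powr (4/3) * (t * \<mu>) powr (1/6) * \<theta> powr (1/3)"
    unfolding m using assms by (simp add: powr_mult)
  finally show ?thesis by simp
qed

text \<open>The bound 3/4 is available because its cube 27/64 exceeds 1/4. It matches the factor
  \<open>1 - \<eta> \<ge> 3/4\<close> lost when the norm of \<open>B\<close> replaces that of
  \<open>X X^t\<close>.\<close>

lemma cube_root_quarter:
  fixes \<eta> :: real
  assumes "0 < \<eta>" "\<eta> \<le> 1/4"
  shows "0 < \<eta> powr (1/3)" "\<eta> powr (1/3) < 3/4" "(\<eta> powr (1/3)) ^ 3 = \<eta>" "\<eta> powr (2/3) = (\<eta> powr (1/3))\<^sup>2"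
proof -
  show pos: "0 < \<eta> powr (1/3)" using assms by simp
  show 3: "(\<eta> powr (1/3)) ^ 3 = \<eta>" using assms by (simp add: powr_powr flip: powr_numeral)
  show "\<eta> powr (2/3) = (\<eta> powr (1/3))\<^sup>2" using assms by (simp add: powr_powr flip: powr_numeral)
  show "\<eta> powr (1/3) < 3/4"
  proof (rule ccontr)
    assume "\<not> ?thesis"
    then have "(3/4) ^ 3 \<le> (\<eta> powr (1/3)) ^ 3" by (intro power_mono) auto
    then show False using 3 assms by (simp add: power3_eq_cube)
  qed
qed

lemma rank_bound_mono:
  assumes "rank_bound n m X r" "r \<le> r'"
  shows "rank_bound n m X r'"
  unfolding rank_bound_def
proof (intro allI impI)
  fix J :: "nat set" and z
  assume "finite J" "\<forall>c. (\<forall>i<n. (\<Sum>j\<in>J. c j * (\<Sum>l<m. X i l * z j l)) = 0) \<longrightarrow> (\<forall>j\<in>J. c j = 0)"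
  then have "real (card J) \<le> r" using assms(1) unfolding rank_bound_def by blast
  with assms(2) show "real (card J) \<le> r'" by linarith
qed

text \<open>With \<open>z = \<eta>^(1/3)\<close>, the norm of \<open>B\<close> lies between
  \<open>(1 - \<eta>) \<Lambda>\<close> and \<open>(1 + \<eta>) \<Lambda>\<close>. The lower end
  puts the cut \<open>c = z^2 |B|\<close> above the error \<eta>\<Lambda>; the upper end bounds the
  loss per direction, \<open>c + \<eta>\<Lambda>\<close>, by
  \<open>\<Lambda> z^2 (1 + \<eta> + z) \<le> 2 \<Lambda> z^2\<close>.\<close>

lemma signal_part:
  assumes B: "B \<in> carrier_mat n n" and symB: "sym_on n (\<lambda>i j. B $$ (i, j))"
    and X: "X \<in> carrier_mat n m"
    and \<eta>: "0 < \<eta>" "\<eta> \<le> 1/4" and \<Lambda>: "\<Lambda> = (op_norm X)\<^sup>2" and "0 < op_norm X"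
    and dev: "\<And>y. \<bar>ip n y (mv n (\<lambda>i j. B $$ (i, j)) y) - (\<Sum>l<m. (\<Sum>i<n. X $$ (i, l) * y i)\<^sup>2)\<bar> \<le> \<eta> * \<Lambda> * ip n y y"
    and rk: "real (vec_space.rank n X) \<le> r"
  obtains P where "proj n P" "spectral_proj B (\<eta> powr (2/3) * op_norm B) = mat n n (\<lambda>(i, j). P i j)"
    "(\<Sum>i<n. P i i) \<le> r"
    "(\<Sum>l<m. res n P (\<lambda>i. X $$ (i, l))) \<le> 2 * r * \<Lambda> * (\<eta> powr (1/3))\<^sup>2"
proof -
  define z where "z = \<eta> powr (1/3)"
  have z: "0 < z" "z < 3/4" "z ^ 3 = \<eta>" "\<eta> powr (2/3) = z\<^sup>2"
    using cube_root_quarter[OF \<eta>] by (simp_all add: z_def)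
  define b where "b = op_norm B"
  have L0: "0 < \<Lambda>" using \<open>0 < op_norm X\<close> by (simp add: \<Lambda>)
  define D where "D = \<eta> * \<Lambda>"
  have D0: "0 \<le> D" using \<eta> L0 by (simp add: D_def)
  have Xup: "ip n (\<lambda>i. \<Sum>l<m. X $$ (i, l) * x l) (\<lambda>i. \<Sum>l<m. X $$ (i, l) * x l) \<le> \<Lambda> * ip m x x" for x
    using power_mono[OF op_norm_ge[OF X, of x], of 2] by (simp add: nrm_nonneg nrm_sq power_mult_distrib \<Lambda>)
  have up: "(\<Sum>l<m. (\<Sum>i<n. X $$ (i, l) * y i)\<^sup>2) \<le> \<Lambda> * ip n y y" for y
    by (rule transpose_bound[where X = "\<lambda>i l. X $$ (i, l)", OF Xup]) (use L0 in simp)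
  have dev': "\<bar>ip n y (mv n (\<lambda>i j. B $$ (i, j)) y) - (\<Sum>l<m. (\<Sum>i<n. X $$ (i, l) * y i)\<^sup>2)\<bar> \<le> D * ip n y y" for y
    using dev[of y] by (simp add: D_def)
  have b_up: "b \<le> \<Lambda> + D" unfolding b_def
  proof (rule op_norm_le[OF B])
    fix x
    have "ip n (mv n (\<lambda>i j. B $$ (i, j)) x) (mv n (\<lambda>i j. B $$ (i, j)) x) \<le> (\<Lambda> + D)\<^sup>2 * ip n x x"
      by (rule gram_upper[OF symB D0 _ dev' up]) (use L0 in simp)
    then have "(nrm n (\<lambda>i. \<Sum>l<n. B $$ (i, l) * x l))\<^sup>2 \<le> ((\<Lambda> + D) * nrm n x)\<^sup>2"
      by (simp add: nrm_sq power_mult_distrib mv_def[abs_def])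
    then show "nrm n (\<lambda>i. \<Sum>l<n. B $$ (i, l) * x l) \<le> (\<Lambda> + D) * nrm n x"
      using L0 D0 by (rule_tac power2_le_imp_le) (auto simp: nrm_nonneg)
  qed (use L0 D0 in simp)
  have b0: "0 \<le> b"
  proof (rule ccontr)
    assume "\<not> 0 \<le> b"
    then have neg: "b < 0" by simp
    have "n > 0"
    proof (rule ccontr)
      assume "\<not> 0 < n"
      then have "op_norm X \<le> 0" using X by (intro op_norm_le[of X n m]) (auto simp: nrm_def ip_def)
      then show False using \<open>0 < op_norm X\<close> by simp
    qed
    define e :: "nat \<Rightarrow> real" where "e i = of_bool (i = 0)" for i
    have "ip n e e = 1" using \<open>n > 0\<close> by (simp add: ip_def e_def of_bool_def if_distrib[of "\<lambda>z. z * _"] cong: if_cong)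
    then have "nrm n e = 1" by (simp add: nrm_def)
    then have "0 \<le> b" using op_norm_ge[OF B, of e] nrm_nonneg[of n "\<lambda>i. \<Sum>l<n. B $$ (i, l) * e l"] by (simp add: b_def)
    then show False using neg by simp
  qed
  have b_low: "\<Lambda> \<le> b + D"
  proof -
    have Bb: "ip n (mv n (\<lambda>i j. B $$ (i, j)) y) (mv n (\<lambda>i j. B $$ (i, j)) y) \<le> b\<^sup>2 * ip n y y" for y
      using power_mono[OF op_norm_ge[OF B, of y], of 2]
      by (simp add: nrm_nonneg nrm_sq power_mult_distrib b_def mv_def[abs_def])
    have "op_norm X \<le> sqrt (b + D)"
    proof (rule op_norm_le[OF X])
      fix x
      have "ip n (\<lambda>i. \<Sum>l<m. X $$ (i, l) * x l) (\<lambda>i. \<Sum>l<m. X $$ (i, l) * x l) \<le> (b + D) * ip m x x"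
        by (rule gram_lower[OF D0 b0 dev' Bb])
      then show "nrm n (\<lambda>i. \<Sum>l<m. X $$ (i, l) * x l) \<le> sqrt (b + D) * nrm m x"
        unfolding nrm_def by (simp flip: real_sqrt_mult)
    qed (use b0 D0 in simp)
    then have "(op_norm X)\<^sup>2 \<le> (sqrt (b + D))\<^sup>2" using \<open>0 < op_norm X\<close> by (intro power_mono) auto
    then show ?thesis using b0 D0 by (simp add: \<Lambda>)
  qed
  have zz: "z * z\<^sup>2 = \<eta>" using z(3) by (simp add: power3_eq_cube power2_eq_square mult.assoc)
  define c where "c = z\<^sup>2 * b"
  \<comment> \<open>As \<open>\<eta> = z * z^2\<close>, the claim amounts to
    \<open>z \<Lambda> < b\<close>, which holds since \<open>z < 3/4\<close> and
    \<open>b \<ge> 3/4 \<Lambda>\<close>.\<close>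
  have Dc: "D < c"
  proof -
    have "z * z ^ 2 * \<Lambda> < (3/4) * z ^ 2 * \<Lambda>" using z L0 by (intro mult_strict_right_mono) auto
    also have "\<dots> = z\<^sup>2 * ((3/4) * \<Lambda>)" by simp
    also have "\<dots> \<le> z\<^sup>2 * b"
    proof (intro mult_left_mono)
      have "\<eta> * \<Lambda> \<le> (1/4) * \<Lambda>" using \<eta> L0 by (intro mult_right_mono) auto
      then show "3/4 * \<Lambda> \<le> b" using b_low by (simp add: D_def)
    qed simp
    finally show ?thesis unfolding zz by (simp add: D_def c_def)
  qed
  obtain u a where eb: "eigenbasis n (\<lambda>i j. B $$ (i, j)) u a" using spectral_theorem[OF symB] .
  interpret gram_approx n u m "\<lambda>i l. X $$ (i, l)" "\<lambda>i j. B $$ (i, j)" a D c r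
  proof unfold_locales
    fix i j assume "i < n" "j < n"
    then show "ip n (u i) (u j) = (if i = j then 1 else 0)" "mv n (\<lambda>i j. B $$ (i, j)) (u i) j = a i * u i j"
      by (rule eigenbasisD[OF eb])+
  next
    show "rank_bound n m (\<lambda>i l. X $$ (i, l)) r" by (rule rank_bound_mono[OF rank_bound_mat[OF X] rk])
  qed (rule dev' D0 Dc)+
  have r0: "0 \<le> r" using rk by linarith
  have P: "proj n (eigproj n u Top)" by (rule proj_eigproj[OF Top_subset])
  have S: "spectral_proj B (\<eta> powr (2/3) * op_norm B) = mat n n (\<lambda>(i, j). eigproj n u Top i j)"
    unfolding Top_def z(4) using spectral_proj_eq[OF B eb symB, of c] by (simp only: c_def b_def)
  have T: "(\<Sum>i<n. eigproj n u Top i i) \<le> r" unfolding trace_eigproj[OF Top_subset] by (rule card_top_le)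
  have "(\<Sum>l<m. res n (eigproj n u Top) (\<lambda>i. X $$ (i, l))) \<le> r * (c + D)"
    using residual_le[OF r0] by (simp add: res_def)
  also have "\<dots> \<le> r * (2 * \<Lambda> * z\<^sup>2)"
  proof (intro mult_left_mono r0)
    have "c + D \<le> z\<^sup>2 * (\<Lambda> + D) + D" using b_up by (simp add: c_def mult_left_mono)
    also have "\<dots> = \<Lambda> * z\<^sup>2 * (1 + \<eta> + z)" unfolding D_def zz[symmetric]
      by (simp add: algebra_simps)
    also have "\<dots> \<le> \<Lambda> * z\<^sup>2 * 2" using z \<eta> L0 by (intro mult_left_mono) auto
    finally show "c + D \<le> 2 * \<Lambda> * z\<^sup>2" by simp
  qed
  finally show ?thesis using that[OF P S T] by (simp add: z_def mult_ac)
qed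

text \<open>Each index outside \<open>A\<close> contributes a centered multiple of a column of
  \<open>P\<close>. The squared length of a column of a projection is its diagonal entry, so the
  total variance is governed by \<open>M^2\<close> times the trace of \<open>P\<close>, and no
  column is longer than 1.\<close>

lemma noise_part:
  assumes P: "proj (d ^ k) P" and q: "0 < q" "q \<le> 1" and M: "0 \<le> M" and "0 < W"
    and T: "\<And>u. u \<in> multi_index d k \<Longrightarrow> \<bar>T u\<bar> \<le> M"
    and small: "M \<le> q * sqrt W" and var: "M\<^sup>2 * (\<Sum>f<d ^ k. P f f) \<le> q * W"
  shows "bern q (multi_index d k) (\<lambda>B. of_bool (\<not> nrm (d ^ k) (\<lambda>e. \<Sum>f<d ^ k.
      P e f * (of_bool (unflat d k f \<notin> A) * (of_bool (unflat d k f \<in> B) / q - 1) * T (unflat d k f))) \<le> s * sqrt W))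
    \<le> 2 * exp (1 - s)"
proof -
  define h where "h = 1 / sqrt W"
  define z where "z u e = (if u \<in> A then 0 else T u) * P e (flat d u)" for u e
  have h0: "0 < h" using \<open>0 < W\<close> by (simp add: h_def)
  have zz: "ip (d ^ k) (z u) (z u) \<le> M\<^sup>2 * P (flat d u) (flat d u)" if u: "u \<in> multi_index d k" for u
  proof -
    have f: "flat d u < d ^ k" using u by (rule flat_less)
    have "ip (d ^ k) (z u) (z u) = (if u \<in> A then 0 else T u)\<^sup>2 * (\<Sum>e<d ^ k. (P e (flat d u))\<^sup>2)"
      by (simp add: ip_def z_def sum_distrib_left power2_eq_square mult_ac)
    also have "\<dots> \<le> M\<^sup>2 * (\<Sum>e<d ^ k. (P e (flat d u))\<^sup>2)"
    proof (intro mult_right_mono sum_nonneg)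
      show "(if u \<in> A then 0 else T u)\<^sup>2 \<le> M\<^sup>2" using power_mono[OF T[OF u], of 2] by simp
    qed auto
    finally show ?thesis by (simp add: proj_square[OF P f])
  qed
  have tail: "bern q (multi_index d k) (\<lambda>B. of_bool (\<not> nrm (d ^ k) (\<lambda>e. \<Sum>u\<in>multi_index d k.
      (of_bool (u \<in> B) / q - 1) * z u e) \<le> s * sqrt W)) \<le> 2 * exp (1 - h * (s * sqrt W))"
  proof (rule noise_tail[OF finite_multi_index q h0])
    fix u assume u: "u \<in> multi_index d k"
    have "ip (d ^ k) (z u) (z u) \<le> M\<^sup>2 * 1"
      by (rule order.trans[OF zz[OF u]]) (intro mult_left_mono, use proj_diag[OF P flat_less[OF u]] in auto)
    then have "nrm (d ^ k) (z u) \<le> M" using M unfolding nrm_def by (intro real_le_lsqrt) auto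
    then show "h * nrm (d ^ k) (z u) \<le> q" using small \<open>0 < W\<close> by (simp add: h_def divide_le_eq)
  next
    have "(\<Sum>u\<in>multi_index d k. ip (d ^ k) (z u) (z u)) \<le> (\<Sum>u\<in>multi_index d k. M\<^sup>2 * P (flat d u) (flat d u))"
      by (intro sum_mono zz)
    also have "\<dots> = M\<^sup>2 * (\<Sum>f<d ^ k. P f f)"
      unfolding sum_distrib_left[symmetric] using sum.reindex_bij_betw[OF bij_betw_flat[of d k], of "\<lambda>f. P f f"] by simp
    finally have "(\<Sum>u\<in>multi_index d k. ip (d ^ k) (z u) (z u)) \<le> q * W" using var by linarith
    then show "h\<^sup>2 * (\<Sum>u\<in>multi_index d k. ip (d ^ k) (z u) (z u)) \<le> q"
      using \<open>0 < W\<close> by (simp add: h_def power_divide divide_le_eq)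
  qed
  have hs: "h * (s * sqrt W) = s" using \<open>0 < W\<close> by (simp add: h_def)
  have eq: "(\<lambda>e. \<Sum>u\<in>multi_index d k. (of_bool (u \<in> B) / q - 1) * z u e)
     = (\<lambda>e. \<Sum>f<d ^ k. P e f * (of_bool (unflat d k f \<notin> A) * (of_bool (unflat d k f \<in> B) / q - 1) * T (unflat d k f)))" for B
  proof
    fix e
    have "(\<Sum>u\<in>multi_index d k. (of_bool (u \<in> B) / q - 1) * z u e)
      = (\<Sum>u\<in>multi_index d k. P e (flat d u) * (of_bool (unflat d k (flat d u) \<notin> A)
          * (of_bool (unflat d k (flat d u) \<in> B) / q - 1) * T (unflat d k (flat d u))))"
      by (intro sum.cong refl) (auto simp: unflat_flat z_def)
    also have "\<dots> = (\<Sum>f<d ^ k. P e f * (of_bool (unflat d k f \<notin> A) * (of_bool (unflat d k f \<in> B) / q - 1) * T (unflat d k f)))"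
      by (rule sum.reindex_bij_betw[OF bij_betw_flat])
    finally show "(\<Sum>u\<in>multi_index d k. (of_bool (u \<in> B) / q - 1) * z u e) = \<dots>" .
  qed
  show ?thesis using tail unfolding hs eq .
qed

text \<open>On the first mask \<open>T\<close> is observed exactly. Off it, the rescaled second mask
  has mean \<open>T\<close>, so the data are \<open>T\<close> plus a term that is centered given
  \<open>A\<close>.\<close>

lemma estimator_expand:
  assumes "3 \<le> k" "1 \<le> d" and n: "n = d ^ (k div 2)" and g: "g = d ^ (k - 2 * (k div 2))"
    and Q: "spectral_proj (gram_estimate \<delta>1 (unfold d (k div 2) (k - k div 2) (restrict_tensor A T)))
      (c * op_norm (gram_estimate \<delta>1 (unfold d (k div 2) (k - k div 2) (restrict_tensor A T))))
      = mat n n (\<lambda>(i, j). P i j)"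
    and e: "e < d ^ k"
  defines "R \<equiv> if k = 3 then P else (\<lambda>i j. of_bool (i = j))"
  shows "estimator d k \<delta>1 \<delta>2 c A {v. v \<notin> A \<and> v \<in> B} T (unflat d k e)
    = (\<Sum>f<d ^ k. kr (n * g) P (kr g P R) e f * (T (unflat d k f)
        + of_bool (unflat d k f \<notin> A) * (of_bool (unflat d k f \<in> B) / \<delta>2 - 1) * T (unflat d k f)))"
proof -
  define Qm where "Qm = mat n n (\<lambda>(i, j). P i j)"
  have Qc: "Qm \<in> carrier_mat n n" by (simp add: Qm_def)
  have K: "d ^ k = n * (n * g)"
  proof -
    have "k = k div 2 + (k div 2 + (k - 2 * (k div 2)))" by simp
    then show ?thesis unfolding n g by (metis power_add)
  qed
  have idx: "tensor_proj d k Qm $$ (e, f) = kr (n * g) P (kr g P R) e f" if f: "f < d ^ k" for f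
  proof -
    have pos: "0 < n * g" "0 < n" "0 < g" using \<open>1 \<le> d\<close> by (simp_all add: n g)
    have b: "x div (n * g) < n \<and> x mod (n * g) div g < n \<and> x mod (n * g) mod g < g" if "x < d ^ k" for x
    proof -
      have "x mod (n * g) < n * g" using pos by simp
      then show ?thesis using that pos unfolding K by (simp add: less_mult_imp_div_less)
    qed
    have gn: "g = n" if "k = 3" using that by (simp add: n g)
    show ?thesis
      using tensor_proj_index(2)[OF Qc n g assms(1,2), of e f] e f b[OF e] b[OF f] gn
      unfolding K by (auto simp: kr_def Qm_def R_def)
  qed
  have "estimator d k \<delta>1 \<delta>2 c A {v. v \<notin> A \<and> v \<in> B} T (unflat d k e)
     = (\<Sum>f<d ^ k. tensor_proj d k Qm $$ (e, f) * (restrict_tensor A T (unflat d k f)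
        + restrict_tensor {v. v \<notin> A \<and> v \<in> B} T (unflat d k f) / \<delta>2))"
    unfolding estimator_def Let_def Q Qm_def[symmetric]
    using tensor_proj_index(1)[OF Qc n g assms(1,2)] e by (intro apply_mat_index) (simp_all add: K)
  also have "\<dots> = (\<Sum>f<d ^ k. kr (n * g) P (kr g P R) e f * (T (unflat d k f)
        + of_bool (unflat d k f \<notin> A) * (of_bool (unflat d k f \<in> B) / \<delta>2 - 1) * T (unflat d k f)))"
    using idx by (intro sum.cong refl) (auto simp: restrict_tensor_def algebra_simps)
  finally show ?thesis .
qed

lemma sym_gram_estimate:
  assumes "Z \<in> carrier_mat n m"
  shows "sym_on n (\<lambda>i j. gram_estimate \<rho> Z $$ (i, j))"
  unfolding sym_on_def using gram_estimate_index[OF assms] by (auto simp: mult.commute)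

text \<open>Translation to the locale: the cell \<open>(i, l)\<close> is the concatenated
  multi-index. The scalings agree because an indicator is its own square on the diagonal.\<close>

lemma gram_estimate_Bf:
  assumes mm: "masked_matrix (d ^ a) (d ^ b) X M \<rho>" and ij: "i < d ^ a" "j < d ^ a"
    and X: "\<And>i l. i < d ^ a \<Longrightarrow> l < d ^ b \<Longrightarrow> X i l = T (unflat d a i @ unflat d b l)"
    and A: "\<And>i l. i < d ^ a \<Longrightarrow> l < d ^ b \<Longrightarrow> (i, l) \<in> A \<longleftrightarrow> unflat d a i @ unflat d b l \<in> E"
  shows "gram_estimate \<rho> (unfold d a b (restrict_tensor E T)) $$ (i, j) = masked_matrix.Bf (d ^ a) (d ^ b) X \<rho> A i j"
proof -
  have Z: "unfold d a b (restrict_tensor E T) $$ (i, l) = of_bool ((i, l) \<in> A) * X i l"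
    if "i < d ^ a" "l < d ^ b" for i l
    using that by (simp add: unfold_index restrict_tensor_def X A)
  show ?thesis
    unfolding gram_estimate_index[OF unfold_carrier ij] masked_matrix.Bf_def[OF mm] masked_matrix.w_def[OF mm] sum_distrib_left
    using ij by (intro sum.cong refl) (auto simp: Z power2_eq_square)
qed

lemma multi_index_image:
  "multi_index d (a + b) = (\<lambda>(i, l). unflat d a i @ unflat d b l) ` ({..<d ^ a} \<times> {..<d ^ b})"
  and inj_on_unflat_append: "inj_on (\<lambda>(i, l). unflat d a i @ unflat d b l) ({..<d ^ a} \<times> {..<d ^ b})"
proof -
  show "inj_on (\<lambda>(i, l). unflat d a i @ unflat d b l) ({..<d ^ a} \<times> {..<d ^ b})"
  proof (rule inj_onI, clarsimp)
    fix i l i' l'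
    assume il: "i < d ^ a" "l < d ^ b" "i' < d ^ a" "l' < d ^ b"
      and eq: "unflat d a i @ unflat d b l = unflat d a i' @ unflat d b l'"
    have "length (unflat d a i) = length (unflat d a i')"
      using unflat_multi_index[OF il(1)] unflat_multi_index[OF il(3)] by (simp add: multi_index_def)
    then have "unflat d a i = unflat d a i'" "unflat d b l = unflat d b l'" using eq by auto
    then show "i = i' \<and> l = l'" using il by (metis flat_unflat)
  qed
  show "multi_index d (a + b) = (\<lambda>(i, l). unflat d a i @ unflat d b l) ` ({..<d ^ a} \<times> {..<d ^ b})"
  proof (intro equalityI subsetI)
    fix u assume u: "u \<in> multi_index d (a + b)"
    then have t: "take a u \<in> multi_index d a" "drop a u \<in> multi_index d b"
      by (auto simp: multi_index_def dest: in_set_takeD in_set_dropD)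
    have "u = unflat d a (flat d (take a u)) @ unflat d b (flat d (drop a u))" using t by (simp add: unflat_flat)
    then show "u \<in> (\<lambda>(i, l). unflat d a i @ unflat d b l) ` ({..<d ^ a} \<times> {..<d ^ b})"
      using flat_less[OF t(1)] flat_less[OF t(2)] by force
  next
    fix u assume "u \<in> (\<lambda>(i, l). unflat d a i @ unflat d b l) ` ({..<d ^ a} \<times> {..<d ^ b})"
    then show "u \<in> multi_index d (a + b)"
      using multi_index_append unflat_multi_index by fastforce
  qed
qed

lemma powr_half_power: "1 \<le> d \<Longrightarrow> real d powr (real k / 2) = sqrt (real d ^ k)"
proof -
  assume "1 \<le> d"
  then have "(real d powr real k) powr (1 / 2) = real d powr (real k / 2)" by (simp add: powr_powr)
  moreover have "real d powr real k = real d ^ k" using \<open>1 \<le> d\<close> by (simp add: powr_realpow)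
  ultimately show ?thesis by (simp add: powr_half_sqrt)
qed

text \<open>The origin of \<open>r_max\<close>. The trace of the Kronecker product is \<tau> times
  \<open>\<tau>^2\<close>, \<open>\<tau>\<close> or \<open>\<tau> d\<close> in the three cases, and
  \<open>r_max\<close> is the value for which that second factor stays below
  \<open>d^(k/2)\<close>.\<close>

lemma trace_factor_le:
  fixes \<tau> r :: real
  assumes "1 \<le> d" "3 \<le> k" "0 \<le> \<tau>" "\<tau> \<le> r" "r \<le> r_max d k"
  shows "\<tau> * (\<tau> * (if k = 3 then \<tau> else real (d ^ (k - 2 * (k div 2))))) \<le> r * sqrt (real d ^ k)"
proof -
  have r0: "0 \<le> r" using assms by linarith
  have key: "\<tau> * (if k = 3 then \<tau> else real (d ^ (k - 2 * (k div 2)))) \<le> real d powr (real k / 2)"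
  proof -
    consider "k = 3" | "k \<noteq> 3" "even k" | "k \<noteq> 3" "odd k" by blast
    then show ?thesis
    proof cases
      case 1
      then have "\<tau> \<le> real d powr (3 / 4)" using assms by (simp add: r_max_def)
      then have "\<tau> * \<tau> \<le> real d powr (3 / 4) * real d powr (3 / 4)" using assms by (intro mult_mono) auto
      also have "\<dots> = real d powr (3 / 2)" by (simp flip: powr_add)
      finally show ?thesis using 1 by simp
    next
      case 2
      then show ?thesis using assms by (simp add: r_max_def)
    next
      case 3
      then have k: "k - 2 * (k div 2) = 1" by (auto elim!: oddE)
      have "\<tau> * real d \<le> real d powr (real k / 2 - 1) * real d"
        using assms 3 by (intro mult_right_mono) (auto simp: r_max_def)
      also have "\<dots> = real d powr (real k / 2 - 1) * real d powr 1" using assms by simp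
      also have "\<dots> = real d powr (real k / 2)" unfolding powr_add[symmetric] by simp
      finally show ?thesis using 3 k by simp
    qed
  qed
  have "\<tau> * (\<tau> * (if k = 3 then \<tau> else real (d ^ (k - 2 * (k div 2))))) \<le> r * real d powr (real k / 2)"
    using assms key r0 by (intro mult_mono) auto
  then show ?thesis using powr_half_power[OF assms(1)] by simp
qed

lemma prob_mask_mono:
  assumes p: "0 \<le> p" "p \<le> 1" and q: "0 \<le> q" "q \<le> 1" and "finite U"
    and good: "bern p U (\<lambda>A. of_bool (\<not> good A)) \<le> \<epsilon>1"
    and ok: "\<And>A. A \<subseteq> U \<Longrightarrow> good A \<Longrightarrow> bern q U (\<lambda>B. of_bool (\<not> \<Phi> A B)) \<le> \<epsilon>2" and "0 \<le> \<epsilon>2"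
  shows "1 - \<epsilon>1 - \<epsilon>2 \<le> bern p U (\<lambda>A. bern q U (\<lambda>B. of_bool (\<Phi> A B)))"
proof -
  have "bern p U (\<lambda>A. (1 - of_bool (\<not> good A)) - \<epsilon>2) \<le> bern p U (\<lambda>A. bern q U (\<lambda>B. of_bool (\<Phi> A B)))"
  proof (intro bern_mono p)
    fix A assume A: "A \<subseteq> U"
    show "(1 - of_bool (\<not> good A)) - \<epsilon>2 \<le> bern q U (\<lambda>B. of_bool (\<Phi> A B))"
    proof (cases "good A")
      case False
      have "0 \<le> bern q U (\<lambda>B. of_bool (\<Phi> A B))" using q by (intro bern_nonneg) auto
      then show ?thesis using False \<open>0 \<le> \<epsilon>2\<close> by simp
    next
      case True
      have "bern q U (\<lambda>B. of_bool (\<Phi> A B)) = bern q U (\<lambda>B. 1 - of_bool (\<not> \<Phi> A B))"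
        by (intro bern_cong) auto
      also have "\<dots> = 1 - bern q U (\<lambda>B. of_bool (\<not> \<Phi> A B))"
        using \<open>finite U\<close> by (simp add: bern_diff bern_const)
      finally show ?thesis using ok[OF A True] True by simp
    qed
  qed
  moreover have "bern p U (\<lambda>A. (1 - of_bool (\<not> good A)) - \<epsilon>2) = 1 - bern p U (\<lambda>A. of_bool (\<not> good A)) - \<epsilon>2"
    using \<open>finite U\<close> by (simp add: bern_diff bern_const)
  ultimately show ?thesis using good by linarith
qed

text \<open>Once the first mask is fixed with \<open>B\<close> close to \<open>X X^t\<close>, the
  projection is deterministic. The error is then the residual of \<open>T\<close> under it minus the
  projected centered noise. The coefficient 6 is 3 modes times the 2 of
  \<open>signal_part\<close>.\<close>

lemma good_mask_estimate:
  fixes T :: "nat list \<Rightarrow> real" and r \<eta> \<Lambda> \<delta>1 \<delta>2 :: real and A :: "nat list set"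
  assumes d: "1 \<le> d" and k: "3 \<le> k" and sym: "symmetric_tensor d k T"
    and r: "r \<le> r_max d k"
  defines "a \<equiv> k div 2" and "b \<equiv> k - k div 2" and "U \<equiv> multi_index d k"
  defines "X \<equiv> unfold d a b T"
  assumes rk: "real (vec_space.rank (d ^ a) X) \<le> r"
    and op: "0 < op_norm X" "\<Lambda> = (op_norm X)\<^sup>2"
    and \<eta>: "0 < \<eta>" "\<eta> \<le> 1/4"
    and \<delta>2: "0 < \<delta>2" "\<delta>2 \<le> 1" and M: "0 \<le> M" and "0 < w"
    and T: "\<And>u. u \<in> U \<Longrightarrow> \<bar>T u\<bar> \<le> M"
    and small: "M \<le> \<delta>2 * sqrt w" and var: "M\<^sup>2 * (r * sqrt (real d ^ k)) \<le> \<delta>2 * w"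
  defines "B \<equiv> gram_estimate \<delta>1 (unfold d a b (restrict_tensor A T))"
  assumes dev: "\<And>y. \<bar>ip (d ^ a) y (mv (d ^ a) (\<lambda>i j. B $$ (i, j)) y)
      - (\<Sum>l<d ^ b. (\<Sum>i<d ^ a. X $$ (i, l) * y i)\<^sup>2)\<bar> \<le> \<eta> * \<Lambda> * ip (d ^ a) y y"
    and bd: "sqrt (6 * r * \<Lambda> * (\<eta> powr (1/3))\<^sup>2) + s * sqrt w \<le> bound"
  shows "bern \<delta>2 U (\<lambda>E. of_bool (\<not> tensor_norm d k
      (\<lambda>u. T u - estimator d k \<delta>1 \<delta>2 (\<eta> powr (2/3)) A {v. v \<notin> A \<and> v \<in> E} T u) \<le> bound))
    \<le> 2 * exp (1 - s)"
proof -
  define n where "n = d ^ a"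
  define e where "e = k - 2 * a"
  define g where "g = d ^ e"
  have kab: "k = a + b" "b = a + e" "k = a + (a + e)" by (auto simp: a_def b_def e_def)
  have m: "d ^ b = n * g" by (simp add: kab(2) n_def g_def power_add)
  have K: "d ^ k = n * (n * g)" by (simp add: kab(3) n_def g_def power_add)
  have Xc: "X \<in> carrier_mat n (n * g)" using unfold_carrier[of d a b T] by (simp add: X_def n_def m)
  have Bc: "B \<in> carrier_mat n n"
    unfolding B_def n_def by (rule gram_estimate_carrier[OF unfold_carrier])
  have Bs: "sym_on n (\<lambda>i j. B $$ (i, j))"
    unfolding B_def n_def by (rule sym_gram_estimate[OF unfold_carrier])
  obtain P where P: "proj n P" and SP: "spectral_proj B (\<eta> powr (2/3) * op_norm B) = mat n n (\<lambda>(i, j). P i j)"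
    and trP: "(\<Sum>i<n. P i i) \<le> r"
    and resP: "(\<Sum>l<n * g. res n P (\<lambda>i. X $$ (i, l))) \<le> 2 * r * \<Lambda> * (\<eta> powr (1/3))\<^sup>2"
    by (rule signal_part[OF Bc Bs Xc \<eta> op(2,1) dev[unfolded m n_def[symmetric]] rk[unfolded n_def[symmetric]]])
  define R where "R = (if k = 3 then P else (\<lambda>i j. of_bool (i = j)))"
  define QQ where "QQ = kr (n * g) P (kr g P R)"
  have gn: "g = n" if "k = 3" using that by (simp add: g_def n_def e_def a_def)
  have R: "proj g R" using P gn proj_id by (auto simp: R_def)
  have QQ: "proj (d ^ k) QQ" unfolding QQ_def K by (intro proj_kr P R)
  define x where "x f = T (unflat d k f)" for f
  have x3: "x (i * (n * g) + (j * g + h)) = T (unflat d a i @ unflat d a j @ unflat d e h)"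
    if "i < n" "j < n" "h < g" for i j h
  proof -
    have "j * g + h < d ^ b"
    proof -
      have "j * g + h < j * g + g" using that by simp
      also have "\<dots> = Suc j * g" by simp
      also have "\<dots> \<le> n * g" using that by (intro mult_right_mono) auto
      finally show ?thesis by (simp add: m)
    qed
    then have "unflat d k (i * d ^ b + (j * g + h)) = unflat d a i @ unflat d b (j * g + h)"
      unfolding kab(1) using that by (intro unflat_append) (simp_all add: n_def)
    also have "unflat d b (j * g + h) = unflat d a j @ unflat d e h"
      unfolding kab(2) g_def using that by (intro unflat_append) (simp_all add: n_def g_def)
    finally show ?thesis by (simp add: x_def m)
  qed
  have mem: "unflat d a i @ unflat d a j @ unflat d e h \<in> multi_index d k" if "i < n" "j < n" "h < g" for i j h
    unfolding kab(3) using that by (intro multi_index_append unflat_multi_index) (simp_all add: n_def g_def)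
  have s12: "x (i * (n * g) + (j * g + h)) = x (j * (n * g) + (i * g + h))" if "i < n" "j < n" "h < g" for i j h
    unfolding x3[OF that] x3[OF that(2,1,3)]
    by (rule symmetric_tensor_mset[OF sym mem]) (use that in simp_all)
  have s13: "x (i * (n * g) + (j * g + h)) = x (h * (n * g) + (j * g + i))"
    if "k = 3" "i < n" "j < n" "h < n" for i j h
  proof -
    have ea: "e = a" using that(1) by (simp add: e_def a_def)
    have h: "h < g" "i < g" using that gn by auto
    show ?thesis
      unfolding x3[OF that(2,3) h(1)] x3[OF that(4,3) h(2)]
      by (rule symmetric_tensor_mset[OF sym mem]) (use that h in \<open>simp_all add: ea\<close>)
  qed
  have "res (d ^ k) QQ x \<le> 3 * (\<Sum>l<n * g. res n P (\<lambda>i. x (i * (n * g) + l)))"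
    unfolding QQ_def K
  proof (rule res_kr3_le[where x = x and Q = P and R = R, OF P])
    show "x (i * (n * g) + (j * g + h)) = x (j * (n * g) + (i * g + h))" if "i < n" "j < n" "h < g" for i j h
      by (rule s12[OF that])
    show "R = (\<lambda>i j. of_bool (i = j)) \<or> R = P \<and> g = n \<and>
      (\<forall>i<n. \<forall>j<n. \<forall>h<n. x (i * (n * g) + (j * g + h)) = x (h * (n * g) + (j * g + i)))"
    proof (cases "k = 3")
      case True
      then show ?thesis using gn s13 by (simp add: R_def)
    next
      case False
      then show ?thesis by (simp add: R_def)
    qed
  qed
  also have "(\<Sum>l<n * g. res n P (\<lambda>i. x (i * (n * g) + l))) = (\<Sum>l<n * g. res n P (\<lambda>i. X $$ (i, l)))"
  proof (intro sum.cong refl)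
    fix l assume "l \<in> {..<n * g}"
    then have l: "l < d ^ b" by (simp add: m)
    have "x (i * (n * g) + l) = X $$ (i, l)" if "i < n" for i
      using that l unfolding m[symmetric] x_def X_def unfolding kab(1) n_def by (simp add: unflat_append unfold_index)
    then show "res n P (\<lambda>i. x (i * (n * g) + l)) = res n P (\<lambda>i. X $$ (i, l))"
      unfolding res_def mv_def by (intro sum.cong refl) simp
  qed
  finally have resx: "res (d ^ k) QQ x \<le> 6 * r * \<Lambda> * (\<eta> powr (1/3))\<^sup>2" using resP by linarith
  have sig: "nrm (d ^ k) (\<lambda>f. x f - mv (d ^ k) QQ x f) \<le> sqrt (6 * r * \<Lambda> * (\<eta> powr (1/3))\<^sup>2)"
    unfolding nrm_def using resx by (intro real_sqrt_le_mono) (simp add: ip_def res_def power2_eq_square)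
  have tr: "(\<Sum>f<d ^ k. QQ f f) \<le> r * sqrt (real d ^ k)"
  proof -
    define \<tau> where "\<tau> = (\<Sum>i<n. P i i)"
    have "0 \<le> \<tau>" unfolding \<tau>_def using proj_diag[OF P] by (intro sum_nonneg) auto
    have trR: "(\<Sum>h<g. R h h) = (if k = 3 then \<tau> else real (d ^ (k - 2 * (k div 2))))"
      using gn by (auto simp: R_def \<tau>_def g_def e_def a_def)
    have "(\<Sum>f<d ^ k. QQ f f) = \<tau> * (\<tau> * (if k = 3 then \<tau> else real (d ^ (k - 2 * (k div 2)))))"
      unfolding QQ_def K trace_kr trR \<tau>_def ..
    also have "\<dots> \<le> r * sqrt (real d ^ k)"
      using trP \<open>0 \<le> \<tau>\<close> by (intro trace_factor_le d k r) (simp_all add: \<tau>_def)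
    finally show ?thesis .
  qed
  have noise: "bern \<delta>2 (multi_index d k) (\<lambda>E. of_bool (\<not> nrm (d ^ k) (\<lambda>e. \<Sum>f<d ^ k.
      QQ e f * (of_bool (unflat d k f \<notin> A) * (of_bool (unflat d k f \<in> E) / \<delta>2 - 1) * T (unflat d k f))) \<le> s * sqrt w))
    \<le> 2 * exp (1 - s)"
  proof (rule noise_part[OF QQ \<delta>2 M \<open>0 < w\<close> _ small])
    have "M\<^sup>2 * (\<Sum>f<d ^ k. QQ f f) \<le> M\<^sup>2 * (r * sqrt (real d ^ k))" using tr by (intro mult_left_mono) auto
    then show "M\<^sup>2 * (\<Sum>f<d ^ k. QQ f f) \<le> \<delta>2 * w" using var by linarith
  qed (use T in \<open>simp add: U_def\<close>)
  have "bern \<delta>2 U (\<lambda>E. of_bool (\<not> tensor_norm d k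
      (\<lambda>u. T u - estimator d k \<delta>1 \<delta>2 (\<eta> powr (2/3)) A {v. v \<notin> A \<and> v \<in> E} T u) \<le> bound))
    \<le> bern \<delta>2 U (\<lambda>E. of_bool (\<not> nrm (d ^ k) (\<lambda>e. \<Sum>f<d ^ k.
      QQ e f * (of_bool (unflat d k f \<notin> A) * (of_bool (unflat d k f \<in> E) / \<delta>2 - 1) * T (unflat d k f))) \<le> s * sqrt w))"
  proof (intro bern_mono)
    fix E
    define \<nu> where "\<nu> f = of_bool (unflat d k f \<notin> A) * (of_bool (unflat d k f \<in> E) / \<delta>2 - 1) * T (unflat d k f)" for f
    have est: "T (unflat d k f) - estimator d k \<delta>1 \<delta>2 (\<eta> powr (2/3)) A {v. v \<notin> A \<and> v \<in> E} T (unflat d k f)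
        = (x f - mv (d ^ k) QQ x f) - (\<Sum>h<d ^ k. QQ f h * \<nu> h)" if f: "f < d ^ k" for f
    proof -
      have "estimator d k \<delta>1 \<delta>2 (\<eta> powr (2/3)) A {v. v \<notin> A \<and> v \<in> E} T (unflat d k f)
          = (\<Sum>h<d ^ k. QQ f h * (x h + \<nu> h))"
        unfolding QQ_def R_def x_def \<nu>_def
        by (rule estimator_expand[OF k d n_def[unfolded a_def] g_def[unfolded e_def a_def] SP[unfolded B_def a_def b_def] f])
      then show ?thesis by (simp add: x_def mv_def distrib_left sum.distrib)
    qed
    have "tensor_norm d k (\<lambda>u. T u - estimator d k \<delta>1 \<delta>2 (\<eta> powr (2/3)) A {v. v \<notin> A \<and> v \<in> E} T u)
        = nrm (d ^ k) (\<lambda>f. (x f - mv (d ^ k) QQ x f) - (\<Sum>h<d ^ k. QQ f h * \<nu> h))"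
      unfolding tensor_norm_nrm nrm_def using est by (intro arg_cong[of _ _ sqrt] ip_cong) auto
    also have "\<dots> \<le> nrm (d ^ k) (\<lambda>f. x f - mv (d ^ k) QQ x f) + nrm (d ^ k) (\<lambda>f. \<Sum>h<d ^ k. QQ f h * \<nu> h)"
      by (rule nrm_triangle_diff)
    finally show "of_bool (\<not> tensor_norm d k
      (\<lambda>u. T u - estimator d k \<delta>1 \<delta>2 (\<eta> powr (2/3)) A {v. v \<notin> A \<and> v \<in> E} T u) \<le> bound)
      \<le> (of_bool (\<not> nrm (d ^ k) (\<lambda>e. \<Sum>f<d ^ k.
      QQ e f * (of_bool (unflat d k f \<notin> A) * (of_bool (unflat d k f \<in> E) / \<delta>2 - 1) * T (unflat d k f))) \<le> s * sqrt w) :: real)"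
      unfolding \<nu>_def[symmetric] of_bool_less_eq_iff using sig bd by linarith
  qed (use \<delta>2 in auto)
  also have "\<dots> \<le> 2 * exp (1 - s)" using noise by (simp add: U_def)
  finally show ?thesis .
qed

text \<open>For the zero tensor the parameter conditions read \<open>0 \<le> 0\<close> and
  \<open>0 = 0\<close>, so \<alpha> and \<mu> are unconstrained and the analysis cannot start. The
  estimator, a matrix applied to zero data, is exact.\<close>

lemma zero_tensor_estimate:
  assumes d: "1 \<le> d" and k: "3 \<le> k" and T: "tensor_norm d k T = 0"
  shows "tensor_norm d k (\<lambda>u. T u - estimator d k \<delta>1 \<delta>2 c A {v. v \<notin> A \<and> v \<in> E} T u) = 0"
proof -
  define B where "B = gram_estimate \<delta>1 (unfold d (k div 2) (k - k div 2) (restrict_tensor A T))"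
  define n where "n = d ^ (k div 2)"
  have Bc: "B \<in> carrier_mat n n"
    unfolding B_def n_def by (rule gram_estimate_carrier[OF unfold_carrier])
  have Bs: "sym_on n (\<lambda>i j. B $$ (i, j))"
    unfolding B_def n_def by (rule sym_gram_estimate[OF unfold_carrier])
  obtain u a where eb: "eigenbasis n (\<lambda>i j. B $$ (i, j)) u a" using spectral_theorem[OF Bs] .
  have T0: "T (unflat d k f) = 0" if "f < d ^ k" for f
  proof -
    have "(\<Sum>f<d ^ k. (T (unflat d k f))\<^sup>2) = 0" using tensor_norm_sq[of d k T] T by simp
    then show ?thesis using that by (subst (asm) sum_nonneg_eq_0_iff) auto
  qed
  have "estimator d k \<delta>1 \<delta>2 c A {v. v \<notin> A \<and> v \<in> E} T (unflat d k f) = 0" if f: "f < d ^ k" for f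
    using estimator_expand[OF k d n_def refl spectral_proj_eq[OF Bc eb Bs, unfolded B_def] f, where B = E] T0
    by simp
  then have "(tensor_norm d k (\<lambda>u. T u - estimator d k \<delta>1 \<delta>2 c A {v. v \<notin> A \<and> v \<in> E} T u))\<^sup>2 = 0"
    unfolding tensor_norm_sq using T0 by simp
  then show ?thesis by simp
qed

theorem theorem4:
  fixes d k :: nat and T :: "nat list \<Rightarrow> real"
    and r \<alpha> \<mu> t \<delta> \<delta>1 \<delta>2 \<omega> \<eta> \<theta> :: real
    and M :: "'s measure" and I J :: "nat list \<Rightarrow> 's \<Rightarrow> bool"
  assumes "d \<ge> 1" and "k \<ge> 3"
    and "symmetric_tensor d k T"
    and "unfolding_params d k T r \<alpha> \<mu>"
    and "r \<le> r_max d k"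
    and "t \<ge> 1"
    and "\<omega> = \<alpha> * r / \<mu>"
    and "0 < \<delta>" and "\<delta> < 1"
    and "32 * (real k * ln (real d)) ^ 4 * t powr (1/2) * \<omega> / real d powr (real k / 2) \<le> \<delta>"
    and "\<delta> \<le> t * \<omega> / real d ^ (k div 2)"
    and "\<delta>1 = \<delta> / 2" and "\<delta>2 = \<delta>1 / (1 - \<delta>1)"
    and "prob_space M"
    and "prob_space.indep_vars M (\<lambda>_. count_space UNIV) (case_sum I J)
           (multi_index d k <+> multi_index d k)"
    and "\<And>u. u \<in> multi_index d k \<Longrightarrow>
           distr M (count_space UNIV) (I u) = measure_pmf (bernoulli_pmf \<delta>1)"
    and "\<And>u. u \<in> multi_index d k \<Longrightarrow>
           distr M (count_space UNIV) (J u) = measure_pmf (bernoulli_pmf \<delta>2)"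
    and "\<eta> = 8 * (real k * ln (real d)) ^ 4 * t powr (1/2) * \<omega> / (real d powr (real k / 2) * \<delta>)"
    and "\<theta> = \<alpha> * r / (\<delta> * real d powr (real k / 2))"
  shows "measure M {s \<in> space M.
           tensor_norm d k
             (\<lambda>u. T u - estimator d k \<delta>1 \<delta>2 (\<eta> powr (2/3)) {v. I v s} {v. \<not> I v s \<and> J v s} T u)
           \<le> 20 * (real k * ln (real d)) powr (4/3) * (t * \<mu>) powr (1/6) * \<theta> powr (1/3)
              * tensor_norm d k T}
         \<ge> 1 - 3 * real d ^ k * exp (- (1/8) * (real k * ln (real d))\<^sup>2)"
proof -
  interpret prob_space M by fact
  note d = \<open>d \<ge> 1\<close> and k = \<open>k \<ge> 3\<close>
  define L where "L = real k * ln (real d)"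
  define N where "N = real d ^ k"
  define F where "F = tensor_norm d k T"
  define U where "U = multi_index d k"
  define bound where "bound = 20 * L powr (4/3) * (t * \<mu>) powr (1/6) * \<theta> powr (1/3) * F"
  define \<Phi> where "\<Phi> A E \<longleftrightarrow> tensor_norm d k
      (\<lambda>u. T u - estimator d k \<delta>1 \<delta>2 (\<eta> powr (2/3)) A {v. v \<notin> A \<and> v \<in> E} T u) \<le> bound" for A E
  have \<delta>1: "0 < \<delta>1" "\<delta>1 < 1/2" using assms(8,9,12) by auto
  have \<delta>2: "0 < \<delta>2" "\<delta>2 \<le> 1" "\<delta> / 2 \<le> \<delta>2"
    using \<delta>1 assms(12,13) by (auto simp: divide_le_eq le_divide_eq)
  have finU: "finite U" by (simp add: U_def finite_multi_index)
  have neU: "U \<noteq> {}"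
  proof -
    have "replicate k 0 \<in> U" using d by (auto simp: U_def multi_index_def)
    then show ?thesis by blast
  qed
  have N0: "0 < N" using d by (simp add: N_def)
  have NL: "N = exp L" using d by (simp add: N_def L_def exp_of_nat_mult)
  have L0: "0 \<le> L" using d by (simp add: L_def)
  have event: "{s \<in> space M. tensor_norm d k
      (\<lambda>u. T u - estimator d k \<delta>1 \<delta>2 (\<eta> powr (2/3)) {v. I v s} {v. \<not> I v s \<and> J v s} T u) \<le> bound}
    = {s \<in> space M. \<Phi> {u\<in>U. I u s} {u\<in>U. J u s}}"
  proof -
    have "estimator d k \<delta>1 \<delta>2 (\<eta> powr (2/3)) {v. I v s} {v. \<not> I v s \<and> J v s} T u
      = estimator d k \<delta>1 \<delta>2 (\<eta> powr (2/3)) {u\<in>U. I u s} {v. v \<notin> {u\<in>U. I u s} \<and> v \<in> {u\<in>U. J u s}} T u" for s u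
      by (rule estimator_cong) (auto simp: U_def)
    then show ?thesis unfolding \<Phi>_def by simp
  qed
  have pr: "prob {s \<in> space M. tensor_norm d k
      (\<lambda>u. T u - estimator d k \<delta>1 \<delta>2 (\<eta> powr (2/3)) {v. I v s} {v. \<not> I v s \<and> J v s} T u) \<le> bound}
    = bern \<delta>1 U (\<lambda>A. bern \<delta>2 U (\<lambda>E. of_bool (\<Phi> A E)))"
    unfolding event
  proof (rule prob_bernoulli_masks[OF finU neU])
    show "indep_vars (\<lambda>_. count_space UNIV) (case_sum I J) (U <+> U)" using assms(15) by (simp add: U_def)
  qed (use \<delta>1 \<delta>2 assms(16,17) in \<open>auto simp: U_def\<close>)
  have "1 - 3 * N * exp (- (1/8) * L\<^sup>2) \<le> bern \<delta>1 U (\<lambda>A. bern \<delta>2 U (\<lambda>E. of_bool (\<Phi> A E)))"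
  proof (cases "L \<le> 8")
    case True
    \<comment> \<open>For \<open>L \<le> 8\<close> the claim is void:
      \<open>N exp (- L^2 / 8) = exp (L - L^2 / 8)\<close> is at least 1.\<close>
    have "L * L \<le> L * 8" using True L0 by (intro mult_left_mono) auto
    then have "0 \<le> L + - (1/8) * L\<^sup>2" by (simp add: power2_eq_square)
    then have "1 \<le> exp (L + - (1/8) * L\<^sup>2)" by simp
    then have "1 \<le> N * exp (- (1/8) * L\<^sup>2)" unfolding NL exp_add .
    moreover have "0 \<le> bern \<delta>1 U (\<lambda>A. bern \<delta>2 U (\<lambda>E. of_bool (\<Phi> A E)))"
      using \<delta>1 \<delta>2 by (intro bern_nonneg) auto
    ultimately show ?thesis by linarith
  next
    case False
    then have L8: "8 \<le> L" by simp
    show ?thesis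
    proof (cases "F = 0")
      case True
      then have "\<Phi> A E" for A E
        using zero_tensor_estimate[OF d k, of T] by (simp add: \<Phi>_def bound_def F_def)
      then show ?thesis using finU N0 by (simp add: bern_const)
    next
      case False
      have F0: "0 < F" using False by (simp add: F_def tensor_norm_def less_le)
      define a where "a = k div 2"
      define b where "b = k - a"
      define n where "n = d ^ a"
      define m where "m = d ^ b"
      have kab: "k = a + b" "a \<le> b" by (auto simp: a_def b_def)
      have n1: "1 \<le> n" "n \<le> m" using d kab by (auto simp: n_def m_def intro: power_increasing)
      have nm: "real n * real m = N" unfolding N_def kab(1) power_add by (simp add: n_def m_def)
      define X where "X = unfold d a b T"
      have Xc: "X \<in> carrier_mat n m" unfolding X_def n_def m_def by (rule unfold_carrier)
      have fX: "frob_norm X = F" unfolding X_def frob_unfold F_def kab(1)[symmetric] ..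
      define \<Lambda> where "\<Lambda> = (op_norm X)\<^sup>2"
      have par: "real (vec_space.rank n X) \<le> r" "N * (max_norm X)\<^sup>2 \<le> \<alpha> * F\<^sup>2" "\<mu> * F\<^sup>2 = r * \<Lambda>"
        using assms(4) unfolding unfolding_params_def Let_def a_def[symmetric] b_def[symmetric] X_def[symmetric]
        by (simp_all add: fX n_def N_def \<Lambda>_def)
      have F2: "F\<^sup>2 = (\<Sum>i<n. \<Sum>l<m. (X $$ (i, l))\<^sup>2)" using frob_norm_sq[OF Xc] fX by simp
      have mx: "(X $$ (i, l))\<^sup>2 \<le> (max_norm X)\<^sup>2" if "i < n" "l < m" for i l
        using power_mono[OF max_norm_ge[OF Xc that], of 2] by simp
      \<comment> \<open>The largest squared entry is at least the average one, which forces
        \<open>\<alpha> \<ge> 1\<close>.\<close>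
      have F2N: "F\<^sup>2 \<le> N * (max_norm X)\<^sup>2"
      proof -
        have "F\<^sup>2 \<le> (\<Sum>i<n. \<Sum>l<m. (max_norm X)\<^sup>2)" unfolding F2 by (intro sum_mono mx) auto
        then show ?thesis by (simp add: nm[symmetric] mult.assoc)
      qed
      have \<alpha>F: "F\<^sup>2 \<le> \<alpha> * F\<^sup>2" using F2N par(2) by linarith
      have F20: "0 < F\<^sup>2" using F0 by simp
      have \<alpha>1: "1 \<le> \<alpha>" using \<alpha>F F20 by simp
      obtain i0 l0 where il0: "i0 < n" "l0 < m" "X $$ (i0, l0) \<noteq> 0"
      proof -
        have "\<exists>i<n. \<exists>l<m. X $$ (i, l) \<noteq> 0"
        proof (rule ccontr)
          assume "\<not> ?thesis"
          then have "F\<^sup>2 = 0" unfolding F2 by (intro sum.neutral ballI) auto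
          then show False using F20 by simp
        qed
        then show ?thesis using that by blast
      qed
      \<comment> \<open>The unit vector that picks a nonzero column of \<open>X\<close>. It shows
        that the rank is at least 1 and that the operator norm is positive.\<close>
      define e0 :: "nat \<Rightarrow> real" where "e0 l = of_bool (l = l0)" for l
      have Xe0: "(\<Sum>l<m. X $$ (i, l) * e0 l) = X $$ (i, l0)" for i
        using il0 by (simp add: e0_def of_bool_def if_distrib[of "\<lambda>z. _ * z"] cong: if_cong)
      have r1: "1 \<le> r"
      proof -
        have "rank_bound n m (\<lambda>i l. X $$ (i, l)) r" by (rule rank_bound_mono[OF rank_bound_mat[OF Xc] par(1)])
        moreover have "c 0 = 0" if "\<forall>i<n. (\<Sum>j\<in>{0::nat}. c j * (\<Sum>l<m. X $$ (i, l) * e0 l)) = 0" for c :: "nat \<Rightarrow> real"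
          using that il0 by (auto simp: Xe0)
        ultimately have "real (card {0::nat}) \<le> r"
          unfolding rank_bound_def by (elim allE[of _ "{0}"] allE[of _ "\<lambda>_. e0"]) auto
        then show ?thesis by simp
      qed
      have op0: "0 < op_norm X"
      proof -
        have "ip m e0 e0 = 1"
          using il0 by (simp add: ip_def e0_def of_bool_def if_distrib[of "\<lambda>z. z * _"] cong: if_cong)
        then have "nrm n (\<lambda>i. X $$ (i, l0)) \<le> op_norm X"
          using op_norm_ge[OF Xc, of e0] by (simp add: Xe0 nrm_def)
        moreover have "nrm n (\<lambda>i. X $$ (i, l0)) \<noteq> 0"
          using ip_eq_0D[of n "\<lambda>i. X $$ (i, l0)" i0] il0 by (auto simp: nrm_def)
        ultimately show ?thesis using nrm_nonneg[of n "\<lambda>i. X $$ (i, l0)"] by linarith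
      qed
      have \<Lambda>0: "0 < \<Lambda>" using op0 by (simp add: \<Lambda>_def)
      have \<Lambda>F: "\<Lambda> \<le> F\<^sup>2"
      proof -
        have "op_norm X \<le> F"
        proof (rule op_norm_le[OF Xc])
          fix x
          have "ip n (\<lambda>i. \<Sum>l<m. X $$ (i, l) * x l) (\<lambda>i. \<Sum>l<m. X $$ (i, l) * x l) = (\<Sum>i<n. (\<Sum>l<m. X $$ (i, l) * x l)\<^sup>2)"
            by (simp add: ip_def power2_eq_square)
          also have "\<dots> \<le> (\<Sum>i<n. (\<Sum>l<m. (X $$ (i, l))\<^sup>2) * (\<Sum>l<m. (x l)\<^sup>2))"
            by (intro sum_mono Cauchy_Schwarz_ineq_sum)
          also have "\<dots> = F\<^sup>2 * ip m x x"
            unfolding F2 sum_distrib_right by (simp add: ip_def power2_eq_square)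
          finally have "(nrm n (\<lambda>i. \<Sum>l<m. X $$ (i, l) * x l))\<^sup>2 \<le> (F * nrm m x)\<^sup>2"
            by (simp add: nrm_sq power_mult_distrib)
          then show "nrm n (\<lambda>i. \<Sum>l<m. X $$ (i, l) * x l) \<le> F * nrm m x"
            by (rule power2_le_imp_le) (use F0 nrm_nonneg in auto)
        qed (use F0 in simp)
        then show ?thesis using op0 unfolding \<Lambda>_def by (intro power_mono) auto
      qed
      have \<mu>0: "0 < \<mu>"
      proof -
        have "0 < \<mu> * F\<^sup>2" unfolding par(3) using r1 \<Lambda>0 by simp
        then show ?thesis using F20 by (simp add: zero_less_mult_iff)
      qed
      \<comment> \<open>This identity eliminates \<mu> and \<open>r\<close> from the Gram estimate:
        its error scale, an entry bound times \<open>N\<close>, becomes a multiple of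
        \<Lambda>.\<close>
      have \<omega>\<Lambda>: "\<omega> * \<Lambda> = \<alpha> * F\<^sup>2"
      proof -
        have "\<mu> * (\<omega> * \<Lambda>) = \<alpha> * (r * \<Lambda>)" using assms(7) \<mu>0 by simp
        also have "\<dots> = \<mu> * (\<alpha> * F\<^sup>2)" unfolding par(3)[symmetric] by simp
        finally show ?thesis using \<mu>0 by simp
      qed
      have \<omega>1: "1 \<le> \<omega>"
      proof -
        have "1 * \<Lambda> \<le> \<omega> * \<Lambda>" unfolding \<omega>\<Lambda> using \<Lambda>F \<alpha>F by linarith
        then show ?thesis using \<Lambda>0 by (simp only: mult_le_cancel_right_pos)
      qed
      have t1: "1 \<le> t" "1 \<le> sqrt t" using assms(6) by auto
      have tp: "t powr (1/2) = sqrt t" using t1 by (simp add: powr_half_sqrt)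
      define q where "q = sqrt N"
      have q0: "0 < q" and qq: "q * q = N" using N0 by (simp_all add: q_def)
      have dq: "real d powr (real k / 2) = q" using powr_half_power[OF d, of k] by (simp add: q_def N_def)
      have lo: "32 * L ^ 4 * sqrt t * \<omega> \<le> \<delta> * q"
        using assms(10) q0 unfolding L_def[symmetric] dq tp by (simp add: divide_le_eq)
      have \<eta>: "\<eta> = 8 * L ^ 4 * sqrt t * \<omega> / (q * \<delta>)" using assms(18) unfolding L_def[symmetric] dq tp .
      have \<theta>: "\<theta> = \<omega> * \<mu> / (\<delta> * q)" using assms(19,7) \<mu>0 unfolding dq by simp
      have \<theta>0: "0 < \<theta>" unfolding \<theta> using \<omega>1 \<mu>0 q0 assms(8) by simp
      have \<eta>\<theta>: "\<eta> = 8 * L ^ 4 * sqrt t * \<theta> / \<mu>" unfolding \<eta> \<theta> using \<mu>0 by (simp add: mult_ac)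
      have \<eta>0: "0 < \<eta>" unfolding \<eta>\<theta> using L8 t1 \<theta>0 \<mu>0 by simp
      have \<eta>4: "\<eta> \<le> 1/4" unfolding \<eta> using lo q0 assms(8) by (simp add: divide_le_eq mult_ac)
      have L32: "32 * L ^ 4 \<le> \<delta> * q"
      proof -
        have "1 * 1 \<le> sqrt t * \<omega>" using t1 \<omega>1 by (intro mult_mono) auto
        then have "32 * L ^ 4 * 1 \<le> 32 * L ^ 4 * (sqrt t * \<omega>)" using L8 by (intro mult_left_mono) auto
        then show ?thesis using lo by (simp add: mult_ac)
      qed
      have \<delta>q2: "2 \<le> \<delta> * q"
      proof -
        have "8 ^ 4 \<le> L ^ 4" using L8 by (intro power_mono) auto
        then show ?thesis using L32 by simp
      qed
      \<comment> \<open>The entry bound granted by \<alpha>, rather than the true maximum, so that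
        \<open>N * Mx^2\<close> equals \<open>\<omega> * \<Lambda>\<close> exactly.\<close>
      define Mx where "Mx = sqrt (\<alpha> * F\<^sup>2 / N)"
      have Mx2: "Mx\<^sup>2 = \<alpha> * F\<^sup>2 / N" using \<alpha>1 N0 by (simp add: Mx_def)
      have Mx0: "0 < Mx" using \<alpha>1 N0 F0 by (simp add: Mx_def)
      have XM: "\<bar>X $$ (i, l)\<bar> \<le> Mx" if "i < n" "l < m" for i l
      proof -
        have "(max_norm X)\<^sup>2 \<le> Mx\<^sup>2" unfolding Mx2 using par(2) N0 by (simp add: le_divide_eq mult.commute)
        then have "(X $$ (i, l))\<^sup>2 \<le> Mx\<^sup>2" using mx[OF that] by linarith
        then show ?thesis using Mx0 by (simp add: abs_le_square_iff[symmetric])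
      qed
      define x where "x i l = T (unflat d a i @ unflat d b l)" for i l
      have Xx: "X $$ (i, l) = x i l" if "i < n" "l < m" for i l
        using that by (simp add: X_def x_def unfold_index n_def m_def)
      interpret mm: masked_matrix n m x Mx \<delta>1
        using Mx0 \<delta>1 XM Xx by unfold_locales auto
      define f where "f = (\<lambda>(i, l). unflat d a i @ unflat d b l)"
      have Uf: "U = f ` mm.cell" and injf: "inj_on f mm.cell"
        unfolding U_def f_def mm.cell_def unfolding n_def m_def kab(1)
        by (rule multi_index_image, rule inj_on_unflat_append)
      define G where "G A \<longleftrightarrow> (\<forall>y. \<bar>ip n y (mv n (mm.Bf A) y) - (\<Sum>l<m. (\<Sum>i<n. x i l * y i)\<^sup>2)\<bar> \<le> \<eta> * \<Lambda> * ip n y y)" for A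
      \<comment> \<open>Carries a mask on multi-indices over to matrix cells; along the bijection
        \<open>f\<close> the law is preserved.\<close>
      define cells where "cells A = {y \<in> mm.cell. f y \<in> A}" for A
      have G_prob: "bern \<delta>1 U (\<lambda>A. of_bool (\<not> G (cells A))) \<le> 2 * real n * exp (- (L\<^sup>2 / 8)) + 2 * real n * exp (1 - 4 * L\<^sup>2)"
      proof -
        have "bern \<delta>1 U (\<lambda>A. of_bool (\<not> G (cells A))) = bern \<delta>1 mm.cell (\<lambda>A. of_bool (\<not> G (cells (f ` A))))"
          unfolding Uf by (rule bern_image[OF mm.finite_cell injf])
        also have "\<dots> = bern \<delta>1 mm.cell (\<lambda>A. of_bool (\<not> G A))"
        proof (intro bern_cong)
          fix A assume "A \<subseteq> mm.cell"
          then have "cells (f ` A) = A" using injf by (auto simp: cells_def inj_on_def)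
          then show "of_bool (\<not> G (cells (f ` A))) = (of_bool (\<not> G A) :: real)" by simp
        qed
        also have "\<dots> \<le> 2 * real n * exp (- (L\<^sup>2 / 8)) + 2 * real n * exp (1 - 4 * L\<^sup>2)"
        proof -
          \<comment> \<open>The choice of \<eta> comes from here:
            \<open>\<delta>1 = \<delta> / 2\<close> turns the 4 of \<open>gram_tail\<close> into the
            8 of \<eta>.\<close>
          have scale: "4 * L ^ 4 * sqrt t * sqrt (real n * real m) * Mx\<^sup>2 / \<delta>1 = \<eta> * \<Lambda>"
          proof -
            have "4 * L ^ 4 * sqrt t * sqrt (real n * real m) * Mx\<^sup>2 / \<delta>1 = 8 * L ^ 4 * sqrt t * (\<omega> * \<Lambda>) * q / (q * q * \<delta>)"
              unfolding nm Mx2 q_def[symmetric] \<omega>\<Lambda> qq assms(12) by simp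
            also have "\<dots> = \<eta> * \<Lambda>" unfolding \<eta> using q0 by simp
            finally show ?thesis .
          qed
          have up: "(\<Sum>l<m. (\<Sum>i<n. x i l * y i)\<^sup>2) \<le> \<Lambda> * ip n y y" for y
          proof -
            have Xup: "ip n (\<lambda>i. \<Sum>l<m. X $$ (i, l) * z l) (\<lambda>i. \<Sum>l<m. X $$ (i, l) * z l) \<le> \<Lambda> * ip m z z" for z
              using power_mono[OF op_norm_ge[OF Xc, of z], of 2] by (simp add: nrm_nonneg nrm_sq power_mult_distrib \<Lambda>_def)
            have "(\<Sum>l<m. (\<Sum>i<n. X $$ (i, l) * y i)\<^sup>2) \<le> \<Lambda> * ip n y y"
              by (rule transpose_bound[where X = "\<lambda>i l. X $$ (i, l)", OF Xup]) (use \<Lambda>0 in simp)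
            then show ?thesis by (simp add: Xx)
          qed
          have \<Lambda>1: "\<Lambda> \<le> real n * real m * Mx\<^sup>2" unfolding nm Mx2 using \<Lambda>F \<alpha>F N0 by simp
          \<comment> \<open>The upper bound on \<delta> enters here: it makes
            \<open>\<delta>1 * \<Lambda>\<close> at most \<open>t\<close> times the largest possible
            squared row norm \<open>m * Mx^2\<close>.\<close>
          have \<Lambda>2: "\<delta>1 * \<Lambda> \<le> t * real m * Mx\<^sup>2"
          proof -
            have rn: "real n = real d ^ (k div 2)" by (simp add: n_def a_def)
            have n0: "0 < real n" using n1 by simp
            have "\<delta>1 \<le> t * \<omega> / real n" using assms(8,11,12) unfolding rn by linarith
            then have "\<delta>1 * \<Lambda> \<le> t * \<omega> / real n * \<Lambda>" using \<Lambda>0 by (intro mult_right_mono) auto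
            also have "\<dots> = t * (\<omega> * \<Lambda>) / real n" by simp
            also have "\<dots> = t * real m * Mx\<^sup>2" unfolding \<omega>\<Lambda> Mx2 nm[symmetric] using n0 n1 by (simp add: field_simps)
            finally show ?thesis .
          qed
          have \<rho>N: "16 * L ^ 4 \<le> sqrt (real n * real m) * \<delta>1"
            unfolding nm q_def[symmetric] assms(12) using L32 by (simp add: mult.commute)
          have nmL: "real n * real m = exp L" using nm NL by simp
          show ?thesis
            using mm.gram_tail[OF n1 L8 nmL t1(1) \<rho>N up \<Lambda>1 \<Lambda>2 less_imp_le[OF \<Lambda>0]] unfolding scale G_def .
        qed
        finally show ?thesis .
      qed
      define z where "z = \<eta> powr (1/3)"
      have z: "0 < z" "z < 3/4" "z ^ 3 = \<eta>" using cube_root_quarter[OF \<eta>0 \<eta>4] by (simp_all add: z_def)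
      have bound_eq: "bound = 10 * sqrt \<mu> * z * F"
        unfolding bound_def z_def \<eta>\<theta> using rate_identity[of L t \<theta> \<mu>] L8 t1 \<theta>0 \<mu>0 by simp
      \<comment> \<open>The noise variance: this \<open>w\<close> makes
        \<open>\<delta> / 2 * w\<close> equal to \<open>Mx^2\<close> times the trace bound
        \<open>r * q\<close>, and \<open>\<delta>2 \<ge> \<delta> / 2\<close>.\<close>
      define w where "w = 2 * \<theta> * F\<^sup>2"
      have w0: "0 < w" using \<theta>0 F0 by (simp add: w_def)
      have TM: "\<bar>T u\<bar> \<le> Mx" if "u \<in> U" for u
      proof -
        from that obtain y where y: "u = f y" "y \<in> mm.cell" unfolding Uf by (rule imageE)
        obtain i l where "y = (i, l)" by (rule prod.exhaust)
        with y have "u = f (i, l)" "(i, l) \<in> mm.cell" by simp_all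
        then show ?thesis using XM Xx by (auto simp: f_def x_def mm.cell_def)
      qed
      have wq: "\<delta> * w * q = 2 * (\<alpha> * r) * F\<^sup>2"
      proof -
        have "\<theta> * (\<delta> * q) = \<alpha> * r" unfolding \<theta> assms(7) using assms(8) q0 \<mu>0 by simp
        then have "2 * (\<theta> * (\<delta> * q)) * F\<^sup>2 = 2 * (\<alpha> * r) * F\<^sup>2" by simp
        then show ?thesis by (simp add: w_def mult_ac)
      qed
      have var: "Mx\<^sup>2 * (r * sqrt (real d ^ k)) \<le> \<delta>2 * w"
      proof -
        have "Mx\<^sup>2 * (r * sqrt (real d ^ k)) = \<alpha> * F\<^sup>2 / (q * q) * (r * q)"
          unfolding Mx2 qq by (simp add: N_def q_def)
        also have "\<dots> = (\<alpha> * r) * F\<^sup>2 / q" using q0 by simp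
        also have "\<dots> = (\<delta> * w * q / 2) / q" unfolding wq by simp
        also have "\<dots> = \<delta> / 2 * w" using q0 by simp
        also have "\<dots> \<le> \<delta>2 * w" using \<delta>2 w0 by (intro mult_right_mono) auto
        finally show ?thesis .
      qed
      have small: "Mx \<le> \<delta>2 * sqrt w"
      proof (rule power2_le_imp_le)
        have "Mx\<^sup>2 * (2 * 2) \<le> Mx\<^sup>2 * ((\<delta> * q) * (2 * r))"
          using \<delta>q2 r1 by (intro mult_left_mono mult_mono) auto
        also have "\<dots> = \<delta> * q * (2 * (\<alpha> * r) * F\<^sup>2) / N" unfolding Mx2 by simp
        also have "\<dots> = \<delta> * q * (\<delta> * w * q) / (q * q)" unfolding wq qq ..
        also have "\<dots> = \<delta>\<^sup>2 * w" using q0 by (simp add: power2_eq_square)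
        finally have "Mx\<^sup>2 \<le> (\<delta> / 2)\<^sup>2 * w" by (simp add: power_divide)
        also have "\<dots> \<le> \<delta>2\<^sup>2 * w" using \<delta>2 w0 assms(8) by (intro mult_right_mono power_mono) auto
        finally show "Mx\<^sup>2 \<le> (\<delta>2 * sqrt w)\<^sup>2" using w0 by (simp add: power_mult_distrib)
      qed (use \<delta>2 w0 in simp)
      \<comment> \<open>Of the total \<open>10 sqrt \<mu> z F\<close>, the signal takes at most 3
        parts and the noise at level \<open>s = L^2\<close> at most 1.\<close>
      have bd: "sqrt (6 * r * \<Lambda> * (\<eta> powr (1/3))\<^sup>2) + L\<^sup>2 * sqrt w \<le> bound"
      proof -
        have "6 * r * \<Lambda> * z\<^sup>2 \<le> (3 * sqrt \<mu> * z * F)\<^sup>2"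
        proof -
          have "6 * r * \<Lambda> * z\<^sup>2 = 6 * (\<mu> * F\<^sup>2) * z\<^sup>2" by (simp add: par(3))
          also have "\<dots> \<le> 9 * (\<mu> * F\<^sup>2) * z\<^sup>2" using \<mu>0 by (intro mult_right_mono) auto
          also have "\<dots> = (3 * sqrt \<mu> * z * F)\<^sup>2" using \<mu>0 by (simp add: power_mult_distrib)
          finally show ?thesis .
        qed
        then have 1: "sqrt (6 * r * \<Lambda> * z\<^sup>2) \<le> 3 * sqrt \<mu> * z * F"
          using \<mu>0 z F0 by (intro real_le_lsqrt) auto
        have "L\<^sup>2 * sqrt w \<le> sqrt \<mu> * z * F"
        proof (rule power2_le_imp_le)
          have "2 * L ^ 4 * \<theta> * 1 \<le> 2 * L ^ 4 * \<theta> * (4 * sqrt t)"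
          proof (intro mult_left_mono)
            show "1 \<le> 4 * sqrt t" using t1(2) by linarith
          qed (use L8 \<theta>0 in simp)
          also have "\<dots> = \<eta> * \<mu>" unfolding \<eta>\<theta> using \<mu>0 by simp
          also have "\<dots> = (z\<^sup>2 * z) * \<mu>" unfolding z(3)[symmetric] by (simp add: power3_eq_cube power2_eq_square)
          also have "\<dots> \<le> (z\<^sup>2 * 1) * \<mu>" using z \<mu>0 by (intro mult_right_mono mult_left_mono) auto
          finally have "2 * L ^ 4 * \<theta> \<le> z\<^sup>2 * \<mu>" by simp
          then have "2 * L ^ 4 * \<theta> * F\<^sup>2 \<le> z\<^sup>2 * \<mu> * F\<^sup>2" by (rule mult_right_mono) simp
          moreover have "(L\<^sup>2 * sqrt w)\<^sup>2 = 2 * L ^ 4 * \<theta> * F\<^sup>2"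
            using w0 by (simp add: power_mult_distrib) (simp add: w_def flip: power_mult)
          moreover have "(sqrt \<mu> * z * F)\<^sup>2 = z\<^sup>2 * \<mu> * F\<^sup>2" using \<mu>0 by (simp add: power_mult_distrib)
          ultimately show "(L\<^sup>2 * sqrt w)\<^sup>2 \<le> (sqrt \<mu> * z * F)\<^sup>2" by linarith
        qed (use \<mu>0 z F0 in simp)
        moreover have "0 \<le> sqrt \<mu> * z * F" using \<mu>0 z F0 by simp
        ultimately show ?thesis using 1 unfolding bound_eq z_def[symmetric] by linarith
      qed
      have ok: "bern \<delta>2 U (\<lambda>E. of_bool (\<not> \<Phi> A E)) \<le> 2 * exp (1 - L\<^sup>2)" if A: "G (cells A)" for A
        unfolding \<Phi>_def
      proof (rule good_mask_estimate[OF d k assms(3,5), folded a_def b_def, folded X_def n_def m_def U_def,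
            OF par(1) op0 \<Lambda>_def \<eta>0 \<eta>4 \<delta>2(1,2) less_imp_le[OF Mx0] w0 TM small var _ bd])
        fix y
        define B where "B = gram_estimate \<delta>1 (unfold d a b (restrict_tensor A T))"
        have cells_iff: "(i, l) \<in> cells A \<longleftrightarrow> unflat d a i @ unflat d b l \<in> A" if "i < d ^ a" "l < d ^ b" for i l
          using that unfolding n_def[symmetric] m_def[symmetric] by (simp add: cells_def mm.cell_def f_def)
        have Bij: "B $$ (i, j) = mm.Bf (cells A) i j" if "i < n" "j < n" for i j
          unfolding B_def n_def m_def
        proof (rule gram_estimate_Bf)
          show "masked_matrix (d ^ a) (d ^ b) x Mx \<delta>1" using mm.masked_matrix_axioms by (simp add: n_def m_def)
        qed (use that in \<open>auto simp: n_def m_def x_def cells_iff\<close>)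
        have "ip n y (mv n (\<lambda>i j. B $$ (i, j)) y) = ip n y (mv n (mm.Bf (cells A)) y)"
          unfolding ip_def mv_def by (intro sum.cong refl) (simp add: Bij)
        moreover have "(\<Sum>l<m. (\<Sum>i<n. X $$ (i, l) * y i)\<^sup>2) = (\<Sum>l<m. (\<Sum>i<n. x i l * y i)\<^sup>2)"
          by (simp add: Xx)
        ultimately show "\<bar>ip n y (mv n (\<lambda>i j. gram_estimate \<delta>1 (unfold d a b (restrict_tensor A T)) $$ (i, j)) y)
            - (\<Sum>l<m. (\<Sum>i<n. X $$ (i, l) * y i)\<^sup>2)\<bar> \<le> \<eta> * \<Lambda> * ip n y y"
          using A unfolding G_def B_def by simp
      qed
      have "1 - (2 * real n * exp (- (L\<^sup>2 / 8)) + 2 * real n * exp (1 - 4 * L\<^sup>2)) - 2 * exp (1 - L\<^sup>2)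
          \<le> bern \<delta>1 U (\<lambda>A. bern \<delta>2 U (\<lambda>E. of_bool (\<Phi> A E)))"
        using \<delta>1 \<delta>2 ok by (intro prob_mask_mono[where good = "\<lambda>A. G (cells A)"] finU G_prob) auto
      moreover have "2 * real n * exp (- (L\<^sup>2 / 8)) + 2 * real n * exp (1 - 4 * L\<^sup>2) + 2 * exp (1 - L\<^sup>2)
          \<le> 3 * N * exp (- (1/8) * L\<^sup>2)"
      proof -
        define E where "E = exp (- (L\<^sup>2 / 8))"
        have E0: "0 \<le> E" by (simp add: E_def)
        have L64: "64 \<le> L\<^sup>2" using power_mono[OF L8, of 2] by simp
        have e1: "exp (1 - 4 * L\<^sup>2) \<le> E" "exp (1 - L\<^sup>2) \<le> E" unfolding E_def using L64 by simp_all
        \<comment> \<open>The three failure probabilities add up to at most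
          \<open>6 n exp (- L^2 / 8)\<close>, and \<open>m \<ge> 2\<close> turns this into
          \<open>3 n m exp (- L^2 / 8)\<close>.\<close>
        have m2: "2 \<le> real m"
        proof (rule ccontr)
          assume "\<not> ?thesis"
          then have "m \<le> 1" by linarith
          then have "real n * real m \<le> 1 * 1" using n1 by (intro mult_mono) auto
          moreover have "1 < exp L" using L8 by simp
          ultimately show False using nm NL by simp
        qed
        have "2 * real n * E + 2 * real n * exp (1 - 4 * L\<^sup>2) + 2 * exp (1 - L\<^sup>2)
            \<le> 2 * real n * E + 2 * real n * E + 2 * real n * E"
        proof (intro add_mono order.refl)
          show "2 * real n * exp (1 - 4 * L\<^sup>2) \<le> 2 * real n * E" using e1 by (intro mult_left_mono) auto
          show "2 * exp (1 - L\<^sup>2) \<le> 2 * real n * E" using e1 n1 E0 by (intro mult_mono) auto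
        qed
        also have "\<dots> = 3 * (real n * 2) * E" by simp
        also have "\<dots> \<le> 3 * (real n * real m) * E" using m2 E0 by (intro mult_right_mono mult_left_mono) auto
        finally show ?thesis unfolding nm by (simp add: E_def)
      qed
      ultimately show ?thesis by linarith
    qed
  qed
  then show ?thesis
    unfolding pr[symmetric] unfolding bound_def L_def F_def N_def .
qed

end
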